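(* Let $p$ be an odd prime and let $X$ and $Y$ be polyhedra with free actions of $\mathbb Z/p$. If $\operatorname{hind} X$ and $\operatorname{hind} Y$ are both odd, then \[ \operatorname{hind} (X*Y) = \operatorname{hind} X + \operatorname{hind} Y + 1. \]
   Context: Polyhedra are finite simplicial complexes, and group actions preserve some finite triangulation. For a polyhedron $X$ with a free action of $G=\mathbb Z/p$, the equivariant map $X\to EG$ (unique up to equivariant homotopy) induces $H^*(BG;\mathbb F_p)\to H^*(X/G;\mathbb F_p)$, and $\operatorname{hind} X=\max\{k : H^k(BG;\mathbb F_p)\to H^k(X/G;\mathbb F_p)\text{ is nonzero}\}$. The join $X*Y$ is $X\times Y\times[0,1]/\sim$ where $(x,y_1,0)\sim(x,y_2,0)$ and $(x_1,y,1)\sim(x_2,y,1)$; writing points as $(1-t)x\oplus ty$, $G$ acts by $g\cdot((1-t)x\oplus ty)=(1-t)(gx)\oplus t(gy)$. *)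

theory Defs
  imports "HOL-Analysis.Analysis" "HOL-Homology.Homology" "HOL-Algebra.Group_Action" "HOL-Computational_Algebra.Primes"
begin

section \<open>Quotient spaces\<close>

definition quotient_topology :: "'a topology \<Rightarrow> ('a \<Rightarrow> 'b) \<Rightarrow> 'b topology" where
  "quotient_topology X q =
     topology (\<lambda>U. U \<subseteq> q ` topspace X \<and> openin X {x \<in> topspace X. q x \<in> U})"

lemma openin_quotient_topology:
  "openin (quotient_topology X q) U \<longleftrightarrow>
     U \<subseteq> q ` topspace X \<and> openin X {x \<in> topspace X. q x \<in> U}"
proof -
  have "istopology (\<lambda>U. U \<subseteq> q ` topspace X \<and> openin X {x \<in> topspace X. q x \<in> U})"
    unfolding istopology_def
  proof (rule conjI; clarify)
    fix S T
    assume "openin X {x \<in> topspace X. q x \<in> S}" "openin X {x \<in> topspace X. q x \<in> T}"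
      and "S \<subseteq> q ` topspace X"
    moreover have "{x \<in> topspace X. q x \<in> S \<inter> T} =
        {x \<in> topspace X. q x \<in> S} \<inter> {x \<in> topspace X. q x \<in> T}"
      by auto
    ultimately show "S \<inter> T \<subseteq> q ` topspace X \<and> openin X {x \<in> topspace X. q x \<in> S \<inter> T}"
      by auto
  next
    fix \<U>
    assume *: "\<forall>K\<in>\<U>. K \<subseteq> q ` topspace X \<and> openin X {x \<in> topspace X. q x \<in> K}"
    have "{x \<in> topspace X. q x \<in> \<Union>\<U>} = (\<Union>K\<in>\<U>. {x \<in> topspace X. q x \<in> K})"
      by auto
    moreover have "openin X (\<Union>K\<in>\<U>. {x \<in> topspace X. q x \<in> K})"
      using * by blast
    ultimately show "\<Union>\<U> \<subseteq> q ` topspace X \<and> openin X {x \<in> topspace X. q x \<in> \<Union>\<U>}"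
      using * by auto
  qed
  then show ?thesis
    by (simp add: quotient_topology_def topology_inverse')
qed

lemma topspace_quotient_topology [simp]:
  "topspace (quotient_topology X q) = q ` topspace X"
proof (rule antisym)
  show "topspace (quotient_topology X q) \<subseteq> q ` topspace X"
    by (metis openin_quotient_topology openin_topspace)
  have "{x \<in> topspace X. q x \<in> q ` topspace X} = topspace X"
    by auto
  then have "openin (quotient_topology X q) (q ` topspace X)"
    by (simp add: openin_quotient_topology)
  then show "q ` topspace X \<subseteq> topspace (quotient_topology X q)"
    by (rule openin_subset)
qed

lemma quotient_map_quotient_topology: "quotient_map X (quotient_topology X q) q"
  by (auto simp: quotient_map_def openin_quotient_topology)

section \<open>Singular cohomology\<close>

definition cochain_group ::
    "nat \<Rightarrow> 'a topology \<Rightarrow> ('g, 'm) monoid_scheme \<Rightarrow> (((nat \<Rightarrow> real) \<Rightarrow> 'a) \<Rightarrow> 'g) monoid" where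
  "cochain_group n X A = product_group (singular_simplex_set n X) (\<lambda>_. A)"

text \<open>The coefficient group is written multiplicatively, so this is the alternating sum of the
  values of the cochain on the faces.\<close>

definition coboundary ::
    "nat \<Rightarrow> 'a topology \<Rightarrow> ('g, 'm) monoid_scheme \<Rightarrow>
     (((nat \<Rightarrow> real) \<Rightarrow> 'a) \<Rightarrow> 'g) \<Rightarrow> ((nat \<Rightarrow> real) \<Rightarrow> 'a) \<Rightarrow> 'g" where
  "coboundary n X A c =
     (\<lambda>\<sigma>\<in>singular_simplex_set (Suc n) X.
        finprod A (\<lambda>i. c (singular_face (Suc n) i \<sigma>) [^]\<^bsub>A\<^esub> ((-1) ^ i :: int)) {..Suc n})"

definition cocycle_set ::
    "nat \<Rightarrow> 'a topology \<Rightarrow> ('g, 'm) monoid_scheme \<Rightarrow> (((nat \<Rightarrow> real) \<Rightarrow> 'a) \<Rightarrow> 'g) set" where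
  "cocycle_set n X A =
     kernel (cochain_group n X A) (cochain_group (Suc n) X A) (coboundary n X A)"

definition coboundary_set ::
    "nat \<Rightarrow> 'a topology \<Rightarrow> ('g, 'm) monoid_scheme \<Rightarrow> (((nat \<Rightarrow> real) \<Rightarrow> 'a) \<Rightarrow> 'g) set" where
  "coboundary_set n X A =
     (case n of
        0 \<Rightarrow> {\<one>\<^bsub>cochain_group 0 X A\<^esub>}
      | Suc m \<Rightarrow> coboundary m X A ` carrier (cochain_group m X A))"

definition cohomology_group ::
    "nat \<Rightarrow> 'a topology \<Rightarrow> ('g, 'm) monoid_scheme \<Rightarrow> (((nat \<Rightarrow> real) \<Rightarrow> 'a) \<Rightarrow> 'g) set monoid" where
  "cohomology_group n X A =
     subgroup_generated (cochain_group n X A) (cocycle_set n X A) Mod coboundary_set n X A"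

definition cochain_pullback ::
    "nat \<Rightarrow> 'a topology \<Rightarrow> ('a \<Rightarrow> 'b) \<Rightarrow> (((nat \<Rightarrow> real) \<Rightarrow> 'b) \<Rightarrow> 'g) \<Rightarrow>
     ((nat \<Rightarrow> real) \<Rightarrow> 'a) \<Rightarrow> 'g" where
  "cochain_pullback n X f c = (\<lambda>\<sigma>\<in>singular_simplex_set n X. c (simplex_map n f \<sigma>))"

text \<open>The map $f^* : H^n(Y;A) \to H^n(X;A)$ induced by a continuous $f : X \to Y$. Cohomology classes
  are cosets of coboundaries; the pullbacks of the members of a class all lie in one coset, and
  multiplying by the coboundaries of $X$ fills it up.\<close>

definition cohomology_induced ::
    "nat \<Rightarrow> 'a topology \<Rightarrow> ('g, 'm) monoid_scheme \<Rightarrow> ('a \<Rightarrow> 'b) \<Rightarrow>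
     (((nat \<Rightarrow> real) \<Rightarrow> 'b) \<Rightarrow> 'g) set \<Rightarrow> (((nat \<Rightarrow> real) \<Rightarrow> 'a) \<Rightarrow> 'g) set" where
  "cohomology_induced n X A f C =
     coboundary_set n X A <#>\<^bsub>cochain_group n X A\<^esub> (cochain_pullback n X f ` C)"

section \<open>Free actions\<close>

definition free_action :: "('g, 'm) monoid_scheme \<Rightarrow> 'a topology \<Rightarrow> ('g \<Rightarrow> 'a \<Rightarrow> 'a) \<Rightarrow> bool" where
  "free_action G X \<phi> \<longleftrightarrow>
     group_action G (topspace X) \<phi> \<and>
     (\<forall>g\<in>carrier G. continuous_map X X (\<phi> g)) \<and>
     (\<forall>g\<in>carrier G - {\<one>\<^bsub>G\<^esub>}. \<forall>x\<in>topspace X. \<phi> g x \<noteq> x)"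

definition orbit_space :: "('g, 'm) monoid_scheme \<Rightarrow> 'a topology \<Rightarrow> ('g \<Rightarrow> 'a \<Rightarrow> 'a) \<Rightarrow> 'a set topology" where
  "orbit_space G X \<phi> = quotient_topology X (orbit G \<phi>)"

definition equivariant_map ::
    "('g, 'm) monoid_scheme \<Rightarrow> 'a topology \<Rightarrow> ('g \<Rightarrow> 'a \<Rightarrow> 'a) \<Rightarrow>
     'b topology \<Rightarrow> ('g \<Rightarrow> 'b \<Rightarrow> 'b) \<Rightarrow> ('a \<Rightarrow> 'b) \<Rightarrow> bool" where
  "equivariant_map G X \<phi> Y \<psi> f \<longleftrightarrow>
     continuous_map X Y f \<and> (\<forall>g\<in>carrier G. \<forall>x\<in>topspace X. f (\<phi> g x) = \<psi> g (f x))"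

text \<open>A finite triangulation \<open>h : |K| \<rightarrow> X\<close> in which every group element acts simplicially:
  it carries each simplex onto a simplex by an affine map.\<close>

definition invariant_triangulation ::
    "('g, 'm) monoid_scheme \<Rightarrow> 'a topology \<Rightarrow> ('g \<Rightarrow> 'a \<Rightarrow> 'a) \<Rightarrow>
     'n::euclidean_space set set \<Rightarrow> ('n \<Rightarrow> 'a) \<Rightarrow> bool" where
  "invariant_triangulation G X \<phi> K h \<longleftrightarrow>
     simplicial_complex K \<and>
     homeomorphic_map (top_of_set (\<Union>K)) X h \<and>
     (\<forall>g\<in>carrier G. \<forall>S\<in>K. \<exists>f c. linear f \<and> (\<lambda>x. f x + c) ` S \<in> K \<and>
        (\<forall>x\<in>S. \<phi> g (h x) = h (f x + c)))"

section \<open>The universal space of a finite cyclic group\<close>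

text \<open>As a model of $EG$ for $G = \mathbb{Z}/p$ we take the nonzero complex sequences with the
  topology of pointwise convergence, on which the residue $j$ acts as multiplication by
  $e^{2 \pi i j / p}$; the lemmas below show that it is Hausdorff and contractible and that the
  action is free. Since $G$ is finite, $EG \to BG$ is then a principal $G$-bundle.\<close>

definition EG_space :: "(nat \<Rightarrow> complex) topology" where
  "EG_space = top_of_set (- {\<lambda>_. 0})"

definition EG_act :: "nat \<Rightarrow> int \<Rightarrow> (nat \<Rightarrow> complex) \<Rightarrow> nat \<Rightarrow> complex" where
  "EG_act p j = (\<lambda>z\<in>topspace EG_space. \<lambda>n. cis (2 * pi * of_int j / of_nat p) * z n)"

lemma Hausdorff_EG_space: "Hausdorff_space EG_space"
  by (simp add: EG_space_def Hausdorff_space_subtopology)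

lemma contractible_EG_space: "contractible_space EG_space"
proof -
  define T :: "(nat \<Rightarrow> complex) \<Rightarrow> nat \<Rightarrow> complex" where
    "T z n = (case n of 0 \<Rightarrow> 0 | Suc m \<Rightarrow> z m)" for z n
  define e :: "nat \<Rightarrow> complex" where "e n = (if n = 0 then 1 else 0)" for n
  let ?E = "- {\<lambda>_. 0} :: (nat \<Rightarrow> complex) set"
  have T0: "T z 0 = 0" and TS: "T z (Suc m) = z m" for z m
    by (simp_all add: T_def)
  have contT: "continuous_on UNIV T"
  proof (rule continuous_on_coordinatewise_then_product)
    fix n show "continuous_on UNIV (\<lambda>z. T z n)"
      by (cases n) (auto simp: T_def)
  qed
  have 1: "homotopic_with_canon (\<lambda>_. True) ?E ?E id T"
  proof -
    let ?h = "\<lambda>(t::real, z::nat \<Rightarrow> complex) n. complex_of_real (1 - t) * z n + complex_of_real t * T z n"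
    have nz: "?h (t, z) \<noteq> (\<lambda>_. 0)" if "z \<noteq> (\<lambda>_. 0)" for t z
    proof
      assume "?h (t, z) = (\<lambda>_. 0)"
      then have eq: "complex_of_real (1 - t) * z n + complex_of_real t * T z n = 0" for n
        by (metis (mono_tags, lifting) case_prod_conv)
      have "z n = 0" for n
      proof (cases "t = 1")
        case True
        then show ?thesis using eq[of "Suc n"] by (simp add: TS)
      next
        case False
        then have ne: "complex_of_real (1 - t) \<noteq> 0"
          by (metis eq_iff_diff_eq_0 of_real_eq_0_iff)
        show ?thesis
        proof (induction n)
          case 0
          show ?case using eq[of 0] ne by (simp add: T0)
        next
          case (Suc n)
          then show ?case using eq[of "Suc n"] ne by (simp add: TS)
        qed
      qed
      with that show False by auto
    qed
    have c: "continuous_on ({0..1} \<times> ?E) ?h"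
    proof (rule continuous_on_coordinatewise_then_product)
      fix n
      have a: "continuous_on ({0..1} \<times> ?E) (\<lambda>x. snd x m)" for m
        by (rule continuous_on_product_then_coordinatewise[OF continuous_on_snd[OF continuous_on_id]])
      have b: "continuous_on ({0..1} \<times> ?E) (\<lambda>x. T (snd x) n)"
        by (cases n) (auto simp: T_def intro: a)
      have "continuous_on ({0..1} \<times> ?E)
         (\<lambda>x. complex_of_real (1 - fst x) * snd x n + complex_of_real (fst x) * T (snd x) n)"
        by (intro continuous_intros a b)
      then show "continuous_on ({0..1} \<times> ?E) (\<lambda>x. ?h x n)"
        by (simp add: case_prod_beta)
    qed
    have "?h \<in> {0..1} \<times> ?E \<rightarrow> ?E"
      using nz by blast
    then have "continuous_map (prod_topology (top_of_set {0..1}) (top_of_set ?E)) (top_of_set ?E) ?h"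
      using c by (simp add: prod_topology_subtopology_eu continuous_map_subtopology_eu)
    then show ?thesis
      unfolding homotopic_with_def by (intro exI[where x = ?h]) auto
  qed
  have 2: "homotopic_with_canon (\<lambda>_. True) ?E ?E T (\<lambda>_. e)"
  proof -
    let ?h = "\<lambda>(t::real, z::nat \<Rightarrow> complex) n. complex_of_real (1 - t) * T z n + complex_of_real t * e n"
    have nz: "?h (t, z) \<noteq> (\<lambda>_. 0)" if "z \<noteq> (\<lambda>_. 0)" for t z
    proof
      assume "?h (t, z) = (\<lambda>_. 0)"
      then have eq: "complex_of_real (1 - t) * T z n + complex_of_real t * e n = 0" for n
        by (metis (mono_tags, lifting) case_prod_conv)
      have t: "t = 0" using eq[of 0] by (simp add: T0 e_def)
      have "z n = 0" for n using eq[of "Suc n"] t by (simp add: TS e_def)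
      with that show False by auto
    qed
    have c: "continuous_on ({0..1} \<times> ?E) ?h"
    proof (rule continuous_on_coordinatewise_then_product)
      fix n
      have a: "continuous_on ({0..1} \<times> ?E) (\<lambda>x. snd x m)" for m
        by (rule continuous_on_product_then_coordinatewise[OF continuous_on_snd[OF continuous_on_id]])
      have b: "continuous_on ({0..1} \<times> ?E) (\<lambda>x. T (snd x) n)"
        by (cases n) (auto simp: T_def intro: a)
      have "continuous_on ({0..1} \<times> ?E)
         (\<lambda>x. complex_of_real (1 - fst x) * T (snd x) n + complex_of_real (fst x) * e n)"
        by (intro continuous_intros b)
      then show "continuous_on ({0..1} \<times> ?E) (\<lambda>x. ?h x n)"
        by (simp add: case_prod_beta)
    qed
    have "?h \<in> {0..1} \<times> ?E \<rightarrow> ?E"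
      using nz by blast
    then have "continuous_map (prod_topology (top_of_set {0..1}) (top_of_set ?E)) (top_of_set ?E) ?h"
      using c by (simp add: prod_topology_subtopology_eu continuous_map_subtopology_eu)
    then show ?thesis
      unfolding homotopic_with_def by (intro exI[where x = ?h]) auto
  qed
  show ?thesis
    unfolding EG_space_def contractible_space_def
    using homotopic_with_trans[OF 1 2] by blast
qed

lemma free_action_EG:
  assumes "p > 0"
  shows "free_action (integer_mod_group p) EG_space (EG_act p)"
proof -
  let ?G = "integer_mod_group p" and ?E = "topspace EG_space"
  let ?w = "\<lambda>j::int. cis (2 * pi * of_int j / of_nat p)"
  have E: "?E = - {\<lambda>_. 0}"
    by (simp add: EG_space_def)
  have carr: "carrier ?G = {0..<int p}"
    using assms by (simp add: carrier_integer_mod_group)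
  have one: "\<one>\<^bsub>?G\<^esub> = 0"
    by simp
  have w_add: "?w (i + j) = ?w i * ?w j" for i j
    by (simp add: cis_mult add_divide_distrib distrib_left)
  have w_mult: "?w (int p * j) = 1" for j
  proof -
    have "2 * pi * of_int (int p * j) / of_nat p = 2 * pi * of_int j"
      using assms by simp
    then show ?thesis
      by (metis Ints_of_int cis_multiple_2pi)
  qed
  have w_mod: "?w (j mod int p) = ?w j" for j
    using w_add[of "int p * (j div int p)" "j mod int p"] w_mult[of "j div int p"] by simp
  have w_neg: "?w j * ?w (- j) = 1" for j
    using w_add[of j "- j"] by simp
  have mem: "(\<lambda>n. ?w j * z n) \<in> ?E" if "z \<in> ?E" for j z
  proof
    have "?w j \<noteq> 0" by simp
    moreover obtain n where "z n \<noteq> 0" using \<open>z \<in> ?E\<close> E by auto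
    ultimately have "(\<lambda>n. ?w j * z n) \<noteq> (\<lambda>_. 0)"
      by (metis mult_eq_0_iff)
    then show "(\<lambda>n. ?w j * z n) \<in> topspace EG_space" using E by simp
  qed simp
  have act: "EG_act p j z = (\<lambda>n. ?w j * z n)" if "z \<in> ?E" for j z
    using that by (simp add: EG_act_def)
  have bij: "EG_act p j \<in> Bij ?E" for j
  proof -
    have "bij_betw (EG_act p j) ?E ?E"
    proof (rule bij_betw_byWitness[where f' = "EG_act p (- j)"])
      have inv: "EG_act p (- j) (EG_act p j z) = z" if "z \<in> ?E" for j z
      proof -
        have "EG_act p (- j) (EG_act p j z) = (\<lambda>n. ?w (- j) * (?w j * z n))"
          by (simp only: act[OF that] act[OF mem[OF that]])
        also have "\<dots> = (\<lambda>n. (?w j * ?w (- j)) * z n)"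
          by (simp only: mult.assoc mult.left_commute)
        finally show ?thesis
          by (simp only: w_neg mult_1)
      qed
      show "\<forall>a\<in>?E. EG_act p (- j) (EG_act p j a) = a"
        using inv by blast
      show "\<forall>a\<in>?E. EG_act p j (EG_act p (- j) a) = a"
        using inv[of _ "- j"] by simp
    qed (auto simp only: act intro: mem)
    then show ?thesis
      by (simp add: Bij_def EG_act_def)
  qed
  have "group_hom ?G (BijGroup ?E) (EG_act p)"
  proof (rule group_hom.intro)
    show "group_hom_axioms ?G (BijGroup ?E) (EG_act p)"
    proof (rule group_hom_axioms.intro, rule homI)
      show "EG_act p x \<in> carrier (BijGroup ?E)" for x
        by (simp add: BijGroup_def bij)
    next
      fix i j
      have "EG_act p (i \<otimes>\<^bsub>?G\<^esub> j) = compose ?E (EG_act p i) (EG_act p j)"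
      proof
        fix z
        show "EG_act p (i \<otimes>\<^bsub>?G\<^esub> j) z = compose ?E (EG_act p i) (EG_act p j) z"
        proof (cases "z \<in> ?E")
          case True
          have "EG_act p (i \<otimes>\<^bsub>?G\<^esub> j) z = (\<lambda>n. ?w ((i + j) mod int p) * z n)"
            using assms by (simp only: act[OF True] mult_integer_mod_group)
          also have "\<dots> = (\<lambda>n. ?w i * (?w j * z n))"
            by (subst w_mod, subst w_add) (rule ext, rule mult.assoc)
          also have "\<dots> = compose ?E (EG_act p i) (EG_act p j) z"
            by (simp only: compose_eq[OF True] act[OF True] act[OF mem[OF True]])
          finally show ?thesis .
        next
          case False
          then show ?thesis by (simp add: compose_def EG_act_def)
        qed
      qed
      then show "EG_act p (i \<otimes>\<^bsub>?G\<^esub> j) = EG_act p i \<otimes>\<^bsub>BijGroup ?E\<^esub> EG_act p j"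
        by (simp add: BijGroup_def bij)
    qed
  qed (simp_all add: group_BijGroup)
  moreover have "continuous_map EG_space EG_space (EG_act p j)" for j
  proof -
    have "continuous_on (- {\<lambda>_. 0}) (\<lambda>z n. ?w j * (z :: nat \<Rightarrow> complex) n)"
    proof (rule continuous_on_coordinatewise_then_product)
      fix n
      have "continuous_on (- {\<lambda>_. 0}) (\<lambda>z :: nat \<Rightarrow> complex. z n)"
        by (rule continuous_on_product_then_coordinatewise[OF continuous_on_id])
      then show "continuous_on (- {\<lambda>_. 0}) (\<lambda>z :: nat \<Rightarrow> complex. ?w j * z n)"
        by (intro continuous_intros)
    qed
    then have "continuous_map EG_space EG_space (\<lambda>z n. ?w j * z n)"
      using mem E by (auto simp: EG_space_def continuous_map_in_subtopology)
    then show ?thesis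
      by (rule continuous_map_eq) (simp add: act)
  qed
  moreover have "EG_act p j z \<noteq> z" if "j \<in> carrier ?G - {\<one>\<^bsub>?G\<^esub>}" "z \<in> ?E" for j z
  proof
    assume eq: "EG_act p j z = z"
    obtain n where n: "z n \<noteq> 0" using \<open>z \<in> ?E\<close> E by auto
    have "?w j * z n = z n" using eq act[OF \<open>z \<in> ?E\<close>] by metis
    then have "?w j = 1" using n by simp
    then have "cos (2 * pi * of_int j / of_nat p) = 1"
      by (metis cis.sel(1) one_complex.sel(1))
    then obtain m :: int where "2 * pi * of_int j / of_nat p = of_int m * 2 * pi"
      using cos_one_2pi_int by auto
    then have "real_of_int j = of_int m * of_nat p"
      using assms by (simp add: field_simps)
    then have "j = m * int p"
      by (metis of_int_eq_iff of_int_mult of_int_of_nat_eq)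
    then have "j = 0"
      using that(1) carr by (metis DiffD1 atLeastLessThan_iff mod_mult_self2_is_0 mod_pos_pos_trivial)
    with that(1) show False by simp
  qed
  ultimately show ?thesis
    by (simp add: free_action_def group_action_def)
qed

section \<open>The homological index\<close>

text \<open>An equivariant map \<open>f\<close> sends orbits to orbits, so the map of orbit spaces induced by it
  is \<open>image f\<close>. For a free polyhedron any two equivariant maps to $EG$ are equivariantly
  homotopic, so the choice of \<open>f\<close> is immaterial.\<close>

definition hind_degrees :: "nat \<Rightarrow> 'a topology \<Rightarrow> (int \<Rightarrow> 'a \<Rightarrow> 'a) \<Rightarrow> nat set" where
  "hind_degrees p X \<phi> =
     (let G = integer_mod_group p;
          XG = orbit_space G X \<phi>;
          BG = orbit_space G EG_space (EG_act p)
      in {k. \<exists>f. equivariant_map G X \<phi> EG_space (EG_act p) f \<and>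
             (\<exists>C\<in>carrier (cohomology_group k BG (integer_mod_group p)).
                cohomology_induced k XG (integer_mod_group p) (image f) C
                  \<noteq> \<one>\<^bsub>cohomology_group k XG (integer_mod_group p)\<^esub>)})"

text \<open>For a polyhedron with a free action the maximum fails to exist only if the space is empty; the
  dummy value \<open>0\<close> is even, so an odd index always is a genuine maximum.\<close>

definition hind :: "nat \<Rightarrow> 'a topology \<Rightarrow> (int \<Rightarrow> 'a \<Rightarrow> 'a) \<Rightarrow> nat" where
  "hind p X \<phi> = (if hind_degrees p X \<phi> = {} then 0 else Max (hind_degrees p X \<phi>))"

section \<open>Joins\<close>

text \<open>The equivalence class of \<open>(x, y, t)\<close>, i.e. the point $(1-t)x \oplus ty$ of the join.\<close>

definition join_point :: "'a topology \<Rightarrow> 'b topology \<Rightarrow> 'a \<times> 'b \<times> real \<Rightarrow> ('a \<times> 'b \<times> real) set" where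
  "join_point X Y = (\<lambda>(x, y, t).
     {(x', y', t'). x' \<in> topspace X \<and> y' \<in> topspace Y \<and> t' = t \<and>
        (t = 0 \<and> x' = x \<or> t = 1 \<and> y' = y \<or> x' = x \<and> y' = y)})"

definition join_space :: "'a topology \<Rightarrow> 'b topology \<Rightarrow> ('a \<times> 'b \<times> real) set topology" where
  "join_space X Y =
     quotient_topology (prod_topology X (prod_topology Y (top_of_set {0..1}))) (join_point X Y)"

definition join_action ::
    "'a topology \<Rightarrow> ('g \<Rightarrow> 'a \<Rightarrow> 'a) \<Rightarrow> 'b topology \<Rightarrow> ('g \<Rightarrow> 'b \<Rightarrow> 'b) \<Rightarrow>
     'g \<Rightarrow> ('a \<times> 'b \<times> real) set \<Rightarrow> ('a \<times> 'b \<times> real) set" where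
  "join_action X \<phi> Y \<psi> g =
     (\<lambda>C\<in>topspace (join_space X Y). (\<lambda>(x, y, t). (\<phi> g x, \<psi> g y, t)) ` C)"

end

theory Submission
  imports Defs "HOL-Library.Function_Algebras"
begin

text \<open>
  Simplices lift to a free cyclic cover uniquely up to deck transformations, so the \<open>\<bbbF>\<^sub>p\<close>-cochains of
  an orbit space are the invariant cochains upstairs. An equivariant chain map from the singular
  chains of a free \<open>\<int>/p\<close>-space to the periodic resolution of \<open>\<int>/p\<close> is a sequence of cochains
  \<open>v\<^sub>0, v\<^sub>1, \<dots>\<close> with \<open>N v\<^sub>0 = 1\<close>, \<open>\<delta> v\<^sub>2\<^sub>i = (T - 1) v\<^sub>2\<^sub>i\<^sub>+\<^sub>1\<close> and \<open>\<delta> v\<^sub>2\<^sub>i\<^sub>+\<^sub>1 = N v\<^sub>2\<^sub>i\<^sub>+\<^sub>2\<close>, where \<open>T\<close> is the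
  generator and \<open>N\<close> the norm. The generator of \<open>H\<^sup>k(BG)\<close> pulls back to \<open>N v\<^sub>k\<close>, and as \<open>EG\<close> is contractible
  nothing else comes from \<open>BG\<close>: the index is the largest \<open>k\<close> such that \<open>N v\<^sub>k\<close> is not the coboundary of an
  invariant cochain.

  Upper bound: the even classes are powers of the class \<open>t\<close> of degree two. The join is covered by two
  invariant open sets that map equivariantly to \<open>X\<close> and to \<open>Y\<close>; since \<open>t\<^sup>a\<close> vanishes on the first and
  \<open>t\<^sup>b\<close> on the second, \<open>t\<^sup>a\<^sup>+\<^sup>b\<close> vanishes on the join. The same argument for a finite cover by trivial
  pieces shows that the index of a compact space is a genuine maximum.

  Lower bound: over a field, non-vanishing of \<open>N v\<^sub>n\<close> on \<open>Y\<close> is detected by a chain \<open>d\<close> whose boundary is of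
  the form \<open>(T - 1) e\<close> modulo \<open>p\<close>, and \<open>D = N d\<close> is an invariant cycle modulo \<open>p\<close>. If \<open>v\<close> belongs to the join,
  then \<open>\<sigma> \<mapsto> v\<^sub>k\<^sub>+\<^sub>n\<^sub>+\<^sub>1(\<sigma> * D)\<close> is such a sequence on \<open>X\<close> up to a non-zero scalar; here \<open>n\<close> odd is needed for
  the parities to match. So if the class of degree \<open>m + n + 1\<close> vanishes on the join, then the class of
  degree \<open>m\<close> vanishes on \<open>X\<close>.
\<close>

section \<open>Cochains modulo p\<close>

text \<open>Singular cochain groups have no useful bases, so nothing is computed cell by cell. All
  that is used of the group is that \<open>T - 1\<close> and the norm \<open>N\<close> are exact
  against each other on the cochains of a free space. This makes comparison maps to the resolution
  exist and be unique up to homotopy, for \<open>X\<close>, \<open>Y\<close>, \<open>EG\<close> and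
  the join alike, and it removes the classifying map: for the lower bound it is enough to exhibit on
  \<open>X\<close> some sequence satisfying the relations. The obstacle there is that a class of
  invariant cochains on \<open>Y\<close> is not detected by invariant cycles, but by chains
  \<open>d\<close> that are closed only modulo the image of \<open>T - 1\<close>, and such chains
  cannot be joined equivariantly with simplices of \<open>X\<close>. Passing to \<open>N d\<close>
  repairs this, and no information is lost because the norm can be moved across the pairing:
  \<open>v_n (N d) = (N v_n) d\<close>. Joining with an \<open>n\<close>-dimensional chain raises
  the degree by \<open>n + 1\<close>; when this is even, \<open>T - 1\<close> and \<open>N\<close>
  keep their places in the relations.\<close>

text \<open>Cochains are integer-valued functions on simplices; being zero modulo \<open>p\<close> on the relevant
  simplices is the predicate \<open>nul\<close>, so that equality in \<open>C\<^sup>k(Z; \<bbbF>\<^sub>p)\<close> of two cochains means that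
  their difference is \<open>nul\<close>.\<close>

type_synonym 'a cochain = "((nat \<Rightarrow> real) \<Rightarrow> 'a) \<Rightarrow> int"

definition nul :: "nat \<Rightarrow> (((nat \<Rightarrow> real) \<Rightarrow> 'a) \<Rightarrow> bool) \<Rightarrow> 'a cochain \<Rightarrow> bool" where
  "nul p P c \<longleftrightarrow> (\<forall>\<sigma>. P \<sigma> \<longrightarrow> int p dvd c \<sigma>)"

definition pb :: "nat \<Rightarrow> ('a \<Rightarrow> 'b) \<Rightarrow> 'b cochain \<Rightarrow> 'a cochain" where
  "pb k f c = (\<lambda>\<sigma>. c (simplex_map k f \<sigma>))"

definition cobd :: "nat \<Rightarrow> 'a cochain \<Rightarrow> 'a cochain" where
  "cobd k c = (\<lambda>\<sigma>. \<Sum>i\<le>Suc k. (-1) ^ i * c (singular_face (Suc k) i \<sigma>))"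

definition nm :: "nat \<Rightarrow> ('a \<Rightarrow> 'a) \<Rightarrow> nat \<Rightarrow> 'a cochain \<Rightarrow> 'a cochain" where
  "nm p T k c = (\<lambda>\<sigma>. \<Sum>j<p. c (simplex_map k (T ^^ j) \<sigma>))"

text \<open>The differentials \<open>T - 1\<close> and \<open>1 + T + \<dots> + T\<^sup>p\<^sup>-\<^sup>1\<close> of the periodic resolution of the cyclic
  group.\<close>

definition op :: "nat \<Rightarrow> ('a \<Rightarrow> 'a) \<Rightarrow> nat \<Rightarrow> nat \<Rightarrow> 'a cochain \<Rightarrow> 'a cochain" where
  "op p T j k c = (if odd j then pb k T c - c else nm p T k c)"

section \<open>Pairing of cochains with integral chains\<close>

definition cev :: "('b \<Rightarrow> int) \<Rightarrow> ('b \<Rightarrow>\<^sub>0 int) \<Rightarrow> int" where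
  "cev c x = (\<Sum>\<sigma>\<in>Poly_Mapping.keys x. Poly_Mapping.lookup x \<sigma> * c \<sigma>)"

text \<open>Writing the pairing as a linear extension into the free group on one generator transfers
  additivity from \<open>frag_extend\<close>; the defining sum over the support of \<open>x\<close>
  is awkward for sums of chains, where supports can cancel.\<close>

lemma cev_frag_extend:
  "cev c x = Poly_Mapping.lookup (frag_extend (\<lambda>\<sigma>. frag_cmul (c \<sigma>) (frag_of ())) x) ()"
  by (simp add: cev_def frag_extend_def lookup_sum)

lemma cev_of [simp]: "cev c (frag_of \<sigma>) = c \<sigma>"
  by (simp add: cev_frag_extend)

lemma cev_0 [simp]: "cev c 0 = 0"
  by (simp add: cev_def)

lemma cev_add: "cev c (x + y) = cev c x + cev c y"
  by (simp add: cev_frag_extend frag_extend_add lookup_add)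

lemma cev_diff: "cev c (x - y) = cev c x - cev c y"
  by (simp add: cev_frag_extend frag_extend_diff lookup_minus)

lemma cev_cmul: "cev c (frag_cmul a x) = a * cev c x"
  by (simp add: cev_frag_extend frag_extend_cmul)

lemma cev_sum: "cev c (sum f I) = (\<Sum>i\<in>I. cev c (f i))"
  by (induction I rule: infinite_finite_induct) (simp_all add: cev_add)

lemma cev_sum_fun: "cev (\<lambda>\<sigma>. \<Sum>i\<in>I. f i \<sigma>) x = (\<Sum>i\<in>I. cev (f i) x)"
  unfolding cev_def sum_distrib_left by (rule sum.swap)

lemma cev_mult_fun: "cev (\<lambda>\<sigma>. a * f \<sigma>) x = a * cev f x"
  by (simp add: cev_def sum_distrib_left mult.left_commute)

lemma cev_diff_fun: "cev (\<lambda>\<sigma>. f \<sigma> - g \<sigma>) x = cev f x - cev g x"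
  by (simp add: cev_def sum_subtractf right_diff_distrib)

lemma cev_frag_extend_eq: "cev c (frag_extend f x) = cev (\<lambda>\<sigma>. cev c (f \<sigma>)) x"
  by (simp add: frag_extend_def cev_sum cev_cmul cev_def[of "\<lambda>\<sigma>. cev c (f \<sigma>)"])

lemma cev_chain_map: "cev c (chain_map k f x) = cev (pb k f c) x"
  by (simp add: chain_map_def cev_frag_extend_eq pb_def)

lemma cev_dvd: "(\<And>\<sigma>. \<sigma> \<in> Poly_Mapping.keys x \<Longrightarrow> a dvd c \<sigma>) \<Longrightarrow> a dvd cev c x"
  unfolding cev_def by (intro dvd_sum) auto

lemma cev_dvd_nul: "nul p (singular_simplex k Z) c \<Longrightarrow> singular_chain k Z x \<Longrightarrow> int p dvd cev c x"
  by (rule cev_dvd) (auto simp: nul_def singular_chain_def)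

lemma cev_cong_keys: "(\<And>\<sigma>. \<sigma> \<in> Poly_Mapping.keys x \<Longrightarrow> c \<sigma> = c' \<sigma>) \<Longrightarrow> cev c x = cev c' x"
  unfolding cev_def by (intro sum.cong) auto

lemma cev_chain_boundary: "cev c (chain_boundary (Suc k) x) = cev (cobd k c) x"
  by (simp add: chain_boundary_def cev_frag_extend_eq cobd_def cev_sum cev_cmul del: sum.atMost_Suc)

section \<open>Calculus of equality modulo p and linearity of the operators\<close>

lemma nul_add: "nul p P a \<Longrightarrow> nul p P b \<Longrightarrow> nul p P (a + b)"
  by (simp add: nul_def)

lemma nul_diff: "nul p P a \<Longrightarrow> nul p P b \<Longrightarrow> nul p P (a - b)"
  by (simp add: nul_def)

lemma nul_minus: "nul p P a \<Longrightarrow> nul p P (- a)"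
  by (simp add: nul_def)

lemma nul_0 [simp]: "nul p P 0" "nul p P (\<lambda>\<sigma>. 0)"
  by (simp_all add: nul_def)

lemma nul_mult2: "nul p P a \<Longrightarrow> nul p P (a * b)"
  by (simp add: nul_def)

lemma nul_sub: "nul p P (a - b) \<Longrightarrow> nul p P b \<Longrightarrow> nul p P a"
  using nul_add[of p P "a - b" b] by simp

lemma nul_sym: "nul p P (a - b) \<Longrightarrow> nul p P (b - a)"
  using nul_minus[of p P "a - b"] by simp

lemma nul_trans: "nul p P (a - b) \<Longrightarrow> nul p P (b - c) \<Longrightarrow> nul p P (a - c)"
  using nul_add[of p P "a - b" "b - c"] by simp

lemma pb_add: "pb k f (a + b) = pb k f a + pb k f b"
  and pb_diff: "pb k f (a - b) = pb k f a - pb k f b"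
  and pb_0: "pb k f 0 = 0"
  and pb_1: "pb k f 1 = 1"
  by (auto simp: pb_def fun_eq_iff)

lemma nm_add: "nm p T k (a + b) = nm p T k a + nm p T k b"
  and nm_diff: "nm p T k (a - b) = nm p T k a - nm p T k b"
  by (auto simp: nm_def fun_eq_iff sum.distrib sum_subtractf)

lemma cobd_add: "cobd k (a + b) = cobd k a + cobd k b"
  and cobd_diff: "cobd k (a - b) = cobd k a - cobd k b"
  by (auto simp: cobd_def fun_eq_iff sum.distrib sum_subtractf algebra_simps simp del: sum.atMost_Suc)

lemma op_add: "op p T j k (a + b) = op p T j k a + op p T j k b"
  and op_diff: "op p T j k (a - b) = op p T j k a - op p T j k b"
  by (simp_all add: op_def nm_add nm_diff pb_add pb_diff)

definition smul :: "int \<Rightarrow> 'a cochain \<Rightarrow> 'a cochain" where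
  "smul a c = (\<lambda>\<sigma>. a * c \<sigma>)"

lemma pb_smul: "pb k f (smul a c) = smul a (pb k f c)"
  and nm_smul: "nm p T k (smul a c) = smul a (nm p T k c)"
  and cobd_smul: "cobd k (smul a c) = smul a (cobd k c)"
  and smul_diff: "smul a (c - d) = smul a c - smul a d"
  and smul_add: "smul a (c + d) = smul a c + smul a d"
  by (auto simp: pb_def nm_def cobd_def smul_def fun_eq_iff sum_distrib_left algebra_simps simp del: sum.atMost_Suc)

lemma op_smul: "op p T j k (smul a c) = smul a (op p T j k c)"
  by (simp add: op_def pb_smul nm_smul smul_diff)

lemma nul_smul: "nul p P c \<Longrightarrow> nul p P (smul a c)"
  by (simp add: nul_def smul_def)

lemma singular_face_simplex_map':
  assumes "i \<le> Suc k"
  shows "singular_face (Suc k) i (simplex_map (Suc k) f \<sigma>) = simplex_map k f (singular_face (Suc k) i \<sigma>)"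
  using assms simplical_face_in_standard_simplex[of "Suc k" i]
  by (auto simp: singular_face_def simplex_map_def fun_eq_iff)

lemma singular_simplex_face:
  "singular_simplex (Suc k) Z \<sigma> \<Longrightarrow> i \<le> Suc k \<Longrightarrow> singular_simplex k Z (singular_face (Suc k) i \<sigma>)"
  using singular_simplex_singular_face[of "Suc k" Z \<sigma> i] by simp

lemma cobd_pb: "cobd k (pb k f c) = pb (Suc k) f (cobd k c)"
  by (auto simp: cobd_def pb_def fun_eq_iff singular_face_simplex_map' simp del: sum.atMost_Suc intro!: sum.cong)

lemma pb_pb: "pb k f (pb k g c) = pb k (g \<circ> f) c"
  by (simp add: pb_def simplex_map_compose)

lemma nm_eq_sum: "nm p T k c = (\<lambda>\<sigma>. \<Sum>j<p. pb k (T ^^ j) c \<sigma>)"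
  by (simp add: nm_def pb_def)

lemma cobd_sum: "cobd k (\<lambda>\<sigma>. \<Sum>j\<in>I. f j \<sigma>) = (\<lambda>\<sigma>. \<Sum>j\<in>I. cobd k (f j) \<sigma>)"
  by (auto simp: cobd_def fun_eq_iff sum_distrib_left simp del: sum.atMost_Suc intro!: sum.swap)

lemma cobd_nm: "cobd k (nm p T k c) = nm p T (Suc k) (cobd k c)"
  by (simp add: nm_eq_sum cobd_sum cobd_pb)

lemma cobd_op: "cobd k (op p T j k c) = op p T j (Suc k) (cobd k c)"
  by (simp add: op_def cobd_diff cobd_pb cobd_nm)

lemma nul_cobd: "nul p (singular_simplex k Z) c \<Longrightarrow> nul p (singular_simplex (Suc k) Z) (cobd k c)"
  by (auto simp: nul_def cobd_def simp del: sum.atMost_Suc intro!: dvd_sum dvd_mult singular_simplex_face)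

lemma nul_pb:
  "nul p (singular_simplex k Y) c \<Longrightarrow> continuous_map Z Y f \<Longrightarrow> nul p (singular_simplex k Z) (pb k f c)"
  by (auto simp: nul_def pb_def intro: singular_simplex_simplex_map)

lemma nul_cobd_cobd: "nul p (singular_simplex (Suc (Suc k)) Z) (cobd (Suc k) (cobd k c))"
  unfolding nul_def
proof (intro allI impI)
  fix \<sigma> assume "singular_simplex (Suc (Suc k)) Z \<sigma>"
  then have "chain_boundary (Suc k) (chain_boundary (Suc (Suc k)) (frag_of \<sigma>)) = 0"
    using chain_boundary_boundary[of "Suc (Suc k)" Z "frag_of \<sigma>"] by (simp add: singular_chain_of)
  then have "cobd (Suc k) (cobd k c) \<sigma> = 0"
    by (metis cev_0 cev_chain_boundary cev_of)
  then show "int p dvd cobd (Suc k) (cobd k c) \<sigma>" by simp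
qed

lemma cobd_one: "cobd 0 1 = 0"
  by (auto simp: cobd_def fun_eq_iff)

section \<open>Free cyclic actions\<close>

text \<open>The action is recorded by its generator alone, and all translates are powers
  \<open>T ^^ j\<close>. Nothing is assumed outside \<open>topspace Z\<close>, which is why
  periodicity holds only for simplices of \<open>Z\<close>.\<close>

locale free_cyclic =
  fixes p :: nat and Z :: "'a topology" and T :: "'a \<Rightarrow> 'a"
  assumes prime_p: "prime p"
    and cont: "continuous_map Z Z T"
    and period: "\<And>z. z \<in> topspace Z \<Longrightarrow> (T ^^ p) z = z"
    and free: "\<And>z j. z \<in> topspace Z \<Longrightarrow> 0 < j \<Longrightarrow> j < p \<Longrightarrow> (T ^^ j) z \<noteq> z"
begin

abbreviation "NL k \<equiv> nul p (singular_simplex k Z)"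
abbreviation "tw k \<equiv> pb k T"
abbreviation "nrm \<equiv> nm p T"
abbreviation "opr \<equiv> op p T"

lemma p_pos: "p > 0"
  using prime_p prime_gt_0_nat by blast

lemma cont_pow: "continuous_map Z Z (T ^^ j)"
proof (induction j)
  case (Suc j)
  then show ?case
    unfolding funpow.simps(2) by (rule continuous_map_compose[OF _ cont])
qed (simp add: id_def)

lemma T_mem: "z \<in> topspace Z \<Longrightarrow> (T ^^ j) z \<in> topspace Z"
  using cont_pow[of j] by (auto simp: continuous_map_def)

lemma simplex_pow: "singular_simplex k Z \<sigma> \<Longrightarrow> singular_simplex k Z (simplex_map k (T ^^ j) \<sigma>)"
  using cont_pow singular_simplex_simplex_map by blast

lemma simplex_map_pow_add:
  "simplex_map k (T ^^ i) (simplex_map k (T ^^ j) \<sigma>) = simplex_map k (T ^^ (i + j)) \<sigma>"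
  by (metis comp_apply funpow_add simplex_map_compose)

lemma simplex_map_pow_0:
  "singular_simplex k Z \<sigma> \<Longrightarrow> simplex_map k (T ^^ 0) \<sigma> = \<sigma>"
  "singular_simplex k Z \<sigma> \<Longrightarrow> simplex_map k (\<lambda>z. z) \<sigma> = \<sigma>"
  "singular_simplex k Z \<sigma> \<Longrightarrow> simplex_map k id \<sigma> = \<sigma>"
  by (rule simplex_map_id_gen[of k Z]; simp)+

lemma simplex_map_period: "singular_simplex k Z \<sigma> \<Longrightarrow> simplex_map k (T ^^ p) \<sigma> = \<sigma>"
  by (rule simplex_map_id_gen[of k Z]) (auto simp: period)

lemma pow_mod: "z \<in> topspace Z \<Longrightarrow> (T ^^ j) z = (T ^^ (j mod p)) z"
proof -
  assume z: "z \<in> topspace Z"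
  have *: "(T ^^ (p * i)) z = z" for i
  proof (induction i)
    case (Suc i)
    have "(T ^^ (p * Suc i)) z = (T ^^ p) ((T ^^ (p * i)) z)"
      by (simp add: funpow_add)
    then show ?case using Suc period z by simp
  qed simp
  have "(T ^^ j) z = (T ^^ (j mod p + p * (j div p))) z"
    by simp
  also have "\<dots> = (T ^^ (j mod p)) z"
    by (subst funpow_add) (simp add: *)
  finally show ?thesis .
qed

lemma simplex_map_pow_mod: "singular_simplex k Z \<sigma> \<Longrightarrow> simplex_map k (T ^^ j) \<sigma> = simplex_map k (T ^^ (j mod p)) \<sigma>"
  by (rule simplex_map_eq[of k Z]) (auto intro: pow_mod)

lemma pow_inj:
  assumes z: "z \<in> topspace Z" and e: "(T ^^ i) z = (T ^^ j) z" and "i < p" "j < p"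
  shows "i = j"
proof -
  have *: False if "i < j" "j < p" "(T ^^ i) z = (T ^^ j) z" for i j
  proof -
    have "(T ^^ (p - j + i)) z = (T ^^ (p - j + j)) z"
      by (simp only: funpow_add comp_apply that(3))
    also have "\<dots> = z" using that z period by simp
    finally have eq: "(T ^^ (p - j + i)) z = z" .
    have "0 < p - j + i" "p - j + i < p" using that(1,2) by linarith+
    from free[OF z this] eq show False by (rule notE)
  qed
  show ?thesis
  proof (rule ccontr)
    assume "i \<noteq> j"
    then consider "i < j" | "j < i" by linarith
    then show False
      by cases (rule *[OF _ \<open>j < p\<close> e], assumption, rule *[OF _ \<open>i < p\<close> e[symmetric]], assumption)
  qed
qed

text \<open>A single point of the image already separates the translates, so the induced action on
  simplices is free as well.\<close>

lemma simplex_map_free: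
  assumes "singular_simplex k Z \<sigma>" "simplex_map k (T ^^ i) \<sigma> = simplex_map k (T ^^ j) \<sigma>" "i < p" "j < p"
  shows "i = j"
proof -
  obtain s where s: "s \<in> standard_simplex k"
    using nonempty_standard_simplex by blast
  then have z: "\<sigma> s \<in> topspace Z"
    using assms(1) by (auto simp: singular_simplex_def continuous_map_def)
  have "(T ^^ i) (\<sigma> s) = (T ^^ j) (\<sigma> s)"
    using fun_cong[OF assms(2), of s] s by (simp add: simplex_map_def)
  from pow_inj[OF z this] assms show ?thesis by blast
qed

section \<open>Exactness of the periodic complex on cochains\<close>

lemma tw_nrm: "NL k (tw k (nrm k c) - nrm k c)"
  and nrm_tw: "NL k (nrm k (tw k c) - nrm k c)"
proof -
  have *: "(\<Sum>j<p. c (simplex_map k (T ^^ Suc j) \<sigma>)) = (\<Sum>j<p. c (simplex_map k (T ^^ j) \<sigma>))"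
    if "singular_simplex k Z \<sigma>" for \<sigma>
  proof -
    have "(\<Sum>j<p. c (simplex_map k (T ^^ Suc j) \<sigma>)) + c (simplex_map k (T ^^ 0) \<sigma>) = (\<Sum>j<Suc p. c (simplex_map k (T ^^ j) \<sigma>))"
      by (subst sum.lessThan_Suc_shift) simp
    also have "\<dots> = (\<Sum>j<p. c (simplex_map k (T ^^ j) \<sigma>)) + c (simplex_map k (T ^^ 0) \<sigma>)"
      using simplex_map_period[OF that] simplex_map_pow_0[OF that] by (simp del: simplex_map_id)
    finally show ?thesis by simp
  qed
  show "NL k (tw k (nrm k c) - nrm k c)"
    using * simplex_map_pow_add[of k _ 1]
    by (auto simp: nul_def pb_def nm_def)
  show "NL k (nrm k (tw k c) - nrm k c)"
    using * simplex_map_pow_add[of k 1]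
    by (auto simp: nul_def pb_def nm_def)
qed

lemma nul_nrm: "NL k c \<Longrightarrow> NL k (nrm k c)"
  unfolding nul_def nm_def by (auto intro!: dvd_sum simplex_pow)

lemma nul_tw: "NL k c \<Longrightarrow> NL k (tw k c)"
  using nul_pb cont by blast

lemma nul_op: "NL k c \<Longrightarrow> NL k (opr j k c)"
  by (simp add: op_def nul_diff nul_tw nul_nrm)

lemma inv_pow:
  assumes "NL k (tw k c - c)" and s: "singular_simplex k Z \<sigma>"
  shows "int p dvd c (simplex_map k (T ^^ j) \<sigma>) - c \<sigma>"
proof (induction j)
  case 0
  show ?case by (simp only: simplex_map_pow_0[OF s]) simp
next
  case (Suc j)
  have "int p dvd c (simplex_map k T (simplex_map k (T ^^ j) \<sigma>)) - c (simplex_map k (T ^^ j) \<sigma>)"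
    using assms(1) simplex_pow[OF s] by (auto simp: nul_def pb_def)
  moreover have "simplex_map k T (simplex_map k (T ^^ j) \<sigma>) = simplex_map k (T ^^ Suc j) \<sigma>"
    by (simp add: simplex_map_compose del: comp_apply) simp
  ultimately have "int p dvd (c (simplex_map k (T ^^ Suc j) \<sigma>) - c (simplex_map k (T ^^ j) \<sigma>))
      + (c (simplex_map k (T ^^ j) \<sigma>) - c \<sigma>)"
    using Suc by (intro dvd_add) simp_all
  then show ?case by (simp only: diff_add_cancel add_diff_eq)
qed

lemma nrm_inv: "NL k (tw k c - c) \<Longrightarrow> NL k (nrm k c)"
proof -
  assume a: "NL k (tw k c - c)"
  note * = inv_pow[OF a]
  show ?thesis unfolding nul_def
  proof (intro allI impI)
    fix \<sigma> assume s: "singular_simplex k Z \<sigma>"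
    have "int p dvd (\<Sum>j<p. c (simplex_map k (T ^^ j) \<sigma>) - c \<sigma>)"
      by (intro dvd_sum *[OF s])
    then have "int p dvd nrm k c \<sigma> - int p * c \<sigma>"
      by (simp add: nm_def sum_subtractf)
    then show "int p dvd nrm k c \<sigma>"
      by (metis dvd_add_times_triv_right_iff diff_add_cancel mult.commute)
  qed
qed

lemma nrm_nrm: "NL k (nrm k (nrm k c))"
  by (rule nrm_inv[OF tw_nrm])

lemma nrm_op: "NL k (nrm k (opr j k c))"
  using nrm_nrm nrm_tw by (simp add: op_def nm_diff)

lemma op_op: "NL k (opr j k (opr (Suc j) k c))"
  using nrm_tw[of k c] tw_nrm[of k c] by (auto simp: op_def nm_diff)

text \<open>\<open>\<zeta>\<close> is the indicator of one chosen simplex in each orbit. By freeness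
  exactly one of the \<open>p\<close> translates of \<open>\<sigma>\<close> is the chosen
  one.\<close>

lemma transversal: obtains \<zeta> where "\<And>\<sigma>. singular_simplex k Z \<sigma> \<Longrightarrow> nrm k \<zeta> \<sigma> = 1"
proof -
  define orb where "orb \<sigma> = (\<lambda>j. simplex_map k (T ^^ j) \<sigma>) ` {..<p}" for \<sigma>
  define rep where "rep \<sigma> = (SOME \<tau>. \<tau> \<in> orb \<sigma>)" for \<sigma>
  define \<zeta> where "\<zeta> \<sigma> = (if rep \<sigma> = \<sigma> then 1 else 0 :: int)" for \<sigma>
  have rep: "rep \<sigma> \<in> orb \<sigma>" for \<sigma>
    unfolding rep_def some_in_eq using p_pos by (auto simp: orb_def)
  have orb_eq: "orb (simplex_map k (T ^^ i) \<sigma>) = orb \<sigma>" if s: "singular_simplex k Z \<sigma>" "i < p" for \<sigma> i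
  proof
    show "orb (simplex_map k (T ^^ i) \<sigma>) \<subseteq> orb \<sigma>"
    proof
      fix \<tau> assume "\<tau> \<in> orb (simplex_map k (T ^^ i) \<sigma>)"
      then obtain j where "\<tau> = simplex_map k (T ^^ (j + i)) \<sigma>"
        by (auto simp: orb_def simplex_map_pow_add)
      then have "\<tau> = simplex_map k (T ^^ ((j + i) mod p)) \<sigma>"
        using simplex_map_pow_mod[OF s(1), of "j + i"] by (simp only:)
      then show "\<tau> \<in> orb \<sigma>"
        unfolding orb_def using p_pos by (intro image_eqI[where x = "(j + i) mod p"]) auto
    qed
    show "orb \<sigma> \<subseteq> orb (simplex_map k (T ^^ i) \<sigma>)"
    proof
      fix \<tau> assume "\<tau> \<in> orb \<sigma>"
      then obtain j where j: "j < p" "\<tau> = simplex_map k (T ^^ j) \<sigma>" by (auto simp: orb_def)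
      let ?l = "(j + (p - i)) mod p"
      have "(?l + i) mod p = (j + (p - i) + i) mod p"
        by (simp add: mod_add_left_eq)
      also have "\<dots> = j" using j s by simp
      finally have "simplex_map k (T ^^ ?l) (simplex_map k (T ^^ i) \<sigma>) = \<tau>"
        using simplex_map_pow_mod[OF s(1), of "?l + i"] j(2)
        by (simp only: simplex_map_pow_add)
      then show "\<tau> \<in> orb (simplex_map k (T ^^ i) \<sigma>)"
        unfolding orb_def using p_pos by (intro image_eqI[where x = ?l]) auto
    qed
  qed
  show thesis
  proof (rule that[of \<zeta>])
    fix \<sigma> assume s: "singular_simplex k Z \<sigma>"
    obtain i where i: "i < p" "rep \<sigma> = simplex_map k (T ^^ i) \<sigma>"
      using rep[of \<sigma>] by (auto simp: orb_def)
    have "\<zeta> (simplex_map k (T ^^ j) \<sigma>) = (if j = i then 1 else 0)" if "j < p" for j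
    proof -
      have "rep (simplex_map k (T ^^ j) \<sigma>) = rep \<sigma>"
        using orb_eq[OF s that] by (simp add: rep_def)
      then show ?thesis
        using i simplex_map_free[OF s _ that i(1)] by (auto simp: \<zeta>_def)
    qed
    then have "nrm k \<zeta> \<sigma> = (\<Sum>j<p. if j = i then 1 else 0)"
      by (auto simp: nm_def intro!: sum.cong)
    then show "nrm k \<zeta> \<sigma> = 1" using i by simp
  qed
qed

text \<open>The simplices form a free \<open>\<int>/p\<close>-set, so the cochains are an induced module and the periodic
  complex is exact on them.\<close>

lemma inv_ex:
  assumes "NL k (tw k x - x)"
  shows "\<exists>y. NL k (x - nrm k y) \<and> (\<forall>Q. nul p Q x \<longrightarrow> nul p Q y)"
proof -
  obtain \<zeta> where \<zeta>: "\<And>\<sigma>. singular_simplex k Z \<sigma> \<Longrightarrow> nrm k \<zeta> \<sigma> = 1"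
    using transversal[of k] by blast
  note * = inv_pow[OF assms]
  \<comment> \<open>For invariant \<open>x\<close> the norm is linear over \<open>x\<close>, so
    \<open>N (x \<zeta>) = x N \<zeta> = x\<close>. The product with \<open>\<zeta>\<close> is
    pointwise and therefore keeps all zeros of \<open>x\<close>.\<close>
  have "NL k (nrm k (x * \<zeta>) - x)"
    unfolding nul_def
  proof (intro allI impI)
    fix \<sigma> assume s: "singular_simplex k Z \<sigma>"
    have "nrm k (x * \<zeta>) \<sigma> - x \<sigma> = nrm k (x * \<zeta>) \<sigma> - x \<sigma> * nrm k \<zeta> \<sigma>"
      using \<zeta>[OF s] by simp
    also have "\<dots> = (\<Sum>j<p. (x (simplex_map k (T ^^ j) \<sigma>) - x \<sigma>) * \<zeta> (simplex_map k (T ^^ j) \<sigma>))"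
      by (simp add: nm_def sum_distrib_left sum_subtractf algebra_simps)
    also have "int p dvd \<dots>" by (intro dvd_sum dvd_mult2 *[OF s])
    finally show "int p dvd (nrm k (x * \<zeta>) - x) \<sigma>" by simp
  qed
  then show ?thesis using nul_mult2 nul_sym by blast
qed

text \<open>The partial norms \<open>xs j = x + T x + ...\<close> (\<open>j\<close> terms) satisfy
  \<open>T (xs j) = xs (j + 1) - x\<close>. Weighting them by the translates of
  \<open>\<zeta>\<close> and telescoping leaves \<open>x\<close> and an end term containing
  \<open>xs p = N x\<close>. The solution at a simplex involves \<open>x\<close> at all translates,
  so zeros are kept only on invariant sets \<open>Q\<close>; this control later makes primitives
  vanish on small simplices.\<close>

lemma nrm0_ex:
  assumes "NL k (nrm k x)"
  shows "\<exists>y. NL k (x - (tw k y - y)) \<and>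
     (\<forall>Q. (\<forall>\<sigma> j. Q \<sigma> \<longrightarrow> Q (simplex_map k (T ^^ j) \<sigma>)) \<longrightarrow> nul p Q x \<longrightarrow> nul p Q y)"
proof -
  obtain \<zeta> where \<zeta>: "\<And>\<sigma>. singular_simplex k Z \<sigma> \<Longrightarrow> nrm k \<zeta> \<sigma> = 1"
    using transversal[of k] by blast
  define xs where "xs j \<sigma> = (\<Sum>i<j. x (simplex_map k (T ^^ i) \<sigma>))" for j \<sigma>
  define y where "y \<sigma> = - (\<Sum>j<p. xs j \<sigma> * \<zeta> (simplex_map k (T ^^ j) \<sigma>))" for \<sigma>
  have "NL k ((tw k y - y) - x)"
    unfolding nul_def
  proof (intro allI impI)
    fix \<sigma> assume s: "singular_simplex k Z \<sigma>"
    define z where "z j = \<zeta> (simplex_map k (T ^^ j) \<sigma>)" for j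
    have z: "(\<Sum>j<p. z j) = 1" using \<zeta>[OF s] by (simp add: nm_def z_def)
    have zp: "z p = z 0"
      using simplex_map_period[OF s] simplex_map_pow_0[OF s] by (simp add: z_def del: simplex_map_id)
    have xsT: "xs j (simplex_map k T \<sigma>) = xs (Suc j) \<sigma> - x \<sigma>" for j
    proof -
      have "xs (Suc j) \<sigma> = x \<sigma> + (\<Sum>i<j. x (simplex_map k (T ^^ Suc i) \<sigma>))"
        unfolding xs_def by (subst sum.lessThan_Suc_shift)
          (use simplex_map_pow_0[OF s] in \<open>simp del: simplex_map_id\<close>)
      then show ?thesis using simplex_map_pow_add[of k _ 1 \<sigma>] by (simp add: xs_def)
    qed
    have "tw k y \<sigma> = - (\<Sum>j<p. (xs (Suc j) \<sigma> - x \<sigma>) * z (Suc j))"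
      using simplex_map_pow_add[of k _ 1 \<sigma>] by (simp add: pb_def y_def xsT z_def)
    also have "\<dots> = x \<sigma> * (\<Sum>j<p. z (Suc j)) - (\<Sum>j<p. xs (Suc j) \<sigma> * z (Suc j))"
      by (simp add: sum_distrib_left left_diff_distrib sum_subtractf)
    also have "(\<Sum>j<p. z (Suc j)) = 1"
      using sum.lessThan_Suc_shift[of z p] z zp by simp
    also have "(\<Sum>j<p. xs (Suc j) \<sigma> * z (Suc j)) = (\<Sum>j<p. xs j \<sigma> * z j) + xs p \<sigma> * z p"
      using sum.lessThan_Suc_shift[of "\<lambda>j. xs j \<sigma> * z j" p] by (simp add: xs_def)
    finally have "tw k y \<sigma> - y \<sigma> - x \<sigma> = - (xs p \<sigma> * z p)"
      by (simp only: y_def[of \<sigma>] z_def)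
    moreover have "int p dvd xs p \<sigma>"
      using assms s by (simp add: nul_def nm_def xs_def)
    ultimately show "int p dvd (tw k y - y - x) \<sigma>" by simp
  qed
  moreover have "nul p Q y" if "\<forall>\<sigma> j. Q \<sigma> \<longrightarrow> Q (simplex_map k (T ^^ j) \<sigma>)" "nul p Q x" for Q
    using that unfolding nul_def y_def xs_def
    by (auto intro!: dvd_sum dvd_mult2)
  ultimately show ?thesis using nul_sym by blast
qed

text \<open>Both exactness statements at once, indexed by parity, so that inductions along the
  resolution need no case distinction.\<close>

lemma op_ex:
  assumes "NL k (opr j k x)"
  obtains y where "NL k (x - opr (Suc j) k y)"
    "\<And>Q. (\<And>\<sigma> j. Q \<sigma> \<Longrightarrow> Q (simplex_map k (T ^^ j) \<sigma>)) \<Longrightarrow> nul p Q x \<Longrightarrow> nul p Q y"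
proof (cases "odd j")
  case True
  then show ?thesis using assms inv_ex[of k x] that by (auto simp: op_def)
next
  case False
  then have "NL k (nrm k x)" using assms by (simp add: op_def)
  from nrm0_ex[OF this] obtain y where y: "NL k (x - (tw k y - y))"
     "\<forall>Q. (\<forall>\<sigma> j. Q \<sigma> \<longrightarrow> Q (simplex_map k (T ^^ j) \<sigma>)) \<longrightarrow> nul p Q x \<longrightarrow> nul p Q y" by blast
  then show ?thesis using that[of y] False by (auto simp: op_def)
qed

lemma op_cong: "NL k (x - y) \<Longrightarrow> NL k (opr j k x - opr j k y)"
  using nul_op[of k "x - y" j] by (simp add: op_diff)

end

section \<open>The classes of the periodic resolution\<close>

text \<open>A zigzag is an equivariant chain map from the singular chains of \<open>Z\<close> to the periodic free
  resolution of the trivial module; since an equivariant map into the free module of rank one is the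
  same as a single (non-equivariant) functional, it is given by one cochain \<open>v k\<close> in each degree.
  The generator of the degree-\<open>k\<close> cohomology of the classifying space pulls back to \<open>nm p T k (v k)\<close>.\<close>

lemmas lin = cobd_diff cobd_add pb_diff pb_add nm_diff nm_add op_diff op_add algebra_simps

definition zigzag :: "nat \<Rightarrow> 'a topology \<Rightarrow> ('a \<Rightarrow> 'a) \<Rightarrow> (nat \<Rightarrow> 'a cochain) \<Rightarrow> bool" where
  "zigzag p Z T v \<longleftrightarrow> nul p (singular_simplex 0 Z) (nm p T 0 (v 0) - 1) \<and>
     (\<forall>k. nul p (singular_simplex (Suc k) Z) (cobd k (v k) - op p T (Suc k) (Suc k) (v (Suc k))))"

text \<open>For invariant \<open>g\<close> this is the vanishing of its class in the cohomology of
  the orbit space, expressed upstairs. In degree 0 there are no coboundaries.\<close>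

definition cnull :: "nat \<Rightarrow> 'a topology \<Rightarrow> ('a \<Rightarrow> 'a) \<Rightarrow> nat \<Rightarrow> 'a cochain \<Rightarrow> bool" where
  "cnull p Z T k g \<longleftrightarrow> (case k of 0 \<Rightarrow> nul p (singular_simplex 0 Z) g
     | Suc j \<Rightarrow> \<exists>e. nul p (singular_simplex j Z) (pb j T e - e) \<and> nul p (singular_simplex k Z) (g - cobd j e))"

text \<open>\<open>per p Z T k g' g\<close> says that \<open>g\<close> represents the product of the class of \<open>g'\<close> with the polynomial
  generator of degree two.\<close>

definition per :: "nat \<Rightarrow> 'a topology \<Rightarrow> ('a \<Rightarrow> 'a) \<Rightarrow> nat \<Rightarrow> 'a cochain \<Rightarrow> 'a cochain \<Rightarrow> bool" where
  "per p Z T k g' g \<longleftrightarrow> (\<exists>s r. nul p (singular_simplex (Suc (Suc k)) Z) (g - cobd (Suc k) s) \<and>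
     nul p (singular_simplex (Suc k) Z) (pb (Suc k) T s - s - cobd k r) \<and>
     nul p (singular_simplex k Z) (nm p T k r - g'))"

lemma cobd_0: "cobd k 0 = 0"
  and nm_0: "nm p T k 0 = 0"
  by (auto simp: cobd_def nm_def fun_eq_iff simp del: sum.atMost_Suc)

lemma cnull_nul: "nul p (singular_simplex k Z) g \<Longrightarrow> cnull p Z T k g"
  unfolding cnull_def
  by (cases k) (auto intro!: exI[where x = 0] simp: pb_0 cobd_0)

lemma cnull_add: "cnull p Z T k a \<Longrightarrow> cnull p Z T k b \<Longrightarrow> cnull p Z T k (a + b)"
proof (cases k)
  case (Suc j)
  assume "cnull p Z T k a" "cnull p Z T k b"
  then obtain e e' where "nul p (singular_simplex j Z) (pb j T e - e)" "nul p (singular_simplex k Z) (a - cobd j e)"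
    "nul p (singular_simplex j Z) (pb j T e' - e')" "nul p (singular_simplex k Z) (b - cobd j e')"
    using Suc by (auto simp: cnull_def)
  from nul_add[OF this(1,3)] nul_add[OF this(2,4)] show ?thesis
    using Suc by (auto simp: cnull_def pb_add cobd_add algebra_simps intro!: exI[where x = "e + e'"])
qed (simp add: cnull_def nul_add)

lemma cnull_smul: "cnull p Z T k a \<Longrightarrow> cnull p Z T k (smul c a)"
proof (cases k)
  case (Suc j)
  assume "cnull p Z T k a"
  then obtain e where "nul p (singular_simplex j Z) (pb j T e - e)" "nul p (singular_simplex k Z) (a - cobd j e)"
    using Suc by (auto simp: cnull_def)
  from this[THEN nul_smul[of _ _ _ c]] show ?thesis
    using Suc by (auto simp: cnull_def pb_smul cobd_smul smul_diff intro!: exI[where x = "smul c e"])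
qed (simp add: cnull_def nul_smul)

lemma cnull_minus: "cnull p Z T k a \<Longrightarrow> cnull p Z T k (- a)"
  using cnull_smul[of p Z T k a "-1"] by (simp add: smul_def fun_Compl_def)

lemma cnull_diff: "cnull p Z T k a \<Longrightarrow> cnull p Z T k b \<Longrightarrow> cnull p Z T k (a - b)"
  using cnull_add[of p Z T k a "- b"] cnull_minus[of p Z T k b] by simp

lemma cnull_cong: "nul p (singular_simplex k Z) (a - b) \<Longrightarrow> cnull p Z T k b \<Longrightarrow> cnull p Z T k a"
  using cnull_add[of p Z T k "a - b" b, OF cnull_nul] by simp

lemma per_diff: "per p Z T k a' a \<Longrightarrow> per p Z T k b' b \<Longrightarrow> per p Z T k (a' - b') (a - b)"
proof -
  assume "per p Z T k a' a" "per p Z T k b' b"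
  then obtain s r s' r' where
    "nul p (singular_simplex (Suc (Suc k)) Z) (a - cobd (Suc k) s)"
    "nul p (singular_simplex (Suc k) Z) (pb (Suc k) T s - s - cobd k r)"
    "nul p (singular_simplex k Z) (nm p T k r - a')"
    "nul p (singular_simplex (Suc (Suc k)) Z) (b - cobd (Suc k) s')"
    "nul p (singular_simplex (Suc k) Z) (pb (Suc k) T s' - s' - cobd k r')"
    "nul p (singular_simplex k Z) (nm p T k r' - b')"
    unfolding per_def by blast
  from nul_diff[OF this(1,4)] nul_diff[OF this(2,5)] nul_diff[OF this(3,6)]
  show ?thesis unfolding per_def
    by (intro exI[where x = "s - s'"] exI[where x = "r - r'"])
       (simp add: cobd_diff cobd_add pb_diff pb_add nm_diff nm_add algebra_simps lin)
qed

lemma per_smul: "per p Z T k a' a \<Longrightarrow> per p Z T k (smul c a') (smul c a)"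
proof -
  assume "per p Z T k a' a"
  then obtain s r where
    "nul p (singular_simplex (Suc (Suc k)) Z) (a - cobd (Suc k) s)"
    "nul p (singular_simplex (Suc k) Z) (pb (Suc k) T s - s - cobd k r)"
    "nul p (singular_simplex k Z) (nm p T k r - a')"
    unfolding per_def by blast
  from this[THEN nul_smul[of _ _ _ c]]
  show ?thesis unfolding per_def
    by (intro exI[where x = "smul c s"] exI[where x = "smul c r"])
       (simp add: cobd_smul pb_smul nm_smul smul_diff)
qed

section \<open>Comparison with the periodic resolution\<close>

context free_cyclic
begin

abbreviation "ZZ \<equiv> zigzag p Z T"
abbreviation "CN \<equiv> cnull p Z T"
abbreviation "PER \<equiv> per p Z T"

text \<open>The comparison theorem: \<open>\<delta> v_k\<close> is killed by the differential
  \<open>opr k\<close>, so exactness solves for \<open>v_(k+1)\<close>; applying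
  \<open>\<delta>\<close> to that equation shows that \<open>\<delta> v_(k+1)\<close> is killed by
  the next differential. The start is the indicator of a transversal, where \<open>N v_0 = 1\<close>
  and \<open>\<delta> 1 = 0\<close>.\<close>

lemma zigzag_exists: obtains v where "ZZ v"
proof -
  define P where "P k v \<longleftrightarrow> (k = 0 \<longrightarrow> NL 0 (nrm 0 v - 1)) \<and> NL (Suc k) (opr k (Suc k) (cobd k v))" for k v
  define Q where "Q k v w \<longleftrightarrow> NL (Suc k) (cobd k v - opr (Suc k) (Suc k) w)" for k v w
  have "\<exists>v. \<forall>k. P k (v k) \<and> Q k (v k) (v (Suc k))"
  proof (rule dependent_nat_choice)
    obtain \<zeta> where "\<And>\<sigma>. singular_simplex 0 Z \<sigma> \<Longrightarrow> nrm 0 \<zeta> \<sigma> = 1"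
      using transversal[of 0] by blast
    then have 1: "NL 0 (nrm 0 \<zeta> - 1)" by (simp add: nul_def)
    from nul_cobd[OF this] have "NL 1 (nrm 1 (cobd 0 \<zeta>))"
      by (simp add: cobd_diff cobd_nm cobd_one lin)
    with 1 show "\<exists>v. P 0 v" by (auto simp: P_def op_def)
  next
    fix v k assume P: "P k v"
    then obtain w where w: "NL (Suc k) (cobd k v - opr (Suc k) (Suc k) w)"
      by (auto simp: P_def elim: op_ex)
    from nul_cobd[OF this] have "NL (Suc (Suc k)) (opr (Suc k) (Suc (Suc k)) (cobd (Suc k) w))"
      using nul_sub[OF nul_sym nul_cobd_cobd] by (simp add: cobd_diff cobd_op lin)
    with w show "\<exists>w. P (Suc k) w \<and> Q k v w" by (auto simp: P_def Q_def)
  qed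
  then obtain v where "\<And>k. P k (v k)" "\<And>k. Q k (v k) (v (Suc k))" by blast
  then have "ZZ v" by (auto simp: zigzag_def P_def Q_def)
  then show thesis by (rule that)
qed

text \<open>The usual construction of a chain homotopy. \<open>t\<close> stands for the coboundary
  of the homotopy one degree lower (zero in degree 0); of its origin only the two facts that the
  induction and the next lemma need are recorded.\<close>

lemma zigzag_homotopy:
  assumes "ZZ v" "ZZ w"
  shows "\<exists>s t. NL k (v k - w k - opr (Suc k) k s - t) \<and> NL (Suc k) (cobd k t) \<and> CN k (nrm k t)"
proof (induction k)
  case 0
  have "NL 0 ((nrm 0 (v 0) - 1) - (nrm 0 (w 0) - 1))"
    using assms by (intro nul_diff[of _ _ "_ - _" "_ - _"]) (auto simp: zigzag_def)
  then have "NL 0 (opr 0 0 (v 0 - w 0))" by (simp add: op_def nm_diff lin)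
  then obtain s where s: "NL 0 (v 0 - w 0 - opr (Suc 0) 0 s)" by (rule op_ex)
  have "NL 0 (v 0 - w 0 - opr (Suc 0) 0 s - 0)" by (subst diff_zero) (rule s)
  moreover have "CN 0 (nrm 0 0)" by (simp only: nm_0 cnull_nul[OF nul_0(1)])
  moreover have "NL (Suc 0) (cobd 0 0)" by (simp only: cobd_0 nul_0)
  ultimately show ?case by blast
next
  case (Suc k)
  then obtain s t where st: "NL k (v k - w k - opr (Suc k) k s - t)" "NL (Suc k) (cobd k t)"
    by blast
  from nul_add[OF nul_cobd[OF st(1)] st(2)]
  have 1: "NL (Suc k) (cobd k (v k) - cobd k (w k) - opr (Suc k) (Suc k) (cobd k s))"
    by (simp only: cobd_diff cobd_op diff_add_cancel)
  have 2: "NL (Suc k) ((cobd k (v k) - opr (Suc k) (Suc k) (v (Suc k))) - (cobd k (w k) - opr (Suc k) (Suc k) (w (Suc k))))"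
    using assms by (intro nul_diff[of _ _ "_ - _" "_ - _"]) (auto simp: zigzag_def)
  from nul_diff[OF 1 2] have "NL (Suc k) (opr (Suc k) (Suc k) (v (Suc k) - w (Suc k) - cobd k s))"
    by (simp add: op_diff op_add algebra_simps lin)
  then obtain y where "NL (Suc k) (v (Suc k) - w (Suc k) - cobd k s - opr (Suc (Suc k)) (Suc k) y)"
    by (rule op_ex)
  then have "NL (Suc k) (v (Suc k) - w (Suc k) - opr (Suc (Suc k)) (Suc k) y - cobd k s)"
    by (simp add: algebra_simps)
  moreover have "CN (Suc k) (nrm (Suc k) (cobd k s))"
    unfolding cnull_def using tw_nrm[of k s] nul_0
    by (auto intro!: exI[where x = "nrm k s"] simp: cobd_nm)
  ultimately show ?case using nul_cobd_cobd by blast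
qed

text \<open>The norm annihilates the image of \<open>opr\<close>, so only the null term
  \<open>N t\<close> survives. Hence the index can be read off from any one sequence.\<close>

lemma zigzag_unique:
  assumes "ZZ v" "ZZ w"
  shows "CN k (nrm k (v k) - nrm k (w k))"
proof -
  obtain s t where st: "NL k (v k - w k - opr (Suc k) k s - t)" "CN k (nrm k t)"
    using zigzag_homotopy[OF assms] by blast
  from nul_add[OF nul_nrm[OF st(1)] nrm_op[of k "Suc k" s]]
  have *: "NL k (nrm k (v k) - nrm k (w k) - nrm k t)"
    by (simp add: nm_diff lin)
  then show ?thesis using st(2) by (rule cnull_cong)
qed

text \<open>In the group ring modulo \<open>p\<close> the norm factors as
  \<open>(T - 1) \<mu>\<close>, with \<open>\<mu>\<close> the sum of the \<open>- j T^j\<close>.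
  This serves odd degrees, where the relations of a zigzag have \<open>N\<close> in the place where
  \<open>per\<close> has \<open>T - 1\<close>.\<close>

lemma nrm_factor:
  obtains \<mu> where "\<And>k c. NL k (tw k (\<mu> k c) - \<mu> k c - nrm k c)"
    "\<And>k c. NL k (\<mu> k (tw k c - c) - nrm k c)"
    "\<And>k c. NL k c \<Longrightarrow> NL k (\<mu> k c)" "\<And>k c d. \<mu> k (c - d) = \<mu> k c - \<mu> k d"
    "\<And>k c. cobd k (\<mu> k c) = \<mu> (Suc k) (cobd k c)"
proof -
  define \<mu> where "\<mu> k c = (\<lambda>\<sigma>. \<Sum>j<p. - int j * pb k (T ^^ j) c \<sigma>)" for k and c :: "'a cochain"
  have *: "int p dvd (\<Sum>j<p. - int j * (f (Suc j) - f j)) - (\<Sum>j<p. f j)" if "f p = f 0" for f :: "nat \<Rightarrow> int"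
  proof -
    \<comment> \<open>Summation by parts; for \<open>n = p\<close> and \<open>f p = f 0\<close> the
      end terms add up to \<open>- p f 0\<close>.\<close>
    have "(\<Sum>j<n. - int j * (f (Suc j) - f j)) = (\<Sum>j<n. f j) - f 0 - (int n - 1) * f n" if "n > 0" for n
      using that by (induction n rule: nat_induct_non_zero) (auto simp: algebra_simps)
    from this[OF p_pos] have "(\<Sum>j<p. - int j * (f (Suc j) - f j)) - (\<Sum>j<p. f j) = - int p * f 0"
      using that p_pos by (simp add: algebra_simps)
    then show ?thesis by simp
  qed
  show thesis
  proof (rule that[of \<mu>])
    fix k and c :: "'a cochain"
    have per: "c (simplex_map k (T ^^ p) \<sigma>) = c (simplex_map k (T ^^ 0) \<sigma>)" if "singular_simplex k Z \<sigma>" for \<sigma>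
      by (simp only: simplex_map_period[OF that] simplex_map_pow_0[OF that])
    have tw: "simplex_map k (T ^^ j) (simplex_map k T \<sigma>) = simplex_map k (T ^^ Suc j) \<sigma>"
             "simplex_map k T (simplex_map k (T ^^ j) \<sigma>) = simplex_map k (T ^^ Suc j) \<sigma>" for j \<sigma>
      using simplex_map_pow_add[of k j 1 \<sigma>] simplex_map_pow_add[of k 1 j \<sigma>] by simp_all
    show "NL k (pb k T (\<mu> k c) - \<mu> k c - nrm k c)"
      unfolding nul_def
    proof (intro allI impI)
      fix \<sigma> assume s: "singular_simplex k Z \<sigma>"
      show "int p dvd (pb k T (\<mu> k c) - \<mu> k c - nrm k c) \<sigma>"
        using *[of "\<lambda>j. c (simplex_map k (T ^^ j) \<sigma>)", OF per[OF s]]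
        by (simp add: pb_def \<mu>_def nm_def tw sum_subtractf right_diff_distrib sum_negf del: funpow.simps)
    qed
    show "NL k (\<mu> k (pb k T c - c) - nrm k c)"
      unfolding nul_def
    proof (intro allI impI)
      fix \<sigma> assume s: "singular_simplex k Z \<sigma>"
      show "int p dvd (\<mu> k (pb k T c - c) - nrm k c) \<sigma>"
        using *[of "\<lambda>j. c (simplex_map k (T ^^ j) \<sigma>)", OF per[OF s]]
        by (simp add: pb_def \<mu>_def nm_def tw del: funpow.simps)
    qed
    show "NL k (\<mu> k c)" if "NL k c"
      using that unfolding nul_def \<mu>_def pb_def by (auto intro!: dvd_sum dvd_mult simplex_pow)
    show "\<mu> k (c - d) = \<mu> k c - \<mu> k d" for d :: "'a cochain"
      by (auto simp: \<mu>_def pb_def fun_eq_iff sum_subtractf right_diff_distrib sum_negf)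
    show "cobd k (\<mu> k c) = \<mu> (Suc k) (cobd k c)"
    proof -
      have "cobd k (\<mu> k c) = (\<lambda>\<sigma>. \<Sum>i<p. cobd k (smul (- int i) (pb k (T ^^ i) c)) \<sigma>)"
        unfolding \<mu>_def by (simp add: cobd_sum smul_def)
      then show ?thesis by (simp add: cobd_smul cobd_pb \<mu>_def) (simp add: smul_def)
    qed
  qed
qed

text \<open>For even \<open>k\<close> the relations of the zigzag are literally those of
  \<open>per\<close>, with \<open>s = v_(k+1)\<close> and \<open>r = v_k\<close>. For odd
  \<open>k\<close> take \<open>s = \<mu> v_(k+1)\<close>: the identities
  \<open>(T - 1) \<mu> = N = \<mu> (T - 1)\<close> exchange the two differentials.\<close>

lemma zigzag_per:
  assumes "ZZ v"
  shows "PER k (nrm k (v k)) (nrm (Suc (Suc k)) (v (Suc (Suc k))))"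
proof -
  have v: "NL (Suc j) (cobd j (v j) - opr (Suc j) (Suc j) (v (Suc j)))" for j
    using assms by (simp add: zigzag_def)
  show ?thesis
  proof (cases "even k")
    case True
    have "NL (Suc (Suc k)) (nrm (Suc (Suc k)) (v (Suc (Suc k))) - cobd (Suc k) (v (Suc k)))"
      using nul_sym[OF v[of "Suc k"]] True by (simp add: op_def)
    moreover have "NL (Suc k) (tw (Suc k) (v (Suc k)) - v (Suc k) - cobd k (v k))"
      using nul_sym[OF v[of k]] True by (simp add: op_def)
    ultimately show ?thesis unfolding per_def
      by (intro exI[where x = "v (Suc k)"] exI[where x = "v k"]) simp
  next
    case False
    let ?k1 = "Suc k" and ?k2 = "Suc (Suc k)"
    obtain \<mu> where \<mu>: "\<And>k c. NL k (tw k (\<mu> k c) - \<mu> k c - nrm k c)"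
      "\<And>k c. NL k (\<mu> k (tw k c - c) - nrm k c)"
      "\<And>k c. NL k c \<Longrightarrow> NL k (\<mu> k c)"  "\<And>k c d. \<mu> k (c - d) = \<mu> k c - \<mu> k d"
      "\<And>k c. cobd k (\<mu> k c) = \<mu> (Suc k) (cobd k c)"
      using nrm_factor by blast
    have "NL ?k2 (cobd ?k1 (v ?k1) - (tw ?k2 (v ?k2) - v ?k2))"
      using v[of ?k1] False by (simp add: op_def)
    from \<mu>(3)[OF this] have "NL ?k2 (cobd ?k1 (\<mu> ?k1 (v ?k1)) - \<mu> ?k2 (tw ?k2 (v ?k2) - v ?k2))"
      by (simp only: \<mu>(4,5))
    from nul_sym[OF nul_trans[OF this \<mu>(2)]]
    have 1: "NL ?k2 (nrm ?k2 (v ?k2) - cobd ?k1 (\<mu> ?k1 (v ?k1)))" .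
    have "NL ?k1 (nrm ?k1 (v ?k1) - cobd k (v k))"
      using nul_sym[OF v[of k]] False by (simp add: op_def)
    from nul_trans[OF \<mu>(1) this] 1 show ?thesis unfolding per_def
      by (intro exI[where x = "\<mu> ?k1 (v ?k1)"] exI[where x = "v k"]) simp
  qed
qed

text \<open>In positive degree \<open>g = \<delta> e\<close> with \<open>e\<close> invariant, so
  \<open>e = N y\<close>. Then \<open>r - \<delta> y\<close> has norm zero and equals
  \<open>(T - 1) q\<close>; applying \<open>\<delta>\<close> removes \<open>y\<close>.\<close>

lemma cnull_nrm_ex:
  assumes "CN k g" "NL k (nrm k r - g)"
  obtains q where "NL (Suc k) (cobd k r - (tw (Suc k) (cobd k q) - cobd k q))"
proof -
  obtain z where z: "NL k (nrm k (r - z))" "NL (Suc k) (cobd k z)"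
  proof (cases k)
    case 0
    show thesis by (rule that[of 0]) (use assms 0 nul_sub[of p _ "nrm 0 r" g] in \<open>auto simp: cnull_def cobd_0\<close>)
  next
    case (Suc j)
    then obtain e where e: "NL j (tw j e - e)" "NL k (g - cobd j e)"
      using assms by (auto simp: cnull_def)
    obtain y where y: "NL j (e - nrm j y)" using inv_ex[OF e(1)] by blast
    have "NL k (nrm k r - nrm k (cobd j y))"
      using nul_trans[OF assms(2) nul_trans[OF e(2)]] nul_cobd[OF y] Suc
      by (simp add: cobd_diff cobd_nm lin)
    then show thesis
      using that[of "cobd j y"] Suc nul_cobd_cobd[of p j Z y] by (simp add: lin)
  qed
  obtain q where q: "NL k (r - z - (tw k q - q))" using nrm0_ex[OF z(1)] by blast
  from nul_add[OF nul_cobd[OF this] z(2)] show thesis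
    by (intro that[of q]) (simp add: cobd_diff cobd_pb lin)
qed

text \<open>Multiplication by the class of degree two is well defined on classes: the primitive
  \<open>s\<close> of \<open>g\<close> becomes invariant after subtracting
  \<open>\<delta> q\<close>, which does not alter its coboundary.\<close>

lemma cnull_per:
  assumes "PER k g' g" "CN k g'"
  shows "CN (Suc (Suc k)) g"
proof -
  obtain s r where sr: "NL (Suc (Suc k)) (g - cobd (Suc k) s)"
     "NL (Suc k) (tw (Suc k) s - s - cobd k r)" "NL k (nrm k r - g')"
    using assms(1) unfolding per_def by blast
  obtain q where q: "NL (Suc k) (cobd k r - (tw (Suc k) (cobd k q) - cobd k q))"
    using cnull_nrm_ex[OF assms(2) sr(3)] by blast
  have "NL (Suc k) (tw (Suc k) (s - cobd k q) - (s - cobd k q))"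
    using nul_trans[OF sr(2) q] by (simp add: pb_diff pb_add algebra_simps lin)
  moreover have "NL (Suc (Suc k)) (g - cobd (Suc k) (s - cobd k q))"
    using nul_add[OF sr(1) nul_cobd_cobd[of p k Z q]] by (simp add: cobd_diff lin)
  ultimately show ?thesis by (auto simp: cnull_def)
qed

text \<open>In even degree \<open>\<delta> v_k = (T - 1) v_(k+1)\<close>, so nullity makes
  \<open>v_(k+1)\<close> an invariant cochain up to some \<open>\<delta> q\<close>, that is
  \<open>N y + \<delta> q\<close>, and \<open>N N y\<close> vanishes modulo \<open>p\<close>. This
  reflects that the odd class is a multiple of the even class just below it.\<close>

lemma zigzag_null_Suc:
  assumes "ZZ v" "even k" "CN k (nrm k (v k))"
  shows "CN (Suc k) (nrm (Suc k) (v (Suc k)))"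
proof -
  obtain q where q: "NL (Suc k) (cobd k (v k) - (tw (Suc k) (cobd k q) - cobd k q))"
    using cnull_nrm_ex[OF assms(3), of "v k"] by auto
  have "NL (Suc k) (cobd k (v k) - (tw (Suc k) (v (Suc k)) - v (Suc k)))"
  proof -
    have "NL (Suc k) (cobd k (v k) - opr (Suc k) (Suc k) (v (Suc k)))"
      using assms(1) by (simp add: zigzag_def)
    then show ?thesis using assms(2) by (simp add: op_def)
  qed
  from nul_diff[OF q this]
  have "NL (Suc k) (tw (Suc k) (v (Suc k) - cobd k q) - (v (Suc k) - cobd k q))"
    by (simp add: lin)
  from inv_ex[OF this] obtain y where "NL (Suc k) (v (Suc k) - cobd k q - nrm (Suc k) y)"
    by blast
  from nul_add[OF nul_nrm[OF this] nrm_nrm[of _ y]]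
  have "NL (Suc k) (nrm (Suc k) (v (Suc k)) - cobd k (nrm k q))"
    by (simp add: nm_diff cobd_nm lin)
  then show ?thesis using tw_nrm by (auto simp: cnull_def)
qed

text \<open>Degrees \<open>k\<close> and \<open>k + 1\<close> start two inductions with step two;
  evenness of \<open>k\<close> is what supplies the second start.\<close>

lemma zigzag_null_ge:
  assumes "ZZ v" "even k" "CN k (nrm k (v k))" "k \<le> l"
  shows "CN l (nrm l (v l))"
proof -
  have "CN (k + j) (nrm (k + j) (v (k + j)))" for j
  proof (induction j rule: less_induct)
    case (less j)
    consider "j = 0" | "j = 1" | i where "j = Suc (Suc i)"
      by (metis One_nat_def not0_implies_Suc)
    then show ?case
    proof cases
      case (3 i)
      then show ?thesis
        using cnull_per[OF zigzag_per[OF assms(1)], of "k + i"] less[of i] by simp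
    qed (use assms zigzag_null_Suc[OF assms(1-3)] in auto)
  qed
  from this[of "l - k"] assms(4) show ?thesis by simp
qed

lemma zigzag_cocycle:
  assumes "ZZ v"
  shows "NL (Suc k) (cobd k (nrm k (v k)))"
proof -
  have "NL (Suc k) (cobd k (v k) - opr (Suc k) (Suc k) (v (Suc k)))"
    using assms by (simp add: zigzag_def)
  from nul_sub[OF nul_nrm[OF this, unfolded nm_diff] nrm_op]
  show ?thesis by (simp only: cobd_nm)
qed

end

section \<open>Duality over the prime field\<close>

text \<open>Linear functionals over the field with \<open>p\<close> elements extend: \<open>M\<close> is a maximal subgroup that contains
  what the functional has to kill but not \<open>b0\<close>, so it has index \<open>p\<close>.\<close>

lemma coboundary_or_dual_chain:
  fixes \<gamma> :: "'a cochain" and B :: "'a chain set"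
  assumes p: "prime p" and B0: "0 \<in> B" and Bd: "\<And>x y. x \<in> B \<Longrightarrow> y \<in> B \<Longrightarrow> x - y \<in> B"
    and nodual: "\<And>d b f. singular_chain (Suc k) Z d \<Longrightarrow> b \<in> B \<Longrightarrow>
      chain_boundary (Suc k) d = b + frag_cmul (int p) f \<Longrightarrow> int p dvd cev \<gamma> d"
  obtains \<eta> where "\<And>b. b \<in> B \<Longrightarrow> int p dvd cev \<eta> b"
    "nul p (singular_simplex (Suc k) Z) (\<gamma> - cobd k \<eta>)"
proof (cases "nul p (singular_simplex (Suc k) Z) \<gamma>")
  case True
  then show ?thesis using that[of 0] by (simp add: cobd_0 cev_def)
next
  case False
  then obtain \<sigma>0 where \<sigma>0: "singular_simplex (Suc k) Z \<sigma>0" "\<not> int p dvd \<gamma> \<sigma>0"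
    by (auto simp: nul_def)
  have pp: "prime (int p)" using p by simp
  have inverse: "\<exists>i'. int p dvd i * i' - 1" if "\<not> int p dvd i" for i
  proof -
    have "coprime i (int p)" using prime_imp_coprime[OF pp that] by (simp add: coprime_commute)
    then obtain u v where "u * i + v * int p = 1"
      using bezout_int[of i "int p"] by auto
    then have "i * u - 1 = int p * (- v)" by (simp add: algebra_simps)
    then show ?thesis by (metis dvd_triv_left)
  qed
  define b0 where "b0 = chain_boundary (Suc k) (frag_of \<sigma>0)"
  \<comment> \<open>\<open>\<eta>\<close> must send \<open>\<partial> d + b + p f\<close> to
    \<open>\<gamma> d\<close>, and \<open>nodual\<close> makes this prescription consistent modulo
    \<open>p\<close>. \<open>K\<close> is the kernel of the prescribed functional, and
    \<open>b0\<close> is an element on which it is non-zero.\<close>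
  define K where "K = {chain_boundary (Suc k) d + b + frag_cmul (int p) f | d b f.
      singular_chain (Suc k) Z d \<and> int p dvd cev \<gamma> d \<and> b \<in> B}"
  define \<A> where "\<A> = {M. K \<subseteq> M \<and> (\<forall>x\<in>M. \<forall>y\<in>M. x - y \<in> M) \<and> b0 \<notin> M}"
  have KI: "chain_boundary (Suc k) d + b + frag_cmul (int p) f \<in> K"
    if "singular_chain (Suc k) Z d" "int p dvd cev \<gamma> d" "b \<in> B" for d b f
    using that unfolding K_def by blast
  have K0: "0 \<in> K" using KI[of 0 0 0] B0 by simp
  have Kd: "x - y \<in> K" if "x \<in> K" "y \<in> K" for x y
  proof -
    obtain d b f d' b' f' where
      x: "x = chain_boundary (Suc k) d + b + frag_cmul (int p) f" "singular_chain (Suc k) Z d" "int p dvd cev \<gamma> d" "b \<in> B"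
      and y: "y = chain_boundary (Suc k) d' + b' + frag_cmul (int p) f'" "singular_chain (Suc k) Z d'" "int p dvd cev \<gamma> d'" "b' \<in> B"
      using \<open>x \<in> K\<close> \<open>y \<in> K\<close> unfolding K_def by blast
    have "x - y = chain_boundary (Suc k) (d - d') + (b - b') + frag_cmul (int p) (f - f')"
      using x(1) y(1) frag_cmul_distrib2[of "int p" f "- f'"] frag_cmul_distrib2[of "int p" "f - f'" f']
      by (simp add: chain_boundary_diff algebra_simps)
    then show ?thesis using KI[of "d - d'" "b - b'" "f - f'"] x(3) y(3) Bd[OF x(4) y(4)] singular_chain_diff[OF x(2) y(2)]
      by (simp add: cev_diff)
  qed
  have pK: "frag_cmul (int p) x \<in> K" for x
    using KI[of 0 0 x] B0 by simp
  have b0K: "b0 \<notin> K"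
  proof
    assume "b0 \<in> K"
    then obtain d b f where d: "b0 = chain_boundary (Suc k) d + b + frag_cmul (int p) f"
      "singular_chain (Suc k) Z d" "int p dvd cev \<gamma> d" "b \<in> B" unfolding K_def by blast
    have "chain_boundary (Suc k) (frag_of \<sigma>0 - d) = b + frag_cmul (int p) f"
      using d(1) by (simp add: b0_def chain_boundary_diff)
    moreover have "singular_chain (Suc k) Z (frag_of \<sigma>0 - d)"
      using d \<sigma>0 by (intro singular_chain_diff) (auto simp: singular_chain_of)
    ultimately have "int p dvd cev \<gamma> (frag_of \<sigma>0 - d)" using nodual d(4) by blast
    then have "int p dvd (cev \<gamma> (frag_of \<sigma>0 - d)) + cev \<gamma> d" using d(3) by (rule dvd_add)
    then show False using \<sigma>0 by (simp add: cev_diff)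
  qed
  have "\<exists>M\<in>\<A>. \<forall>X\<in>\<A>. M \<subseteq> X \<longrightarrow> X = M"
  proof (rule subset_Zorn_nonempty)
    show "\<A> \<noteq> {}" using K0 Kd b0K unfolding \<A>_def by blast
    fix \<C> assume C: "\<C> \<noteq> {}" "subset.chain \<A> \<C>"
    show "\<Union>\<C> \<in> \<A>" unfolding \<A>_def
    proof (intro CollectI conjI ballI)
      obtain M0 where "M0 \<in> \<C>" using C(1) by blast
      moreover from this have "K \<subseteq> M0" using C(2) by (auto simp: subset.chain_def \<A>_def)
      ultimately show "K \<subseteq> \<Union>\<C>" by blast
      show "b0 \<notin> \<Union>\<C>" using C by (auto simp: subset.chain_def \<A>_def)
      fix x y assume "x \<in> \<Union>\<C>" "y \<in> \<Union>\<C>"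
      then obtain M M' where M: "M \<in> \<C>" "M' \<in> \<C>" "x \<in> M" "y \<in> M'" by blast
      then have "M \<subseteq> M' \<or> M' \<subseteq> M" using C by (auto simp: subset.chain_def)
      then obtain L where "L \<in> \<C>" "x \<in> L" "y \<in> L" using M by blast
      moreover from \<open>L \<in> \<C>\<close> have "L \<in> \<A>" using C(2) by (auto simp: subset.chain_def)
      ultimately have "x - y \<in> L" unfolding \<A>_def by simp
      with \<open>L \<in> \<C>\<close> show "x - y \<in> \<Union>\<C>" by (rule UnionI)
    qed
  qed
  then obtain M where MA: "M \<in> \<A>" and Mmax: "\<And>X. X \<in> \<A> \<Longrightarrow> M \<subseteq> X \<Longrightarrow> X = M"
    by blast
  from MA have M: "K \<subseteq> M" "\<And>x y. x \<in> M \<Longrightarrow> y \<in> M \<Longrightarrow> x - y \<in> M" "b0 \<notin> M"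
    unfolding \<A>_def by simp_all
  have M0: "0 \<in> M" using K0 M by blast
  have Mneg: "- x \<in> M" if "x \<in> M" for x using M(2)[OF M0 that] by simp
  have Madd: "x + y \<in> M" if "x \<in> M" "y \<in> M" for x y using M(2)[OF that(1) Mneg[OF that(2)]] by simp
  have Mcmul: "frag_cmul a x \<in> M" if "x \<in> M" for a x
    by (rule frag_closure_minus_cmul[where P = "\<lambda>x. x \<in> M"]) (use M0 M(2) that in auto)
  have Mp: "frag_cmul a x \<in> M" if "int p dvd a" for a x
  proof -
    obtain c where "a = int p * c" using \<open>int p dvd a\<close> unfolding dvd_def by blast
    then show ?thesis using pK[of "frag_cmul c x"] M(1) by auto
  qed
  have ub: "int p dvd a" if "frag_cmul a b0 \<in> M" for a
  proof (rule ccontr)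
    assume "\<not> int p dvd a"
    then obtain i where i: "int p dvd a * i - 1" using inverse by blast
    have "frag_cmul i (frag_cmul a b0) - frag_cmul (a * i - 1) b0 \<in> M"
      by (rule M(2)[OF Mcmul[OF that] Mp[OF i]])
    then have "b0 \<in> M" by (simp add: frag_cmul_diff_distrib mult.commute)
    then show False using M by blast
  qed
  have ex: "\<exists>j. x - frag_cmul j b0 \<in> M" for x
  proof (cases "x \<in> M")
    case True
    then show ?thesis by (intro exI[where x = 0]) simp
  next
    case False
    \<comment> \<open>By maximality, adjoining \<open>x\<close> to \<open>M\<close> must bring in
      \<open>b0\<close>. As \<open>M\<close> contains all multiples of \<open>p\<close>, the
      coefficient of \<open>x\<close> in the resulting expression for \<open>b0\<close> is
      invertible modulo \<open>p\<close>, so \<open>x\<close> is a multiple of \<open>b0\<close>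
      modulo \<open>M\<close>.\<close>
    let ?M = "{m + frag_cmul i x | m i. m \<in> M}"
    have sub: "M \<subseteq> ?M"
    proof
      fix m assume "m \<in> M"
      moreover have "m = m + frag_cmul 0 x" by simp
      ultimately show "m \<in> ?M" by blast
    qed
    have "x = 0 + frag_cmul 1 x" by simp
    then have "x \<in> ?M" using M0 by blast
    then have ne: "?M \<noteq> M" using False by metis
    have dif: "u - w \<in> ?M" if "u \<in> ?M" "w \<in> ?M" for u w
    proof -
      obtain m i m' i' where "u = m + frag_cmul i x" "w = m' + frag_cmul i' x" "m \<in> M" "m' \<in> M"
        using \<open>u \<in> ?M\<close> \<open>w \<in> ?M\<close> by blast
      then have "u - w = (m - m') + frag_cmul (i - i') x" "m - m' \<in> M"
        using M(2) by (auto simp: frag_cmul_diff_distrib)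
      then show ?thesis by blast
    qed
    have "b0 \<in> ?M"
    proof (rule ccontr)
      assume "b0 \<notin> ?M"
      then have "?M \<in> \<A>" unfolding \<A>_def using subset_trans[OF M(1) sub] dif
        by (intro CollectI conjI ballI) simp_all
      from Mmax[OF this sub] ne show False by (rule notE[rotated])
    qed
    then obtain m i where mi: "b0 = m + frag_cmul i x" "m \<in> M" by blast
    have "\<not> int p dvd i" using Mp[of i x] Madd mi M(3) by auto
    then obtain i' where i': "int p dvd i * i' - 1" using inverse by blast
    have "frag_cmul i' b0 = frag_cmul i' m + frag_cmul (i * i' - 1) x + x"
      by (subst mi(1)) (simp add: frag_cmul_distrib2 frag_cmul_diff_distrib mult.commute)
    then have "x - frag_cmul i' b0 = - (frag_cmul i' m + frag_cmul (i * i' - 1) x)"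
      by (simp add: algebra_simps)
    also have "\<dots> \<in> M" using mi(2) i' by (intro Mneg Madd Mcmul Mp)
    finally show ?thesis by blast
  qed
  define J where "J \<sigma> = (SOME j. frag_of \<sigma> - frag_cmul j b0 \<in> M)" for \<sigma>
  have J: "frag_of \<sigma> - frag_cmul (J \<sigma>) b0 \<in> M" for \<sigma>
    unfolding J_def by (rule someI_ex) (rule ex)
  have cJ: "x - frag_cmul (cev J x) b0 \<in> M" for x
    using subset_UNIV[of "Poly_Mapping.keys x"]
  proof (induction x rule: frag_induction)
    case zero
    then show ?case using M0 by simp
  next
    case (one \<sigma>)
    then show ?case using J by simp
  next
    case (diff a b)
    from M(2)[OF this] show ?case
      by (simp add: cev_diff frag_cmul_diff_distrib algebra_simps)
  qed
  have cJ_M: "int p dvd cev J x - e" if "x - frag_cmul e b0 \<in> M" for x e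
  proof (rule ub)
    have "frag_cmul (cev J x - e) b0 = (x - frag_cmul e b0) - (x - frag_cmul (cev J x) b0)"
      by (rule poly_mapping_eqI) (simp add: lookup_minus algebra_simps)
    then show "frag_cmul (cev J x - e) b0 \<in> M" using M(2)[OF that cJ[of x]] by (simp only:)
  qed
  \<comment> \<open>\<open>J\<close> takes the value 1 on \<open>b0\<close> modulo \<open>p\<close>,
    whereas \<open>\<eta>\<close> has to take the value \<open>\<gamma> \<sigma>0\<close>
    there.\<close>
  let ?\<eta> = "\<lambda>\<sigma>. \<gamma> \<sigma>0 * J \<sigma>"
  have c\<eta>: "cev ?\<eta> x = \<gamma> \<sigma>0 * cev J x" for x
    by (rule cev_mult_fun)
  show ?thesis
  proof (rule that[of ?\<eta>])
    fix b assume "b \<in> B"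
    then have "b \<in> K" using KI[of 0 b 0] by simp
    then have "int p dvd cev J b" using cJ_M[of b 0] M(1) by auto
    then show "int p dvd cev ?\<eta> b" unfolding c\<eta> by simp
  next
    show "nul p (singular_simplex (Suc k) Z) (\<gamma> - cobd k ?\<eta>)" unfolding nul_def
    proof (intro allI impI)
      fix \<sigma> assume \<sigma>: "singular_simplex (Suc k) Z \<sigma>"
      obtain i where i: "int p dvd \<gamma> \<sigma>0 * i - 1" using inverse \<sigma>0 by blast
      \<comment> \<open>Chosen so that \<open>\<sigma> - e \<sigma>0\<close> is killed by
        \<open>\<gamma>\<close> modulo \<open>p\<close>; its boundary then lies in
        \<open>K\<close>.\<close>
      define e where "e = i * \<gamma> \<sigma>"
      have e: "int p dvd \<gamma> \<sigma> - e * \<gamma> \<sigma>0"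
      proof -
        have "\<gamma> \<sigma> - e * \<gamma> \<sigma>0 = - \<gamma> \<sigma> * (\<gamma> \<sigma>0 * i - 1)" by (simp add: e_def algebra_simps)
        then show ?thesis using i by (metis dvd_mult)
      qed
      let ?d = "frag_of \<sigma> - frag_cmul e (frag_of \<sigma>0)"
      have "chain_boundary (Suc k) ?d \<in> K"
        using KI[of ?d 0 0] \<sigma> \<sigma>0 e B0
        by (simp add: singular_chain_diff singular_chain_cmul singular_chain_of cev_diff cev_cmul)
      then have "chain_boundary (Suc k) (frag_of \<sigma>) - frag_cmul e b0 \<in> M"
        using M(1) by (auto simp: chain_boundary_diff chain_boundary_cmul b0_def)
      from cJ_M[OF this] have "int p dvd cev J (chain_boundary (Suc k) (frag_of \<sigma>)) - e" .
      then have "int p dvd (\<gamma> \<sigma> - e * \<gamma> \<sigma>0) - \<gamma> \<sigma>0 * (cev J (chain_boundary (Suc k) (frag_of \<sigma>)) - e)"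
        using dvd_diff[OF e dvd_mult] by blast
      moreover have "cobd k ?\<eta> \<sigma> = \<gamma> \<sigma>0 * cev J (chain_boundary (Suc k) (frag_of \<sigma>))"
        using c\<eta> cev_chain_boundary[of ?\<eta> k "frag_of \<sigma>"] by simp
      ultimately show "int p dvd (\<gamma> - cobd k ?\<eta>) \<sigma>"
        by (simp add: algebra_simps)
    qed
  qed
qed

section \<open>Contractible spaces\<close>

text \<open>A contraction makes \<open>c\<close> homologous to its image under a constant map. In
  positive degree that image is a cycle of a one-point space and bounds; in degree 0 it is the
  augmentation of \<open>c\<close> times a point, hence the hypothesis \<open>aug\<close>.\<close>

lemma contractible_cycle_boundary:
  assumes Z: "contractible_space Z" and c: "singular_chain k Z c" "chain_boundary k c = 0"
    and aug: "k = 0 \<Longrightarrow> cev (\<lambda>_. 1) c = 0"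
  obtains w where "singular_chain (Suc k) Z w" "chain_boundary (Suc k) w = c"
proof -
  have cyc: "singular_relcycle k Z {} c"
    using c by (simp add: singular_cycle)
  obtain a where a: "homotopic_with (\<lambda>x. True) Z Z id (\<lambda>x. a)"
    using Z by (auto simp: contractible_space_def)
  then have ca: "continuous_map Z Z (\<lambda>x. a)"
    using homotopic_with_imp_continuous_maps by blast
  have "homotopic_with (\<lambda>h. h \<in> {} \<rightarrow> {}) Z Z id (\<lambda>x. a)"
    using a by (rule homotopic_with_mono) auto
  from homotopic_imp_homologous_rel_chain_maps[OF this cyc]
  have hom: "homologous_rel k Z {} c (chain_map k (\<lambda>x. a) c)"
    using chain_map_ident[OF c(1)] by simp
  have "singular_relboundary k Z {} (chain_map k (\<lambda>x. a) c)"
  proof (cases k)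
    case 0
    have *: "chain_map 0 (\<lambda>x. a) x = frag_cmul (cev (\<lambda>_. 1) x) (frag_of (restrict (\<lambda>_. a) (standard_simplex 0)))" for x :: "'a chain"
      using subset_UNIV[of "Poly_Mapping.keys x"]
    proof (induction x rule: frag_induction)
      case (one \<sigma>)
      then show ?case by (simp add: simplex_map_def restrict_def o_def)
    qed (simp_all add: chain_map_diff cev_diff frag_cmul_diff_distrib)
    show ?thesis using aug 0 by (simp add: *)
  next
    case (Suc j)
    show ?thesis
    proof (cases "topspace Z = {}")
      case True
      then have "c = 0" using c(1) by (simp add: singular_chain_empty)
      then show ?thesis by simp
    next
      case False
      then have aZ: "a \<in> topspace Z" using ca by (auto simp: continuous_map_def)
      let ?A = "subtopology Z {a}"
      have tA: "topspace ?A = {a}" using aZ by auto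
      have "continuous_map Z ?A (\<lambda>x. a)"
        using ca by (auto simp: continuous_map_in_subtopology)
      then have "singular_relcycle k ?A {} (chain_map k (\<lambda>x. a) c)"
        using singular_relcycle_chain_map[OF cyc] by blast
      then have "singular_relboundary k ?A {} (chain_map k (\<lambda>x. a) c)"
        using singular_boundary_eq_cycle_singleton[OF tA, of k] Suc by simp
      then show ?thesis
        by (auto simp: singular_boundary singular_chain_subtopology)
    qed
  qed
  then have "singular_relboundary k Z {} c"
    using hom singular_relboundary_add[of k Z "{}" "c - chain_map k (\<lambda>x. a) c" "chain_map k (\<lambda>x. a) c"]
    by (simp add: homologous_rel_def)
  then show thesis using that by (auto simp: singular_boundary)
qed

text \<open>Reduces acyclicity modulo \<open>p\<close> to integral acyclicity by duality with
  \<open>B = {0}\<close>. If \<open>\<partial> d = p f\<close>, then \<open>f\<close> is a cycle,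
  \<open>f = \<partial> z\<close>, and \<open>d - p z\<close> is an integral cycle, hence a
  boundary, on which a cocycle vanishes.\<close>

lemma contractible_cocycle:
  assumes Z: "contractible_space Z" and p: "prime p"
    and \<gamma>: "nul p (singular_simplex (Suc (Suc k)) Z) (cobd (Suc k) \<gamma>)"
  obtains s where "nul p (singular_simplex (Suc k) Z) (\<gamma> - cobd k s)"
proof -
  have nodual: "int p dvd cev \<gamma> d"
    if d: "singular_chain (Suc k) Z d" "b \<in> {0}" "chain_boundary (Suc k) d = b + frag_cmul (int p) f" for d b f
  proof -
    have p0: "int p \<noteq> 0" using p by auto
    have bd: "chain_boundary (Suc k) d = frag_cmul (int p) f" using d by simp
    have f: "singular_chain k Z f"
      using singular_chain_boundary_alt[OF d(1)] p0 unfolding bd singular_chain_def by auto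
    have "frag_cmul (int p) (chain_boundary k f) = 0"
      using chain_boundary_boundary[OF d(1)] by (simp add: bd chain_boundary_cmul)
    then have fc: "chain_boundary k f = 0" using p0 by auto
    have "cev (\<lambda>_. 1) f = 0" if "k = 0"
    proof -
      have "int p * cev (\<lambda>_. 1) f = cev 1 (chain_boundary (Suc 0) d)"
        using bd that by (simp add: cev_cmul one_fun_def)
      also have "\<dots> = 0"
        by (simp only: cev_chain_boundary cobd_one) (simp add: cev_def)
      finally show ?thesis using p0 by simp
    qed
    with f fc obtain z where z: "singular_chain (Suc k) Z z" "chain_boundary (Suc k) z = f"
      using contractible_cycle_boundary[OF Z] by metis
    have "singular_chain (Suc k) Z (d - frag_cmul (int p) z)"
      using d z by (intro singular_chain_diff singular_chain_cmul)
    moreover have "chain_boundary (Suc k) (d - frag_cmul (int p) z) = 0"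
      using bd z by (simp add: chain_boundary_diff chain_boundary_cmul)
    ultimately obtain w where w: "singular_chain (Suc (Suc k)) Z w"
      "chain_boundary (Suc (Suc k)) w = d - frag_cmul (int p) z"
      using contractible_cycle_boundary[OF Z, of "Suc k"] by (metis nat.distinct(1))
    have "cev \<gamma> d = cev (cobd (Suc k) \<gamma>) w + int p * cev \<gamma> z"
      using w(2) cev_chain_boundary[of \<gamma> "Suc k" w] by (simp add: cev_diff cev_cmul)
    then show ?thesis using cev_dvd_nul[OF \<gamma> w(1)] by simp
  qed
  show thesis
    by (rule coboundary_or_dual_chain[where B = "{0}" and \<gamma> = \<gamma> and k = k and Z = Z, OF p])
       (use nodual that in auto)
qed

lemma contractible_cocycle_0:
  assumes Z: "contractible_space Z" and \<gamma>: "nul p (singular_simplex 1 Z) (cobd 0 \<gamma>)"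
  obtains a where "nul p (singular_simplex 0 Z) (\<gamma> - smul a 1)"
proof (cases "\<exists>\<sigma>. singular_simplex 0 Z \<sigma>")
  case False
  then show ?thesis using that by (auto simp: nul_def)
next
  case True
  then obtain \<sigma> where \<sigma>: "singular_simplex 0 Z \<sigma>" by blast
  have "int p dvd \<gamma> \<tau> - \<gamma> \<sigma>" if \<tau>: "singular_simplex 0 Z \<tau>" for \<tau>
  proof -
    have "singular_chain 0 Z (frag_of \<tau> - frag_of \<sigma>)"
      using \<sigma> \<tau> by (intro singular_chain_diff) (auto simp: singular_chain_of)
    then obtain w where w: "singular_chain (Suc 0) Z w" "chain_boundary (Suc 0) w = frag_of \<tau> - frag_of \<sigma>"
      using contractible_cycle_boundary[OF Z, of 0 "frag_of \<tau> - frag_of \<sigma>"]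
      by (auto simp: cev_diff chain_boundary_def)
    have "\<gamma> \<tau> - \<gamma> \<sigma> = cev (cobd 0 \<gamma>) w"
      using w(2) cev_chain_boundary[of \<gamma> 0 w] by (simp add: cev_diff)
    then show ?thesis using cev_dvd_nul[OF _ w(1)] \<gamma> by simp
  qed
  then show ?thesis using that[of "\<gamma> \<sigma>"] by (auto simp: nul_def smul_def)
qed

context free_cyclic
begin

text \<open>In degree at least two the cocycle \<open>g\<close> has a primitive \<open>s\<close>,
  and the cocycle \<open>(T - 1) s\<close> has a primitive \<open>r\<close>. So \<open>g\<close> is
  the class of degree two times \<open>N r\<close>, and the induction hypothesis applies to
  \<open>N r\<close>.\<close>

lemma contractible_class:
  assumes Z: "contractible_space Z" and v: "ZZ v"
  shows "\<lbrakk>NL k (tw k g - g); NL (Suc k) (cobd k g)\<rbrakk> \<Longrightarrow> \<exists>a. CN k (g - smul a (nrm k (v k)))"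
proof (induction k arbitrary: g rule: less_induct)
  case (less k)
  consider "k = 0" | "k = Suc 0" | i where "k = Suc (Suc i)"
    by (metis not0_implies_Suc)
  then show ?case
  proof cases
    case 1
    then obtain a where a: "NL 0 (g - smul a 1)"
      using contractible_cocycle_0[OF Z, of p g] less.prems by auto
    have "NL 0 (smul a (nrm 0 (v 0) - 1))"
      using v by (intro nul_smul) (simp add: zigzag_def)
    from nul_diff[OF a this] have "NL 0 (g - smul a (nrm 0 (v 0)))"
      by (simp add: smul_diff)
    then show ?thesis using 1 cnull_nul by blast
  next
    case 2
    then obtain s where s: "NL (Suc 0) (g - cobd 0 s)"
      using contractible_cocycle[OF Z prime_p, of 0 g] less.prems by auto
    from less.prems(1) have inv: "NL (Suc 0) (tw (Suc 0) g - g)" unfolding 2 .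
    have "NL (Suc 0) (cobd 0 (tw 0 s - s))"
      using nul_add[OF nul_diff[OF inv nul_tw[OF s]] s]
      by (simp add: cobd_diff cobd_pb pb_diff algebra_simps)
    then obtain a where a: "NL 0 (tw 0 s - s - smul a 1)"
      using contractible_cocycle_0[OF Z, of p "tw 0 s - s"] by auto
    obtain \<mu> where \<mu>: "\<And>k c. NL k (tw k (\<mu> k c) - \<mu> k c - nrm k c)"
      "\<And>k c. NL k (\<mu> k (tw k c - c) - nrm k c)"
      "\<And>k c. NL k c \<Longrightarrow> NL k (\<mu> k c)"  "\<And>k c d. \<mu> k (c - d) = \<mu> k c - \<mu> k d"
      "\<And>k c. cobd k (\<mu> k c) = \<mu> (Suc k) (cobd k c)"
      using nrm_factor by blast
    have v1: "NL (Suc 0) (cobd 0 (v 0) - (tw (Suc 0) (v (Suc 0)) - v (Suc 0)))" and v0: "NL 0 (nrm 0 (v 0) - 1)"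
      using v by (auto simp: zigzag_def op_def dest: spec[where x = 0])
    from \<mu>(3)[OF v1] have "NL (Suc 0) (cobd 0 (\<mu> 0 (v 0)) - \<mu> (Suc 0) (tw (Suc 0) (v (Suc 0)) - v (Suc 0)))"
      by (simp add: \<mu>(4,5))
    from nul_sym[OF nul_trans[OF this \<mu>(2)]]
    have k1: "NL (Suc 0) (nrm (Suc 0) (v (Suc 0)) - cobd 0 (\<mu> 0 (v 0)))" .
    have k0: "NL 0 (tw 0 (\<mu> 0 (v 0)) - \<mu> 0 (v 0) - 1)"
      using nul_trans[OF \<mu>(1) v0] .
    \<comment> \<open>In degree 1 the deviation of \<open>s\<close> from invariance is a constant
      \<open>a\<close>. It is absorbed by \<open>\<mu> v_0\<close>, because
      \<open>(T - 1) \<mu> v_0 = N v_0 = 1\<close>.\<close>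
    define e where "e = s - smul a (\<mu> 0 (v 0))"
    have "NL 0 (tw 0 e - e)"
      using nul_diff[OF a nul_smul[OF k0, of a]]
      by (simp add: e_def pb_diff pb_smul smul_diff smul_add algebra_simps)
    moreover have "NL (Suc 0) (g - smul a (nrm (Suc 0) (v (Suc 0))) - cobd 0 e)"
      using nul_diff[OF s nul_smul[OF k1, of a]]
      by (simp add: e_def cobd_diff cobd_smul smul_diff smul_add algebra_simps)
    ultimately have "CN (Suc 0) (g - smul a (nrm (Suc 0) (v (Suc 0))))"
      by (auto simp: cnull_def)
    then show ?thesis using 2 by blast
  next
    case (3 i)
    let ?i1 = "Suc i" and ?i2 = "Suc (Suc i)"
    obtain s where s: "NL ?i2 (g - cobd ?i1 s)"
      using contractible_cocycle[OF Z prime_p, of ?i1 g] less.prems 3 by auto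
    from less.prems(1) have inv: "NL ?i2 (tw ?i2 g - g)" unfolding 3 .
    have "NL ?i2 (cobd ?i1 (tw ?i1 s - s))"
      using nul_add[OF nul_diff[OF inv nul_tw[OF s]] s]
      by (simp add: cobd_diff cobd_pb pb_diff algebra_simps)
    then obtain r where r: "NL ?i1 (tw ?i1 s - s - cobd i r)"
      using contractible_cocycle[OF Z prime_p, of i "tw ?i1 s - s"] by auto
    have per: "PER i (nrm i r) g"
      unfolding per_def using s r by (intro exI[where x = s] exI[where x = r]) simp
    have "NL ?i1 (nrm ?i1 (cobd i r))"
      using nul_sub[OF nul_sym, OF _ nrm_tw[of ?i1 s], of "nrm ?i1 (cobd i r)"] nul_nrm[OF r]
      by (simp add: nm_diff)
    then have "NL ?i1 (cobd i (nrm i r))" by (simp only: cobd_nm)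
    moreover have "i < k" using 3 by simp
    ultimately have "\<exists>a. CN i (nrm i r - smul a (nrm i (v i)))"
      using less.IH[OF _ tw_nrm[of i r]] by blast
    then obtain a where a: "CN i (nrm i r - smul a (nrm i (v i)))" by blast
    have "CN ?i2 (g - smul a (nrm ?i2 (v ?i2)))"
      by (rule cnull_per[OF per_diff[OF per per_smul[OF zigzag_per[OF v]]] a])
    then show ?thesis using 3 by blast
  qed
qed

end

section \<open>Lifting simplices to a free cyclic cover\<close>

lemma connected_segments:
  fixes K :: "(nat \<Rightarrow> real) set"
  assumes "\<And>x y t. x \<in> K \<Longrightarrow> y \<in> K \<Longrightarrow> 0 \<le> t \<Longrightarrow> t \<le> 1 \<Longrightarrow> (\<lambda>i. (1 - t) * x i + t * y i) \<in> K"
  shows "connected K"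
proof (rule path_connected_imp_connected)
  show "path_connected K"
    unfolding path_connected_def
  proof (intro ballI)
    fix x y assume xy: "x \<in> K" "y \<in> K"
    let ?g = "\<lambda>t::real. \<lambda>i. (1 - t) * x i + t * y i"
    have "path ?g"
      unfolding path_def
      by (rule continuous_on_coordinatewise_then_product) (intro continuous_intros)
    moreover have "path_image ?g \<subseteq> K"
      using assms[OF xy] by (auto simp: path_image_def)
    ultimately show "\<exists>g. path g \<and> path_image g \<subseteq> K \<and> pathstart g = x \<and> pathfinish g = y"
      by (intro exI[where x = ?g]) (simp add: pathstart_def pathfinish_def)
  qed
qed

text \<open>The metric on functions is the sum of the truncated coordinate distances with weights
  \<open>2^-n\<close>, and these weights add up to 2. It turns narrow boxes into sets of small
  diameter.\<close>

lemma dist_fun_le: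
  fixes x y :: "nat \<Rightarrow> real"
  assumes "\<And>i. \<bar>x i - y i\<bar> \<le> e"
  shows "dist x y \<le> 2 * e"
proof -
  have e: "0 \<le> e" using assms[of 0] by linarith
  have sm: "summable (\<lambda>n. (1/2)^n * min (dist (x (from_nat n)) (y (from_nat n))) 1)"
    by (rule summable_comparison_test'[of "\<lambda>n. (1/2)^n"]) (auto simp: summable_geometric_iff)
  have "suminf (\<lambda>n. (1/2)^n * min (dist (x (from_nat n)) (y (from_nat n))) 1) \<le> suminf (\<lambda>n. (1/2)^n * e)"
  proof (rule suminf_le)
    show "(1/2)^n * min (dist (x (from_nat n)) (y (from_nat n))) 1 \<le> (1/2)^n * e" for n
      using assms[of "from_nat n"] by (intro mult_left_mono) (auto simp: dist_real_def)
    show "summable (\<lambda>n. (1/2)^n * e)" by (intro summable_mult2 summable_geometric) simp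
  qed (rule sm)
  also have "\<dots> = 2 * e"
    by (simp add: suminf_mult2[symmetric] suminf_geometric summable_geometric)
  finally show ?thesis by (simp add: dist_fun_def)
qed

lemma powertop_real_eq: "powertop_real UNIV = (euclidean :: (nat \<Rightarrow> real) topology)"
  by (rule euclidean_product_topology)

lemma continuous_coordinate: "continuous_on S (\<lambda>x::nat \<Rightarrow> real. x i)"
  by (rule continuous_on_product_then_coordinatewise[OF continuous_on_id])

text \<open>Boxes cut out of the simplex. They are connected, and a hyperplane
  \<open>x d = c\<close> cuts a box into two boxes that meet in a box, which is what the gluing of
  lifts requires.\<close>

definition rect :: "nat \<Rightarrow> (nat \<Rightarrow> real) \<Rightarrow> (nat \<Rightarrow> real) \<Rightarrow> (nat \<Rightarrow> real) set" where
  "rect n lo hi = {x \<in> standard_simplex n. \<forall>i. lo i \<le> x i \<and> x i \<le> hi i}"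

lemma connected_rect: "connected (rect n lo hi)"
proof (rule connected_segments)
  fix x y :: "nat \<Rightarrow> real" and t :: real
  assume x: "x \<in> rect n lo hi" and y: "y \<in> rect n lo hi" and t: "0 \<le> t" "t \<le> 1"
  have "(\<lambda>i. (1 - t) * x i + t * y i) \<in> standard_simplex n"
    using convex_standard_simplex[of x n y t] x y t by (auto simp: rect_def)
  moreover have "lo i \<le> (1 - t) * x i + t * y i \<and> (1 - t) * x i + t * y i \<le> hi i" for i
  proof -
    have "lo i \<le> x i" "x i \<le> hi i" "lo i \<le> y i" "y i \<le> hi i" using x y by (auto simp: rect_def)
    then have "(1 - t) * lo i + t * lo i \<le> (1 - t) * x i + t * y i"
       "(1 - t) * x i + t * y i \<le> (1 - t) * hi i + t * hi i"
      using t by (intro add_mono mult_left_mono; simp)+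
    then show ?thesis by (simp add: algebra_simps)
  qed
  ultimately show "(\<lambda>i. (1 - t) * x i + t * y i) \<in> rect n lo hi" by (simp add: rect_def)
qed

text \<open>\<open>evenly\<close> is the covering condition, in the form of an open neighbourhood
  disjoint from its translates. Deriving it from freeness would take separation properties of
  \<open>Z\<close>; here an equivariant map to \<open>EG\<close> will provide it.\<close>

locale cyclic_cover = free_cyclic p Z T for p and Z :: "'a topology" and T +
  fixes Q :: "'b topology" and q :: "'a \<Rightarrow> 'b"
  assumes quot: "quotient_map Z Q q"
    and q_eq: "\<And>z z'. z \<in> topspace Z \<Longrightarrow> z' \<in> topspace Z \<Longrightarrow> q z = q z' \<longleftrightarrow> (\<exists>j<p. z' = (T ^^ j) z)"
    and evenly: "\<And>z. z \<in> topspace Z \<Longrightarrow>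
      \<exists>U. openin Z U \<and> z \<in> U \<and> (\<forall>j u. 0 < j \<longrightarrow> j < p \<longrightarrow> u \<in> U \<longrightarrow> (T ^^ j) u \<notin> U)"
begin

lemma pow_inv: "z \<in> topspace Z \<Longrightarrow> j \<le> p \<Longrightarrow> (T ^^ (p - j)) ((T ^^ j) z) = z"
  using period[of z] funpow_add[of "p - j" j T] by (metis comp_apply le_add_diff_inverse2)

lemma pow_inv': "z \<in> topspace Z \<Longrightarrow> j \<le> p \<Longrightarrow> (T ^^ j) ((T ^^ (p - j)) z) = z"
  using pow_inv[of z "p - j"] by simp

lemma openin_pow_image:
  assumes "openin Z U" "j \<le> p"
  shows "openin Z ((T ^^ j) ` U)"
proof -
  have "U \<subseteq> topspace Z" using assms openin_subset by blast
  then have "(T ^^ j) ` U = {z \<in> topspace Z. (T ^^ (p - j)) z \<in> U}"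
    using pow_inv pow_inv' assms(2) T_mem by (auto simp: image_iff) (metis subsetD)+
  then show ?thesis using openin_continuous_map_preimage[OF cont_pow assms(1)] by simp
qed

lemma q_mem: "z \<in> topspace Z \<Longrightarrow> q z \<in> topspace Q"
  using quotient_imp_surjective_map[OF quot] by (metis imageI)

lemma q_pow: "z \<in> topspace Z \<Longrightarrow> j < p \<Longrightarrow> q ((T ^^ j) z) = q z"
  using q_eq[of z "(T ^^ j) z"] T_mem[of z j] by auto

lemma open_map_q: "openin Z U \<Longrightarrow> openin Q (q ` U)"
proof -
  assume U: "openin Z U"
  then have sub: "U \<subseteq> topspace Z" by (rule openin_subset)
  have "{z \<in> topspace Z. q z \<in> q ` U} = (\<Union>j<p. (T ^^ j) ` U)"
  proof (intro equalityI subsetI)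
    fix z assume "z \<in> {z \<in> topspace Z. q z \<in> q ` U}"
    then obtain u where "u \<in> U" "q u = q z" "z \<in> topspace Z" by auto
    then show "z \<in> (\<Union>j<p. (T ^^ j) ` U)" using q_eq[of u z] sub by auto
  next
    fix z assume "z \<in> (\<Union>j<p. (T ^^ j) ` U)"
    then obtain u j where u: "u \<in> U" "j < p" "z = (T ^^ j) u" by auto
    then have "u \<in> topspace Z" "z \<in> topspace Z" using sub T_mem by auto
    then have "q u = q z" using q_pow u(2,3) by simp
    then have "q z \<in> q ` U" using u(1) by (metis imageI)
    then show "z \<in> {z \<in> topspace Z. q z \<in> q ` U}" using \<open>z \<in> topspace Z\<close> by simp
  qed
  also have "openin Z \<dots>" using openin_pow_image[OF U] by auto
  finally have "openin Z {z \<in> topspace Z. q z \<in> q ` U}" .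
  moreover have "q ` U \<subseteq> topspace Q" using sub q_mem by auto
  ultimately show ?thesis using quot by (simp add: quotient_map_def)
qed

definition is_lift :: "((nat \<Rightarrow> real) \<Rightarrow> 'b) \<Rightarrow> (nat \<Rightarrow> real) set \<Rightarrow> ((nat \<Rightarrow> real) \<Rightarrow> 'a) \<Rightarrow> bool" where
  "is_lift \<tau> K g \<longleftrightarrow> continuous_map (top_of_set K) Z g \<and> (\<forall>x\<in>K. q (g x) = \<tau> x)"

lemma is_lift_mem: "is_lift \<tau> K g \<Longrightarrow> x \<in> K \<Longrightarrow> g x \<in> topspace Z"
  by (auto simp: is_lift_def continuous_map_def)

lemma is_lift_subset: "is_lift \<tau> K g \<Longrightarrow> L \<subseteq> K \<Longrightarrow> is_lift \<tau> L g"
  unfolding is_lift_def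
  by (metis continuous_map_from_subtopology_mono subsetD)

text \<open>Near \<open>x\<close> the first lift stays in an evenly covered \<open>U\<close> and the
  second in the translate of \<open>U\<close> by \<open>T^j\<close>. Both lie over the same point,
  and \<open>U\<close> meets each orbit at most once.\<close>

lemma lift_local_shift:
  assumes g: "is_lift \<tau> K g" and g': "is_lift \<tau> K g'" and x: "x \<in> K" and j: "g' x = (T ^^ j) (g x)" "j < p"
  shows "\<exists>W. openin (top_of_set K) W \<and> x \<in> W \<and> (\<forall>y\<in>W. g' y = (T ^^ j) (g y))"
proof -
  obtain U where U: "openin Z U" "g x \<in> U" "\<And>j u. 0 < j \<Longrightarrow> j < p \<Longrightarrow> u \<in> U \<Longrightarrow> (T ^^ j) u \<notin> U"
    using evenly[OF is_lift_mem[OF g x]] by blast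
  have sub: "U \<subseteq> topspace Z" using U openin_subset by blast
  let ?W = "{y \<in> K. g y \<in> U} \<inter> {y \<in> K. g' y \<in> (T ^^ j) ` U}"
  have "openin (top_of_set K) ?W"
    using openin_continuous_map_preimage[of "top_of_set K" Z g U] openin_continuous_map_preimage[of "top_of_set K" Z g' "(T ^^ j) ` U"]
      g g' U(1) openin_pow_image[OF U(1), of j] j
    by (intro openin_Int) (auto simp: is_lift_def)
  moreover have "x \<in> ?W" using x U(2) j by auto
  moreover have "g' y = (T ^^ j) (g y)" if y: "y \<in> ?W" for y
  proof -
    have yK: "y \<in> K" "g y \<in> U" using y by auto
    obtain u where u: "u \<in> U" "g' y = (T ^^ j) u" using y by auto
    have mem: "g y \<in> topspace Z" "g' y \<in> topspace Z" "u \<in> topspace Z"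
      using is_lift_mem[OF g] is_lift_mem[OF g'] yK u(1) sub by auto
    have "q (g y) = q (g' y)" using g g' yK by (simp add: is_lift_def)
    also have "q (g' y) = q u" using q_pow mem u j by simp
    finally obtain i where i: "i < p" "u = (T ^^ i) (g y)" using q_eq mem by blast
    have "i = 0" using U(3)[of i "g y"] i yK u by (cases "i = 0") auto
    then show ?thesis using i u by simp
  qed
  ultimately show ?thesis by blast
qed

text \<open>The sets \<open>E j\<close> where the lifts differ by \<open>T^j\<close> are open and
  partition \<open>K\<close>, the latter by freeness; connectedness leaves only one of them.\<close>

lemma lift_unique:
  assumes g: "is_lift \<tau> K g" and g': "is_lift \<tau> K g'" and K: "connected K"
  shows "\<exists>j<p. \<forall>x\<in>K. g' x = (T ^^ j) (g x)"
proof (cases "K = {}")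
  case True
  then show ?thesis using p_pos by blast
next
  case False
  then obtain x0 where x0: "x0 \<in> K" by blast
  have ex: "\<exists>j<p. g' x = (T ^^ j) (g x)" if "x \<in> K" for x
    using q_eq[of "g x" "g' x"] is_lift_mem[OF g that] is_lift_mem[OF g' that] g g' that
    by (auto simp: is_lift_def)
  define E where "E j = {x \<in> K. g' x = (T ^^ j) (g x)}" for j
  have op: "openin (top_of_set K) (E j)" if "j < p" for j
  proof (subst openin_subopen, intro ballI)
    fix x assume "x \<in> E j"
    then obtain W where W: "openin (top_of_set K) W" "x \<in> W" "\<forall>y\<in>W. g' y = (T ^^ j) (g y)"
      using lift_local_shift[OF g g' _ _ \<open>j < p\<close>] by (auto simp: E_def)
    then have "W \<subseteq> E j" using openin_subset[OF W(1)] by (auto simp: E_def)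
    then show "\<exists>W. openin (top_of_set K) W \<and> x \<in> W \<and> W \<subseteq> E j" using W by blast
  qed
  obtain j where j: "j < p" "x0 \<in> E j" using ex[OF x0] x0 by (auto simp: E_def)
  have "K - E j = (\<Union>i\<in>{i. i < p \<and> i \<noteq> j}. E i)"
  proof (intro equalityI subsetI)
    fix x assume x: "x \<in> K - E j"
    then obtain i where "i < p" "g' x = (T ^^ i) (g x)" using ex by blast
    then show "x \<in> (\<Union>i\<in>{i. i < p \<and> i \<noteq> j}. E i)" using x by (auto simp: E_def)
  next
    fix x assume "x \<in> (\<Union>i\<in>{i. i < p \<and> i \<noteq> j}. E i)"
    then obtain i where i: "i < p" "i \<noteq> j" "x \<in> E i" by auto
    have "x \<notin> E j"
    proof
      assume "x \<in> E j"
      then have eq: "(T ^^ i) (g x) = (T ^^ j) (g x)" and xK: "x \<in> K" using i by (auto simp: E_def)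
      show False using pow_inj[OF is_lift_mem[OF g xK] eq] i j by simp
    qed
    then show "x \<in> K - E j" using i by (auto simp: E_def)
  qed
  moreover have "openin (top_of_set K) (\<Union>i\<in>{i. i < p \<and> i \<noteq> j}. E i)" using op by auto
  ultimately have "closedin (top_of_set K) (E j)"
    by (simp add: closedin_def) (auto simp: E_def)
  then have "E j = K" using K op[OF j(1)] j(2) unfolding connected_clopen by blast
  then show ?thesis using j by (auto simp: E_def)
qed

text \<open>On the connected overlap the lifts differ by one deck transformation; applying it to the
  first lift makes them agree.\<close>

lemma lift_glue:
  assumes g: "is_lift \<tau> A g" and g': "is_lift \<tau> B g'" and K: "K = A \<union> B"
    and cl: "closedin (top_of_set K) A" "closedin (top_of_set K) B" and conn: "connected (A \<inter> B)"
  shows "\<exists>g. is_lift \<tau> K g"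
proof -
  obtain j where j: "j < p" "\<forall>x\<in>A \<inter> B. g' x = (T ^^ j) (g x)"
    using lift_unique[OF is_lift_subset[OF g] is_lift_subset[OF g'] conn] by blast
  let ?h = "\<lambda>x. if x \<in> A then (T ^^ j) (g x) else g' x"
  have "continuous_map (top_of_set K) Z ?h"
  proof (rule pasting_lemma_closed[where I = "{True, False}" and T = "\<lambda>b. if b then A else B"
        and f = "\<lambda>b. if b then (\<lambda>x. (T ^^ j) (g x)) else g'"])
    fix b :: bool
    have "continuous_map (top_of_set A) Z (\<lambda>x. (T ^^ j) (g x))"
      using continuous_map_compose[OF _ cont_pow, of "top_of_set A" g j] g by (simp add: is_lift_def o_def)
    moreover have "subtopology (top_of_set K) A = top_of_set A" "subtopology (top_of_set K) B = top_of_set B"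
      using K by (auto simp: subtopology_subtopology Int_absorb1)
    ultimately show "continuous_map (subtopology (top_of_set K) (if b then A else B)) Z
        (if b then (\<lambda>x. (T ^^ j) (g x)) else g')"
      using g' by (auto simp: is_lift_def)
  qed (use cl j K in auto)
  moreover have "q (?h x) = \<tau> x" if "x \<in> K" for x
  proof (cases "x \<in> A")
    case True
    have "g x \<in> topspace Z" using is_lift_mem[OF g True] .
    then show ?thesis using q_pow[OF _ j(1)] g True by (simp add: is_lift_def)
  next
    case False
    then show ?thesis using that K g' by (auto simp: is_lift_def)
  qed
  ultimately show ?thesis unfolding is_lift_def by blast
qed

text \<open>On an evenly covered \<open>U\<close> the map \<open>q\<close> is injective and open, so
  its inverse is a continuous local section.\<close>

lemma lift_local:
  assumes \<tau>: "continuous_map (top_of_set D) Q \<tau>" and x: "x \<in> D"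
  shows "\<exists>G. open G \<and> x \<in> G \<and> (\<exists>g. is_lift \<tau> (D \<inter> G) g)"
proof -
  have "\<tau> x \<in> topspace Q" using \<tau> x by (auto simp: continuous_map_def)
  then obtain z where z: "z \<in> topspace Z" "q z = \<tau> x"
    using quotient_imp_surjective_map[OF quot] by (metis imageE)
  obtain U where U: "openin Z U" "z \<in> U" "\<And>j u. 0 < j \<Longrightarrow> j < p \<Longrightarrow> u \<in> U \<Longrightarrow> (T ^^ j) u \<notin> U"
    using evenly[OF z(1)] by blast
  have sub: "U \<subseteq> topspace Z" using U openin_subset by blast
  have inj: "inj_on q U"
  proof (rule inj_onI)
    fix a b assume ab: "a \<in> U" "b \<in> U" "q a = q b"
    then obtain j where "j < p" "b = (T ^^ j) a" using q_eq[of a b] sub by blast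
    then show "a = b" using U(3)[of j a] ab by (cases "j = 0") auto
  qed
  let ?s = "inv_into U q"
  have s: "continuous_map (subtopology Q (q ` U)) Z ?s"
    unfolding continuous_map_def
  proof (intro conjI allI impI)
    show "?s \<in> topspace (subtopology Q (q ` U)) \<rightarrow> topspace Z"
      using inv_into_into[of _ q U] sub by auto
    fix W assume W: "openin Z W"
    have "{y \<in> topspace (subtopology Q (q ` U)). ?s y \<in> W} = q ` (U \<inter> W)"
      using inj sub q_mem by (auto simp: inv_into_f_f)
    moreover have "openin Q (q ` (U \<inter> W))" using open_map_q U(1) W by blast
    ultimately show "openin (subtopology Q (q ` U)) {y \<in> topspace (subtopology Q (q ` U)). ?s y \<in> W}"
      by (auto simp: openin_subtopology intro!: exI[where x = "q ` (U \<inter> W)"])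
  qed
  have "openin (top_of_set D) {y \<in> topspace (top_of_set D). \<tau> y \<in> q ` U}"
    using openin_continuous_map_preimage[OF \<tau> open_map_q[OF U(1)]] .
  then obtain G where G: "open G" "{y \<in> D. \<tau> y \<in> q ` U} = D \<inter> G"
    by (auto simp: openin_open)
  have "x \<in> G" using G(2) x z U(2) by (metis (mono_tags, lifting) IntD2 imageI mem_Collect_eq)
  have "continuous_map (top_of_set (D \<inter> G)) (subtopology Q (q ` U)) \<tau>"
    using continuous_map_from_subtopology_mono[OF \<tau>, of "D \<inter> G"] G(2)
    by (auto simp: continuous_map_in_subtopology)
  from continuous_map_compose[OF this s] have "continuous_map (top_of_set (D \<inter> G)) Z (?s \<circ> \<tau>)" .
  moreover have "q ((?s \<circ> \<tau>) y) = \<tau> y" if "y \<in> D \<inter> G" for y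
    using that G(2) by (simp add: f_inv_into_f) (metis (no_types, lifting) IntI f_inv_into_f mem_Collect_eq)
  ultimately show ?thesis using G(1) \<open>x \<in> G\<close> unfolding is_lift_def by blast
qed

lemma lift_rect:
  assumes \<tau>: "continuous_map (top_of_set (standard_simplex n)) Q \<tau>"
  shows "\<exists>g. is_lift \<tau> (rect n lo hi) g"
proof -
  let ?D = "standard_simplex n"
  have comp: "compact ?D"
    using compactin_standard_simplex[of n] by (simp add: powertop_real_eq)
  define \<G> where "\<G> = {G. open G \<and> (\<exists>g. is_lift \<tau> (?D \<inter> G) g)}"
  have cover: "?D \<subseteq> \<Union>\<G>" using lift_local[OF \<tau>] by (force simp: \<G>_def)
  obtain \<epsilon> where \<epsilon>: "0 < \<epsilon>" "\<And>x. x \<in> ?D \<Longrightarrow> \<exists>G\<in>\<G>. ball x \<epsilon> \<subseteq> G"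
    by (rule Heine_Borel_lemma[OF comp cover]) (auto simp: \<G>_def)
  \<comment> \<open>\<open>\<epsilon>\<close> is a Lebesgue number: a box with sides at most
    \<open>\<delta>\<close> has diameter at most \<open>2 \<delta> < \<epsilon>\<close> and fits
    into one member of the cover.\<close>
  define \<delta> where "\<delta> = \<epsilon> / 3"
  have \<delta>: "0 < \<delta>" "2 * \<delta> < \<epsilon>" using \<epsilon> by (auto simp: \<delta>_def)
  \<comment> \<open>Induction on the number \<open>d\<close> of directions in which the box may be
    long; \<open>d = Suc n\<close> restricts no direction of the simplex.\<close>
  have "\<forall>lo hi. (\<forall>i. d \<le> i \<longrightarrow> i \<le> n \<longrightarrow> hi i - lo i \<le> \<delta>) \<longrightarrow> (\<exists>g. is_lift \<tau> (rect n lo hi) g)" for d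
  proof (induction d)
    case 0
    show ?case
    proof (intro allI impI)
      fix lo hi :: "nat \<Rightarrow> real" assume w: "\<forall>i. 0 \<le> i \<longrightarrow> i \<le> n \<longrightarrow> hi i - lo i \<le> \<delta>"
      show "\<exists>g. is_lift \<tau> (rect n lo hi) g"
      proof (cases "rect n lo hi = {}")
        case True
        then show ?thesis by (auto simp: is_lift_def continuous_map_def)
      next
        case False
        then obtain x where x: "x \<in> rect n lo hi" by blast
        then obtain G where G: "G \<in> \<G>" "ball x \<epsilon> \<subseteq> G" using \<epsilon>(2)[of x] by (auto simp: rect_def)
        have "rect n lo hi \<subseteq> ?D \<inter> G"
        proof
          fix y assume y: "y \<in> rect n lo hi"
          have xy: "\<bar>x i - y i\<bar> \<le> \<delta>" for i
          proof (cases "i \<le> n")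
            case True
            have "lo i \<le> x i" "x i \<le> hi i" "lo i \<le> y i" "y i \<le> hi i" using x y by (auto simp: rect_def)
            then show ?thesis using w True by fastforce
          next
            case False
            then have "x i = 0" "y i = 0" using x y by (auto simp: rect_def standard_simplex_def)
            then show ?thesis using \<delta> by simp
          qed
          have "dist x y < \<epsilon>" using dist_fun_le[of x y, OF xy] \<delta> by linarith
          then show "y \<in> ?D \<inter> G" using G y by (auto simp: rect_def)
        qed
        moreover obtain g where "is_lift \<tau> (?D \<inter> G) g" using G by (auto simp: \<G>_def)
        ultimately show ?thesis using is_lift_subset by blast
      qed
    qed
  next
    case (Suc d)
    show ?case
    proof (intro allI impI)
      fix lo hi :: "nat \<Rightarrow> real" assume w: "\<forall>i. Suc d \<le> i \<longrightarrow> i \<le> n \<longrightarrow> hi i - lo i \<le> \<delta>"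
      let ?c = "\<lambda>l::nat. lo d + real l * \<delta>"
      have IHd: "\<exists>g. is_lift \<tau> (rect n lo' hi') g"
        if a: "hi' d - lo' d \<le> \<delta>" "\<And>i. i \<noteq> d \<Longrightarrow> lo' i = lo i \<and> hi' i = hi i" for lo' hi'
      proof -
        have "hi' i - lo' i \<le> \<delta>" if "d \<le> i" "i \<le> n" for i
          using w a(1) a(2)[of i] that by (cases "i = d") auto
        then show ?thesis using Suc.IH by blast
      qed
      \<comment> \<open>Sweep across direction \<open>d\<close> in layers of thickness
        \<open>\<delta>\<close>, gluing one layer at a time, starting from a box of thickness
        zero.\<close>
      have step: "\<exists>g. is_lift \<tau> (rect n lo (hi(d := ?c l))) g" for l
      proof (induction l)
        case 0
        show ?case by (rule IHd) (use \<delta> in auto)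
      next
        case (Suc l)
        let ?A = "rect n lo (hi(d := ?c l))" and ?B = "rect n (lo(d := ?c l)) (hi(d := ?c (Suc l)))"
          and ?K = "rect n lo (hi(d := ?c (Suc l)))"
        have c: "lo d \<le> ?c l" "?c l \<le> ?c (Suc l)" using \<delta> by (auto simp: algebra_simps)
        obtain g where g: "is_lift \<tau> ?A g" using Suc.IH by blast
        have "\<exists>g. is_lift \<tau> ?B g" by (rule IHd) (auto simp: algebra_simps)
        then obtain g' where g': "is_lift \<tau> ?B g'" by blast
        have A: "?A = ?K \<inter> {x. x d \<le> ?c l}" and B: "?B = ?K \<inter> {x. ?c l \<le> x d}"
          and AB: "?A \<inter> ?B = rect n (lo(d := ?c l)) (hi(d := ?c l))"
        proof -
          have rd: "x \<in> rect n lo' hi' \<longleftrightarrow> x \<in> standard_simplex n \<and> (lo' d \<le> x d \<and> x d \<le> hi' d) \<and>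
              (\<forall>i. i \<noteq> d \<longrightarrow> lo' i \<le> x i \<and> x i \<le> hi' i)" for x lo' hi'
            by (auto simp: rect_def)
          show "?A = ?K \<inter> {x. x d \<le> ?c l}" "?B = ?K \<inter> {x. ?c l \<le> x d}"
            "?A \<inter> ?B = rect n (lo(d := ?c l)) (hi(d := ?c l))"
            using c by (auto simp only: rd fun_upd_same fun_upd_other Int_iff mem_Collect_eq cong: conj_cong) auto
        qed
        have conn: "connected (?A \<inter> ?B)" unfolding AB by (rule connected_rect)
        have cl: "closed {x :: nat \<Rightarrow> real. x d \<le> ?c l}" "closed {x :: nat \<Rightarrow> real. ?c l \<le> x d}"
          by (intro closed_Collect_le continuous_coordinate continuous_on_const)+
        show ?case
        proof (rule lift_glue[OF g g' _ _ _ conn])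
          show "?K = ?A \<union> ?B" unfolding A B by auto
          show "closedin (top_of_set ?K) ?A" "closedin (top_of_set ?K) ?B"
            unfolding A B using cl by (auto simp: closedin_closed)
        qed
      qed
      obtain l :: nat where "(hi d - lo d) / \<delta> \<le> real l" using real_arch_simple by blast
      then have "hi d \<le> ?c l" using \<delta> by (simp add: field_simps)
      then have "rect n lo hi \<subseteq> rect n lo (hi(d := ?c l))"
        by (auto simp: rect_def) (metis order_trans)
      then show "\<exists>g. is_lift \<tau> (rect n lo hi) g" using step[of l] is_lift_subset by blast
    qed
  qed
  from this[of "Suc n"] show ?thesis by auto
qed

lemma simplex_lift:
  assumes "singular_simplex n Q \<tau>"
  obtains \<sigma> where "singular_simplex n Z \<sigma>" "simplex_map n q \<sigma> = \<tau>"
proof -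
  have \<tau>: "continuous_map (top_of_set (standard_simplex n)) Q \<tau>" "\<tau> \<in> extensional (standard_simplex n)"
    using assms by (auto simp: singular_simplex_def powertop_real_eq)
  have "rect n (\<lambda>_. 0) (\<lambda>_. 1) = standard_simplex n"
    by (auto simp: rect_def standard_simplex_def)
  then obtain g where g: "is_lift \<tau> (standard_simplex n) g"
    using lift_rect[OF \<tau>(1), of "\<lambda>_. 0" "\<lambda>_. 1"] by auto
  show thesis
  proof (rule that[of "restrict g (standard_simplex n)"])
    show "singular_simplex n Z (restrict g (standard_simplex n))"
      using g continuous_map_eq[of "top_of_set (standard_simplex n)" Z g "restrict g (standard_simplex n)"]
      by (auto simp: singular_simplex_def powertop_real_eq is_lift_def)
    show "simplex_map n q (restrict g (standard_simplex n)) = \<tau>"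
      using g \<tau>(2) by (auto simp: simplex_map_def is_lift_def fun_eq_iff extensional_def)
  qed
qed

lemma simplex_lift_unique:
  assumes "singular_simplex n Z \<sigma>" "singular_simplex n Z \<sigma>'" "simplex_map n q \<sigma> = simplex_map n q \<sigma>'"
  obtains j where "j < p" "\<sigma>' = simplex_map n (T ^^ j) \<sigma>"
proof -
  let ?D = "standard_simplex n"
  have "is_lift (simplex_map n q \<sigma>) ?D \<sigma>" "is_lift (simplex_map n q \<sigma>) ?D \<sigma>'"
    using assms(1,2) fun_cong[OF assms(3)]
    by (auto simp: singular_simplex_def powertop_real_eq is_lift_def simplex_map_def) (metis comp_apply)
  moreover have "connected ?D"
    using connectedin_standard_simplex[of n] by (simp add: powertop_real_eq)
  ultimately obtain j where j: "j < p" "\<forall>x\<in>?D. \<sigma>' x = (T ^^ j) (\<sigma> x)" using lift_unique by blast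
  moreover have "\<sigma>' = simplex_map n (T ^^ j) \<sigma>"
    using j(2) assms(2) by (auto simp: simplex_map_def singular_simplex_def fun_eq_iff extensional_def)
  ultimately show thesis using that by blast
qed

end

section \<open>Equivariant maps\<close>

locale equivariant_pair = D: free_cyclic p Z T + C: free_cyclic p Y S
  for p and Z :: "'a topology" and T and Y :: "'b topology" and S +
  fixes f :: "'a \<Rightarrow> 'b"
  assumes f_cont: "continuous_map Z Y f"
    and f_eqv: "\<And>z. z \<in> topspace Z \<Longrightarrow> f (T z) = S (f z)"
begin

lemma f_pow: "z \<in> topspace Z \<Longrightarrow> f ((T ^^ j) z) = (S ^^ j) (f z)"
proof (induction j)
  case (Suc j)
  then show ?case using f_eqv[OF D.T_mem[OF Suc.prems, of j]] by simp
qed simp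

lemma simplex_map_eqv:
  "singular_simplex k Z \<sigma> \<Longrightarrow>
    simplex_map k (S ^^ j) (simplex_map k f \<sigma>) = simplex_map k f (simplex_map k (T ^^ j) \<sigma>)"
  using simplex_map_eq[of k Z \<sigma> "(S ^^ j) \<circ> f" "f \<circ> (T ^^ j)"] f_pow
  by (simp add: simplex_map_compose)

lemma simplex_map_eqv1:
  "singular_simplex k Z \<sigma> \<Longrightarrow>
    simplex_map k S (simplex_map k f \<sigma>) = simplex_map k f (simplex_map k T \<sigma>)"
  using simplex_map_eqv[of k \<sigma> 1] by simp

lemma pb_tw: "D.NL k (pb k f (pb k S c) - pb k T (pb k f c))"
  by (simp add: nul_def pb_def simplex_map_eqv1)

lemma pb_nrm: "D.NL k (pb k f (nm p S k c) - nm p T k (pb k f c))"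
  by (simp add: nul_def pb_def nm_def simplex_map_eqv)

lemma pb_op: "D.NL k (pb k f (op p S j k c) - op p T j k (pb k f c))"
  using pb_tw[of k c] pb_nrm[of k c] by (auto simp: op_def pb_diff)

lemma nul_pbf: "C.NL k c \<Longrightarrow> D.NL k (pb k f c)"
  using nul_pb f_cont by blast

lemma pb_cnull: "C.CN k c \<Longrightarrow> D.CN k (pb k f c)"
proof (cases k)
  case 0
  assume "C.CN k c"
  then show ?thesis using 0 nul_pbf[of 0 c] by (simp add: cnull_def)
next
  case (Suc j)
  assume "C.CN k c"
  then obtain e where e: "C.NL j (pb j S e - e)" "C.NL k (c - cobd j e)"
    using Suc by (auto simp: cnull_def)
  have "D.NL j (pb j T (pb j f e) - pb j f e)"
    using nul_trans[OF nul_sym[OF pb_tw] nul_pbf[OF e(1), unfolded pb_diff]] .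
  moreover have "D.NL k (pb k f c - cobd j (pb j f e))"
    using nul_pbf[OF e(2)] Suc by (simp add: pb_diff cobd_pb)
  ultimately show ?thesis using Suc by (auto simp: cnull_def)
qed

text \<open>This naturality, combined with \<open>zigzag_unique\<close>, compares the classes of two
  spaces along any equivariant map.\<close>

lemma pb_zigzag:
  assumes v: "C.ZZ v"
  shows "D.ZZ (\<lambda>k. pb k f (v k))"
  unfolding zigzag_def
proof (intro conjI allI)
  have "C.NL 0 (nm p S 0 (v 0) - 1)" using v by (simp add: zigzag_def)
  from nul_pbf[OF this] have "D.NL 0 (pb 0 f (nm p S 0 (v 0)) - 1)"
    by (simp add: pb_diff pb_1)
  from nul_trans[OF nul_sym[OF pb_nrm] this] show "D.NL 0 (nm p T 0 (pb 0 f (v 0)) - 1)" .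
  fix k
  have "C.NL (Suc k) (cobd k (v k) - op p S (Suc k) (Suc k) (v (Suc k)))" using v by (simp add: zigzag_def)
  from nul_pbf[OF this] have "D.NL (Suc k) (cobd k (pb k f (v k)) - pb (Suc k) f (op p S (Suc k) (Suc k) (v (Suc k))))"
    by (simp add: pb_diff cobd_pb)
  from nul_trans[OF this pb_op]
  show "D.NL (Suc k) (cobd k (pb k f (v k)) - op p T (Suc k) (Suc k) (pb (Suc k) f (v (Suc k))))" .
qed

end

section \<open>Cohomology of the quotient\<close>

text \<open>The counterpart of \<open>cnull\<close> without invariance: a class vanishes modulo
  \<open>p\<close> on a space that carries no action.\<close>

definition cob :: "nat \<Rightarrow> 'a topology \<Rightarrow> nat \<Rightarrow> 'a cochain \<Rightarrow> bool" where
  "cob p Z k c \<longleftrightarrow> (case k of 0 \<Rightarrow> nul p (singular_simplex 0 Z) c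
     | Suc j \<Rightarrow> \<exists>e. nul p (singular_simplex k Z) (c - cobd j e))"

context cyclic_cover
begin

lemma simplex_q_pow:
  assumes "singular_simplex k Z \<sigma>" "j < p"
  shows "simplex_map k q (simplex_map k (T ^^ j) \<sigma>) = simplex_map k q \<sigma>"
  using simplex_map_eq[OF assms(1), of "q \<circ> (T ^^ j)" q] q_pow assms(2)
  by (simp add: simplex_map_compose)

text \<open>Every simplex of the quotient lifts, so pulling back along \<open>q\<close> loses
  nothing.\<close>

lemma nul_q: "NL k (pb k q c) \<longleftrightarrow> nul p (singular_simplex k Q) c"
proof
  assume "nul p (singular_simplex k Q) c"
  then show "NL k (pb k q c)" using nul_pb quotient_imp_continuous_map[OF quot] by blast
next
  assume L: "NL k (pb k q c)"
  show "nul p (singular_simplex k Q) c"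
    unfolding nul_def
  proof (intro allI impI)
    fix \<tau> assume "singular_simplex k Q \<tau>"
    then obtain \<sigma> where "singular_simplex k Z \<sigma>" "simplex_map k q \<sigma> = \<tau>" by (rule simplex_lift)
    then show "int p dvd c \<tau>" using L by (auto simp: nul_def pb_def)
  qed
qed

lemma pb_q_inv: "NL k (tw k (pb k q c) - pb k q c)"
proof -
  have "simplex_map k q (simplex_map k T \<sigma>) = simplex_map k q \<sigma>" if "singular_simplex k Z \<sigma>" for \<sigma>
    using simplex_q_pow[OF that, of 1] prime_gt_1_nat[OF prime_p] by simp
  then show ?thesis by (simp add: nul_def pb_def)
qed

text \<open>Evaluate \<open>g\<close> on a chosen lift; two lifts differ by a deck transformation,
  so by invariance the choice does not matter modulo \<open>p\<close>.\<close>

lemma descend: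
  assumes g: "NL k (tw k g - g)"
  obtains c where "NL k (pb k q c - g)"
proof
  let ?l = "\<lambda>\<tau>. SOME \<sigma>. singular_simplex k Z \<sigma> \<and> simplex_map k q \<sigma> = \<tau>"
  show "NL k (pb k q (\<lambda>\<tau>. g (?l \<tau>)) - g)"
    unfolding nul_def
  proof (intro allI impI)
    fix \<sigma> assume \<sigma>: "singular_simplex k Z \<sigma>"
    let ?s = "?l (simplex_map k q \<sigma>)"
    have "singular_simplex k Z ?s \<and> simplex_map k q ?s = simplex_map k q \<sigma>"
      by (rule someI[of "\<lambda>s. singular_simplex k Z s \<and> simplex_map k q s = simplex_map k q \<sigma>" \<sigma>])
         (simp add: \<sigma>)
    then obtain j where "j < p" "?s = simplex_map k (T ^^ j) \<sigma>"
      using simplex_lift_unique[OF \<sigma>, of ?s] by metis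
    then have "int p dvd g ?s - g \<sigma>" using inv_pow[OF g \<sigma>] by simp
    then show "int p dvd (pb k q (\<lambda>\<tau>. g (?l \<tau>)) - g) \<sigma>" by (simp add: pb_def)
  qed
qed

text \<open>Primitives on the quotient are pulled back, and invariant primitives upstairs are
  descended. So the cohomology of the quotient is that of the invariant cochains.\<close>

lemma cob_q: "cob p Q k c \<longleftrightarrow> CN k (pb k q c)"
proof (cases k)
  case 0
  then show ?thesis using nul_q[of 0 c] by (simp add: cob_def cnull_def)
next
  case (Suc j)
  show ?thesis
  proof
    assume "cob p Q k c"
    then obtain e where "nul p (singular_simplex k Q) (c - cobd j e)" using Suc by (auto simp: cob_def)
    then have "NL k (pb k q c - cobd j (pb j q e))" using nul_q[of k "c - cobd j e"] Suc
      by (simp add: pb_diff cobd_pb)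
    then show "CN k (pb k q c)" using Suc pb_q_inv by (auto simp: cnull_def)
  next
    assume "CN k (pb k q c)"
    then obtain e where e: "NL j (tw j e - e)" "NL k (pb k q c - cobd j e)" using Suc by (auto simp: cnull_def)
    obtain e' where e': "NL j (pb j q e' - e)" using descend[OF e(1)] by blast
    have "NL k (cobd j e - cobd j (pb j q e'))"
      using nul_cobd[OF nul_sym[OF e']] Suc by (simp add: cobd_diff)
    from nul_trans[OF e(2) this] have "NL k (pb k q (c - cobd j e'))"
      using Suc by (simp add: pb_diff cobd_pb)
    then show "cob p Q k c" using nul_q Suc by (auto simp: cob_def)
  qed
qed

end

section \<open>Cohomology groups with cyclic coefficients\<close>

lemma finprod_integer_mod_group:
  assumes "finite I" "p > 0" "f \<in> I \<rightarrow> {0..<int p}"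
  shows "finprod (integer_mod_group p) f I = (\<Sum>i\<in>I. f i) mod int p"
proof -
  interpret comm_group "integer_mod_group p" by simp
  show ?thesis using assms(1,3)
  proof (induction I rule: finite_induct)
    case (insert a F)
    then have "f \<in> F \<rightarrow> carrier (integer_mod_group p)" "f a \<in> carrier (integer_mod_group p)"
      using assms(2) by (auto simp: carrier_integer_mod_group)
    then show ?case using insert by (simp add: mod_add_right_eq)
  qed simp
qed

lemma coboundary_integer_mod_group:
  assumes p: "p > 0" and \<sigma>: "singular_simplex (Suc k) Q \<sigma>"
  shows "coboundary k Q (integer_mod_group p) c \<sigma> = cobd k c \<sigma> mod int p"
proof -
  have "coboundary k Q (integer_mod_group p) c \<sigma> =
     (\<Sum>i\<le>Suc k. ((-1) ^ i * c (singular_face (Suc k) i \<sigma>)) mod int p) mod int p"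
    using \<sigma> p unfolding coboundary_def
    by (simp add: int_pow_integer_mod_group del: sum.atMost_Suc)
       (subst finprod_integer_mod_group; auto simp del: sum.atMost_Suc)
  also have "\<dots> = cobd k c \<sigma> mod int p"
    unfolding cobd_def by (rule mod_sum_eq)
  finally show ?thesis .
qed

lemma carrier_cochain_group:
  "p > 0 \<Longrightarrow> carrier (cochain_group k Q (integer_mod_group p)) = singular_simplex_set k Q \<rightarrow>\<^sub>E {0..<int p}"
  by (simp add: cochain_group_def carrier_integer_mod_group)

lemma mult_cochain_group:
  "b \<otimes>\<^bsub>cochain_group k Q (integer_mod_group p)\<^esub> c = (\<lambda>\<sigma>\<in>singular_simplex_set k Q. (b \<sigma> + c \<sigma>) mod int p)"
  by (simp add: cochain_group_def)

lemma cocycle_set_eq: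
  assumes "p > 0"
  shows "cocycle_set k Q (integer_mod_group p) =
    {c \<in> singular_simplex_set k Q \<rightarrow>\<^sub>E {0..<int p}. nul p (singular_simplex (Suc k) Q) (cobd k c)}"
proof -
  have "coboundary k Q (integer_mod_group p) c = (\<lambda>\<sigma>\<in>singular_simplex_set (Suc k) Q. 0) \<longleftrightarrow>
    nul p (singular_simplex (Suc k) Q) (cobd k c)" for c
  proof -
    have "coboundary k Q (integer_mod_group p) c = (\<lambda>\<sigma>\<in>singular_simplex_set (Suc k) Q. cobd k c \<sigma> mod int p)"
    proof
      fix \<sigma> show "coboundary k Q (integer_mod_group p) c \<sigma> = (\<lambda>\<sigma>\<in>singular_simplex_set (Suc k) Q. cobd k c \<sigma> mod int p) \<sigma>"
        using coboundary_integer_mod_group[OF assms, of k Q \<sigma> c]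
        by (cases "singular_simplex (Suc k) Q \<sigma>") (auto simp: coboundary_def)
    qed
    then show ?thesis by (auto simp: nul_def fun_eq_iff dvd_eq_mod_eq_0)
  qed
  moreover have "\<one>\<^bsub>cochain_group (Suc k) Q (integer_mod_group p)\<^esub> = (\<lambda>\<sigma>\<in>singular_simplex_set (Suc k) Q. 0)"
    by (simp add: cochain_group_def)
  ultimately show ?thesis
    unfolding cocycle_set_def kernel_def carrier_cochain_group[OF assms] by simp
qed

text \<open>Elements of the cochain group are the extensional functions with values in
  \<open>0..p-1\<close>; an integer primitive enters the group after reduction to its
  residues.\<close>

lemma coboundary_set_eq:
  assumes "p > 0"
  shows "coboundary_set k Q (integer_mod_group p) =
    {c \<in> singular_simplex_set k Q \<rightarrow>\<^sub>E {0..<int p}. cob p Q k c}"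
proof (cases k)
  case 0
  have "c = (\<lambda>\<sigma>\<in>singular_simplex_set 0 Q. 0)"
    if "c \<in> singular_simplex_set 0 Q \<rightarrow>\<^sub>E {0..<int p}" "nul p (singular_simplex 0 Q) c" for c
  proof
    fix \<sigma>
    show "c \<sigma> = (\<lambda>\<sigma>\<in>singular_simplex_set 0 Q. 0) \<sigma>"
    proof (cases "singular_simplex 0 Q \<sigma>")
      case True
      then have "c \<sigma> \<in> {0..<int p}" "int p dvd c \<sigma>" using that PiE_mem[OF that(1), of \<sigma>] by (auto simp: nul_def)
      then have "c \<sigma> = 0" by (metis atLeastLessThan_iff dvd_eq_mod_eq_0 mod_pos_pos_trivial)
      then show ?thesis using True by simp
    next
      case False
      then show ?thesis using PiE_arb[OF that(1), of \<sigma>] by simp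
    qed
  qed
  note uniq = this
  have z: "(\<lambda>\<sigma>\<in>singular_simplex_set 0 Q. 0) \<in> singular_simplex_set 0 Q \<rightarrow>\<^sub>E {0..<int p}"
    "nul p (singular_simplex 0 Q) (\<lambda>\<sigma>\<in>singular_simplex_set 0 Q. 0)"
    using assms by (simp_all add: nul_def)
  have "coboundary_set 0 Q (integer_mod_group p) = {\<lambda>\<sigma>\<in>singular_simplex_set 0 Q. 0}"
    by (simp add: coboundary_set_def cochain_group_def)
  also have "\<dots> = {c \<in> singular_simplex_set 0 Q \<rightarrow>\<^sub>E {0..<int p}. nul p (singular_simplex 0 Q) c}"
  proof (intro equalityI subsetI)
    fix c assume "c \<in> {c \<in> singular_simplex_set 0 Q \<rightarrow>\<^sub>E {0..<int p}. nul p (singular_simplex 0 Q) c}"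
    then show "c \<in> {\<lambda>\<sigma>\<in>singular_simplex_set 0 Q. 0}" using uniq[of c] by simp
  qed (use z in simp)
  finally show ?thesis unfolding 0 cob_def by simp
next
  case (Suc m)
  have cb: "coboundary m Q (integer_mod_group p) c = (\<lambda>\<sigma>\<in>singular_simplex_set k Q. cobd m c \<sigma> mod int p)" for c
  proof
    fix \<sigma> show "coboundary m Q (integer_mod_group p) c \<sigma> = (\<lambda>\<sigma>\<in>singular_simplex_set k Q. cobd m c \<sigma> mod int p) \<sigma>"
      using coboundary_integer_mod_group[OF assms, of m Q \<sigma> c] Suc
      by (cases "singular_simplex k Q \<sigma>") (auto simp: coboundary_def)
  qed
  show ?thesis
  proof (intro equalityI subsetI)
    fix c assume "c \<in> coboundary_set k Q (integer_mod_group p)"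
    then obtain e where "c = (\<lambda>\<sigma>\<in>singular_simplex_set k Q. cobd m e \<sigma> mod int p)"
      using Suc cb by (auto simp: coboundary_set_def)
    then show "c \<in> {c \<in> singular_simplex_set k Q \<rightarrow>\<^sub>E {0..<int p}. cob p Q k c}"
      using assms Suc by (auto simp: cob_def nul_def mod_eq_dvd_iff[symmetric] intro!: exI[where x = e])
  next
    fix c assume "c \<in> {c \<in> singular_simplex_set k Q \<rightarrow>\<^sub>E {0..<int p}. cob p Q k c}"
    then obtain e where c: "c \<in> singular_simplex_set k Q \<rightarrow>\<^sub>E {0..<int p}" and
      e: "nul p (singular_simplex k Q) (c - cobd m e)" using Suc by (auto simp: cob_def)
    define e' where "e' = (\<lambda>\<sigma>\<in>singular_simplex_set m Q. e \<sigma> mod int p)"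
    have e': "e' \<in> carrier (cochain_group m Q (integer_mod_group p))"
      using assms by (auto simp: carrier_cochain_group e'_def)
    have "nul p (singular_simplex m Q) (e - e')"
      by (auto simp: nul_def e'_def minus_mod_eq_mult_div)
    from nul_cobd[OF this] have n: "nul p (singular_simplex k Q) (cobd m e - cobd m e')"
      using Suc by (simp add: cobd_diff)
    have "c = (\<lambda>\<sigma>\<in>singular_simplex_set k Q. cobd m e' \<sigma> mod int p)"
    proof
      fix \<sigma> show "c \<sigma> = (\<lambda>\<sigma>\<in>singular_simplex_set k Q. cobd m e' \<sigma> mod int p) \<sigma>"
      proof (cases "singular_simplex k Q \<sigma>")
        case True
        then have "c \<sigma> mod int p = cobd m e' \<sigma> mod int p"
          using nul_trans[OF e n] by (auto simp: nul_def mod_eq_dvd_iff)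
        moreover have "c \<sigma> mod int p = c \<sigma>" using c True by (auto simp: PiE_def Pi_def)
        ultimately show ?thesis using True by simp
      next
        case False
        then show ?thesis using c by (auto simp: PiE_def extensional_def)
      qed
    qed
    then show "c \<in> coboundary_set k Q (integer_mod_group p)"
      using e' cb Suc by (auto simp: coboundary_set_def)
  qed
qed

lemma cob_add: "cob p Q k a \<Longrightarrow> cob p Q k b \<Longrightarrow> cob p Q k (a + b)"
proof (cases k)
  case (Suc j)
  assume "cob p Q k a" "cob p Q k b"
  then obtain e e' where "nul p (singular_simplex k Q) (a - cobd j e)" "nul p (singular_simplex k Q) (b - cobd j e')"
    using Suc by (auto simp: cob_def)
  from nul_add[OF this] show ?thesis
    using Suc by (auto simp: cob_def cobd_add algebra_simps intro!: exI[where x = "e + e'"])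
qed (simp add: cob_def nul_add)

lemma cob_nul: "nul p (singular_simplex k Q) a \<Longrightarrow> cob p Q k a"
  by (cases k) (auto simp: cob_def cobd_0 intro!: exI[where x = 0])

lemma cob_cong: "nul p (singular_simplex k Q) (a - b) \<Longrightarrow> cob p Q k b \<Longrightarrow> cob p Q k a"
  using cob_add[of p Q k "a - b" b, OF cob_nul] by simp

lemma cob_minus: "cob p Q k a \<Longrightarrow> cob p Q k (- a)"
proof (cases k)
  case (Suc j)
  assume "cob p Q k a"
  then obtain e where "nul p (singular_simplex k Q) (a - cobd j e)" using Suc by (auto simp: cob_def)
  from nul_minus[OF this] have "nul p (singular_simplex k Q) (- a - cobd j (0 - e))"
    by (simp only: cobd_diff cobd_0) simp
  then show ?thesis using Suc by (auto simp: cob_def)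
qed (simp add: cob_def nul_minus)

lemma cob_pb:
  assumes "cob p Q k c" "continuous_map P Q F"
  shows "cob p P k (pb k F c)"
proof (cases k)
  case 0
  then show ?thesis using assms nul_pb[of p 0 Q c P F] by (simp add: cob_def)
next
  case (Suc j)
  then obtain e where "nul p (singular_simplex k Q) (c - cobd j e)" using assms by (auto simp: cob_def)
  from nul_pb[OF this assms(2)] show ?thesis
    using Suc by (auto simp: cob_def pb_diff cobd_pb intro!: exI[where x = "pb j F e"])
qed

text \<open>Cocycles form a subgroup, so generating a subgroup from them adds nothing and the
  classes are their cosets.\<close>

lemma carrier_cohomology_group:
  assumes p: "p > 0"
  shows "carrier (cohomology_group k Q (integer_mod_group p)) =
    (\<lambda>c. (\<lambda>b. \<lambda>\<sigma>\<in>singular_simplex_set k Q. (b \<sigma> + c \<sigma>) mod int p) ` coboundary_set k Q (integer_mod_group p)) `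
      cocycle_set k Q (integer_mod_group p)"
proof -
  let ?A = "integer_mod_group p" and ?S = "singular_simplex_set k Q"
  let ?C = "cochain_group k Q ?A"
  have gr: "group ?C" unfolding cochain_group_def by (rule product_group) simp
  have inv: "inv\<^bsub>?C\<^esub> c = (\<lambda>\<sigma>\<in>?S. (- c \<sigma>) mod int p)" if "c \<in> carrier ?C" for c
    using that p unfolding cochain_group_def
    by (subst inv_product_group)
       (auto simp: carrier_integer_mod_group PiE_def Pi_def intro!: restrict_ext inv_integer_mod_group)
  have "subgroup (cocycle_set k Q ?A) ?C"
  proof (rule group.subgroupI[OF gr])
    show "cocycle_set k Q ?A \<subseteq> carrier ?C"
      by (auto simp: cocycle_set_def kernel_def)
    have "(\<lambda>\<sigma>\<in>?S. 0) \<in> cocycle_set k Q ?A"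
      using p by (auto simp: cocycle_set_eq nul_def cobd_def singular_simplex_face simp del: sum.atMost_Suc)
    then show "cocycle_set k Q ?A \<noteq> {}" by blast
    fix a assume a: "a \<in> cocycle_set k Q ?A"
    let ?a = "\<lambda>\<sigma>\<in>?S. (- a \<sigma>) mod int p"
    have "int p dvd (- a \<sigma>) mod int p - (- a \<sigma>)" for \<sigma>
      by (simp only: mod_eq_dvd_iff[symmetric]) simp
    then have "nul p (singular_simplex k Q) (?a - (0 - a))"
      by (simp add: nul_def)
    from nul_cobd[OF this] have "nul p (singular_simplex (Suc k) Q) (cobd k ?a)"
      using a p nul_sub[of p _ "cobd k ?a" "- cobd k a"] nul_minus[of p _ "cobd k a"]
      by (simp add: cobd_diff cobd_add cobd_0 cocycle_set_eq)
    then show "inv\<^bsub>?C\<^esub> a \<in> cocycle_set k Q ?A"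
      using a p inv[of a] by (auto simp: cocycle_set_eq carrier_cochain_group)
    fix b assume b: "b \<in> cocycle_set k Q ?A"
    let ?b = "\<lambda>\<sigma>\<in>?S. (a \<sigma> + b \<sigma>) mod int p"
    have "nul p (singular_simplex k Q) (?b - (a + b))"
      by (auto simp: nul_def mod_eq_dvd_iff[symmetric])
    from nul_cobd[OF this] have "nul p (singular_simplex (Suc k) Q) (cobd k ?b)"
      using a b p nul_sub[of p _ "cobd k ?b" "cobd k a + cobd k b"] nul_add[of p _ "cobd k a" "cobd k b"]
      by (simp add: cobd_diff cobd_add cocycle_set_eq)
    then show "a \<otimes>\<^bsub>?C\<^esub> b \<in> cocycle_set k Q ?A"
      using p by (auto simp: mult_cochain_group cocycle_set_eq)
  qed
  then have "carrier (subgroup_generated ?C (cocycle_set k Q ?A)) = cocycle_set k Q ?A"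
    by (rule subgroup.carrier_subgroup_generated_subgroup)
  then show ?thesis
    by (simp add: cohomology_group_def carrier_FactGroup r_coset_def mult_cochain_group UNION_singleton_eq_range)
qed

text \<open>The image of the coset of \<open>c\<close> is the whole coset of the pullback of
  \<open>c\<close>, which is trivial iff that pullback is a coboundary. An integer cocycle
  represents a class after reduction modulo \<open>p\<close>, which changes it only by a
  \<open>nul\<close> cochain.\<close>

lemma cohomology_induced_nontrivial_iff:
  assumes p: "p > 0" and F: "continuous_map P Q F"
  shows "(\<exists>C\<in>carrier (cohomology_group k Q (integer_mod_group p)).
       cohomology_induced k P (integer_mod_group p) F C \<noteq> \<one>\<^bsub>cohomology_group k P (integer_mod_group p)\<^esub>)
     \<longleftrightarrow> (\<exists>c. nul p (singular_simplex (Suc k) Q) (cobd k c) \<and> \<not> cob p P k (pb k F c))"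
proof -
  let ?A = "integer_mod_group p" and ?S = "singular_simplex_set k Q" and ?R = "singular_simplex_set k P"
  let ?BQ = "coboundary_set k Q ?A" and ?BP = "coboundary_set k P ?A"
  define coset where "coset c = (\<lambda>b. \<lambda>\<sigma>\<in>?S. (b \<sigma> + c \<sigma>) mod int p) ` ?BQ" for c
  have Fs: "singular_simplex k P \<sigma> \<Longrightarrow> singular_simplex k Q (simplex_map k F \<sigma>)" for \<sigma>
    using F singular_simplex_simplex_map by blast
  have key: "cohomology_induced k P ?A F (coset c) = ?BP \<longleftrightarrow> cob p P k (pb k F c)"
    if c: "c \<in> ?S \<rightarrow>\<^sub>E {0..<int p}" for c
  proof -
    have ind: "cohomology_induced k P ?A F (coset c) =
      {\<lambda>\<sigma>\<in>?R. (b \<sigma> + (b' (simplex_map k F \<sigma>) + c (simplex_map k F \<sigma>))) mod int p | b b'. b \<in> ?BP \<and> b' \<in> ?BQ}"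
      (is "_ = ?I")
    proof -
      have e: "(\<lambda>\<sigma>\<in>?R. (b \<sigma> + cochain_pullback k P F (\<lambda>\<sigma>\<in>?S. (b' \<sigma> + c \<sigma>) mod int p) \<sigma>) mod int p) =
        (\<lambda>\<sigma>\<in>?R. (b \<sigma> + (b' (simplex_map k F \<sigma>) + c (simplex_map k F \<sigma>))) mod int p)" for b b'
        by (rule restrict_ext) (simp add: cochain_pullback_def Fs mod_add_right_eq)
      show ?thesis
        unfolding cohomology_induced_def set_mult_def coset_def mult_cochain_group using e by auto
    qed
    have z: "(\<lambda>\<sigma>\<in>singular_simplex_set k W. 0) \<in> coboundary_set k W ?A" for W :: "'x topology"
      using p by (auto simp: coboundary_set_eq intro!: cob_nul simp: nul_def)
    show ?thesis
    proof
      assume "cohomology_induced k P ?A F (coset c) = ?BP"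
      moreover have "(\<lambda>\<sigma>\<in>?R. (0 + (0 + c (simplex_map k F \<sigma>))) mod int p) \<in> ?I"
        by (intro CollectI exI[where x = "\<lambda>\<sigma>\<in>?R. 0"] exI[where x = "\<lambda>\<sigma>\<in>?S. 0"] conjI z restrict_ext)
           (simp add: Fs)
      ultimately have "cob p P k (\<lambda>\<sigma>\<in>?R. (0 + (0 + c (simplex_map k F \<sigma>))) mod int p)"
        using ind p by (simp add: coboundary_set_eq)
      then show "cob p P k (pb k F c)"
        by (rule cob_cong[rotated]) (auto simp: nul_def pb_def minus_mod_eq_mult_div)
    next
      assume cc: "cob p P k (pb k F c)"
      show "cohomology_induced k P ?A F (coset c) = ?BP"
        unfolding ind
      proof (intro equalityI subsetI)
        fix x assume "x \<in> ?I"
        then obtain b b' where x: "x = (\<lambda>\<sigma>\<in>?R. (b \<sigma> + (b' (simplex_map k F \<sigma>) + c (simplex_map k F \<sigma>))) mod int p)"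
          and b: "b \<in> ?BP" "b' \<in> ?BQ" by blast
        have "cob p P k (b + (pb k F b' + pb k F c))"
          using b cc cob_pb[OF _ F] p by (intro cob_add) (auto simp: coboundary_set_eq)
        then have "cob p P k x"
          by (rule cob_cong[rotated]) (auto simp: nul_def x pb_def mod_eq_dvd_iff[symmetric])
        then show "x \<in> ?BP" using p by (auto simp: coboundary_set_eq x)
      next
        fix b assume b: "b \<in> ?BP"
        define b0 where "b0 = (\<lambda>\<sigma>\<in>?R. (b \<sigma> - c (simplex_map k F \<sigma>)) mod int p)"
        have "cob p P k (b + - pb k F c)"
          using b cc p by (intro cob_add cob_minus) (auto simp: coboundary_set_eq)
        then have "cob p P k b0"
          by (rule cob_cong[rotated]) (auto simp: nul_def b0_def pb_def mod_eq_dvd_iff[symmetric])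
        then have "b0 \<in> ?BP" using p by (auto simp: coboundary_set_eq b0_def)
        moreover have "b = (\<lambda>\<sigma>\<in>?R. (b0 \<sigma> + ((\<lambda>\<sigma>\<in>?S. 0) (simplex_map k F \<sigma>) + c (simplex_map k F \<sigma>))) mod int p)"
        proof
          fix \<sigma>
          have "b \<in> ?R \<rightarrow>\<^sub>E {0..<int p}" using b p by (simp add: coboundary_set_eq)
          then show "b \<sigma> = (\<lambda>\<sigma>\<in>?R. (b0 \<sigma> + ((\<lambda>\<sigma>\<in>?S. 0) (simplex_map k F \<sigma>) + c (simplex_map k F \<sigma>))) mod int p) \<sigma>"
            by (cases "singular_simplex k P \<sigma>") (auto simp: b0_def Fs mod_add_left_eq PiE_def Pi_def extensional_def)
        qed
        ultimately show "b \<in> ?I" using z[of Q] by blast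
      qed
    qed
  qed
  have one: "\<one>\<^bsub>cohomology_group k P ?A\<^esub> = ?BP" by (simp add: cohomology_group_def)
  have carr: "carrier (cohomology_group k Q ?A) = coset ` cocycle_set k Q ?A"
    by (simp add: carrier_cohomology_group[OF p] coset_def)
  show ?thesis
  proof
    assume "\<exists>C\<in>carrier (cohomology_group k Q ?A). cohomology_induced k P ?A F C \<noteq> \<one>\<^bsub>cohomology_group k P ?A\<^esub>"
    then obtain c where "c \<in> cocycle_set k Q ?A" "cohomology_induced k P ?A F (coset c) \<noteq> ?BP"
      unfolding one carr by blast
    then show "\<exists>c. nul p (singular_simplex (Suc k) Q) (cobd k c) \<and> \<not> cob p P k (pb k F c)"
      using key p by (auto simp: cocycle_set_eq)
  next
    assume "\<exists>c. nul p (singular_simplex (Suc k) Q) (cobd k c) \<and> \<not> cob p P k (pb k F c)"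
    then obtain c where c: "nul p (singular_simplex (Suc k) Q) (cobd k c)" "\<not> cob p P k (pb k F c)" by blast
    let ?c = "\<lambda>\<sigma>\<in>?S. c \<sigma> mod int p"
    have n: "nul p (singular_simplex k Q) (c - ?c)"
      by (auto simp: nul_def minus_mod_eq_mult_div)
    have "nul p (singular_simplex (Suc k) Q) (cobd k ?c)"
      using nul_sub[OF nul_sym[OF nul_cobd[OF n, unfolded cobd_diff]] c(1)] .
    then have cc: "?c \<in> cocycle_set k Q ?A" using p by (auto simp: cocycle_set_eq)
    have "\<not> cob p P k (pb k F ?c)"
      using c(2) cob_cong[OF nul_pb[OF n F, unfolded pb_diff]] by blast
    then have "cohomology_induced k P ?A F (coset ?c) \<noteq> ?BP"
      using key[of ?c] cc p by (simp add: cocycle_set_eq)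
    then show "\<exists>C\<in>carrier (cohomology_group k Q ?A). cohomology_induced k P ?A F C \<noteq> \<one>\<^bsub>cohomology_group k P ?A\<^esub>"
      unfolding one carr using cc by blast
  qed
qed

section \<open>The index in terms of zigzags\<close>

lemma free_action_compose:
  assumes "free_action (integer_mod_group p) X \<phi>" "i \<in> carrier (integer_mod_group p)" "j \<in> carrier (integer_mod_group p)"
    "x \<in> topspace X"
  shows "\<phi> ((i + j) mod int p) x = \<phi> i (\<phi> j x)"
proof -
  interpret group_action "integer_mod_group p" "topspace X" \<phi>
    using assms(1) by (simp add: free_action_def)
  show ?thesis using composition_rule[OF assms(4,2,3)] by simp
qed

lemma free_action_0:
  assumes "free_action (integer_mod_group p) X \<phi>" "x \<in> topspace X"
  shows "\<phi> 0 x = x"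
proof -
  interpret group_action "integer_mod_group p" "topspace X" \<phi>
    using assms(1) by (simp add: free_action_def)
  show ?thesis using id_eq_one assms(2) by (metis one_integer_mod_group restrict_apply)
qed

lemma free_action_pow:
  assumes "prime p" and fa: "free_action (integer_mod_group p) X \<phi>" and x: "x \<in> topspace X"
  shows "j < p \<Longrightarrow> \<phi> (int j) x = (\<phi> 1 ^^ j) x"
proof (induction j)
  case 0
  show ?case using free_action_0[OF fa x] by simp
next
  case (Suc j)
  have p: "p > 1" using assms(1) prime_gt_1_nat by blast
  have "\<phi> ((1 + int j) mod int p) x = \<phi> 1 (\<phi> (int j) x)"
    using p Suc.prems by (intro free_action_compose[OF fa _ _ x]) (auto simp: carrier_integer_mod_group)
  then show ?case using Suc p by simp
qed

lemma free_action_free_cyclic: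
  assumes p: "prime p" and fa: "free_action (integer_mod_group p) X \<phi>"
  shows "free_cyclic p X (\<phi> 1)"
proof
  have p1: "p > 1" using p prime_gt_1_nat by blast
  then have one: "1 \<in> carrier (integer_mod_group p)" by (simp add: carrier_integer_mod_group)
  show "prime p" by fact
  show "continuous_map X X (\<phi> 1)" using fa one by (simp add: free_action_def)
  fix z assume z: "z \<in> topspace X"
  have "\<phi> ((1 + int (p - 1)) mod int p) z = \<phi> 1 (\<phi> (int (p - 1)) z)"
    using p1 by (intro free_action_compose[OF fa _ _ z]) (auto simp: carrier_integer_mod_group)
  moreover have "(1 + int (p - 1)) mod int p = 0" using p1 by (simp add: of_nat_diff)
  ultimately have "\<phi> 0 z = \<phi> 1 ((\<phi> 1 ^^ (p - 1)) z)"
    using free_action_pow[OF p fa z, of "p - 1"] p1 by simp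
  also have "\<dots> = (\<phi> 1 ^^ p) z"
    using p1 by (metis Suc_diff_1 funpow.simps(2) comp_apply less_trans zero_less_one)
  finally show "(\<phi> 1 ^^ p) z = z" using free_action_0[OF fa z] by simp
  fix j assume j: "0 < j" "j < p"
  then have "\<phi> (int j) z \<noteq> z"
    using fa z p1 by (auto simp: free_action_def carrier_integer_mod_group)
  then show "(\<phi> 1 ^^ j) z \<noteq> z" using free_action_pow[OF p fa z] j by simp
qed

lemma orbit_eq:
  assumes p: "prime p" and fa: "free_action (integer_mod_group p) X \<phi>" and x: "x \<in> topspace X"
  shows "orbit (integer_mod_group p) \<phi> x = {(\<phi> 1 ^^ j) x | j. j < p}"
proof -
  have p0: "p > 0" using p prime_gt_0_nat by blast
  have "orbit (integer_mod_group p) \<phi> x = {\<phi> i x | i. i \<in> {0..<int p}}"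
    using p0 by (simp add: orbit_def carrier_integer_mod_group)
  also have "\<dots> = {\<phi> (int j) x | j. j < p}"
    by (auto intro: exI[where x = "nat _"])
  also have "\<dots> = {(\<phi> 1 ^^ j) x | j. j < p}"
    using free_action_pow[OF p fa x] by (intro Collect_cong) metis
  finally show ?thesis .
qed

section \<open>Even covering of EG and of the spaces over it\<close>

lemma EG_act_pow:
  assumes "prime p" "w \<in> topspace EG_space" "j < p"
  shows "(EG_act p 1 ^^ j) w = (\<lambda>n. cis (2 * pi * real j / real p) * w n)"
proof -
  have "free_action (integer_mod_group p) EG_space (EG_act p)"
    using free_action_EG assms(1) prime_gt_0_nat by blast
  from free_action_pow[OF assms(1) this assms(2,3)] show ?thesis
    using assms(2) by (simp add: EG_act_def)
qed

text \<open>Some coordinate \<open>z n\<close> is non-zero. Group elements other than the identity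
  multiply it by a root of unity different from 1, which moves a disc around \<open>z n\<close> off
  itself if the disc is small compared with \<open>z n\<close>.\<close>

lemma EG_evenly:
  assumes p: "prime p" and z: "z \<in> topspace EG_space"
  shows "\<exists>U. openin EG_space U \<and> z \<in> U \<and>
     (\<forall>j u. 0 < j \<longrightarrow> j < p \<longrightarrow> u \<in> U \<longrightarrow> (EG_act p 1 ^^ j) u \<notin> U)"
proof -
  have fa: "free_action (integer_mod_group p) EG_space (EG_act p)"
    using free_action_EG p prime_gt_0_nat by blast
  interpret E: free_cyclic p EG_space "EG_act p 1"
    by (rule free_action_free_cyclic[OF p fa])
  let ?\<omega> = "\<lambda>j. cis (2 * pi * real j / real p)"
  have \<omega>: "?\<omega> j \<noteq> 1" if "0 < j" "j < p" for j
  proof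
    assume "?\<omega> j = 1"
    then have "(EG_act p 1 ^^ j) z = z" using EG_act_pow[OF p z that(2)] by simp
    then show False using E.free[OF z that] by simp
  qed
  obtain n where n: "z n \<noteq> 0" using z by (auto simp: EG_space_def)
  define D where "D = (\<lambda>j. cmod (?\<omega> j - 1)) ` {0<..<p}"
  have D: "finite D" "\<And>d. d \<in> D \<Longrightarrow> 0 < d" using \<omega> by (auto simp: D_def)
  define \<rho> where "\<rho> = Min (insert 1 D)"
  have \<rho>: "\<rho> > 0" using D by (auto simp: \<rho>_def)
  have \<rho>j: "\<rho> \<le> cmod (?\<omega> j - 1)" if "0 < j" "j < p" for j
    unfolding \<rho>_def using that D(1) by (intro Min_le) (auto simp: D_def)
  \<comment> \<open>The solution of \<open>2 r = \<rho> (|z n| - r)\<close>. A point of the disc is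
    moved by at least the right-hand side, whereas two points of the disc have distance less than
    \<open>2 r\<close>.\<close>
  define r where "r = \<rho> * cmod (z n) / (2 + \<rho>)"
  have r: "r > 0" using \<rho> n by (simp add: r_def)
  have r2: "2 * r = \<rho> * (cmod (z n) - r)"
    using \<rho> by (simp add: r_def field_simps)
  define U where "U = {w \<in> topspace EG_space. cmod (w n - z n) < r}"
  have "continuous_on (topspace EG_space) (\<lambda>w :: nat \<Rightarrow> complex. w n)"
    by (rule continuous_on_product_then_coordinatewise[OF continuous_on_id])
  then have "continuous_map EG_space euclidean (\<lambda>w. w n)"
    by (simp add: EG_space_def)
  from openin_continuous_map_preimage[OF this, of "ball (z n) r"]
  have "openin EG_space U"
    by (simp add: U_def dist_norm norm_minus_commute)
  moreover have "z \<in> U" using z r by (simp add: U_def)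
  moreover have "(EG_act p 1 ^^ j) u \<notin> U" if j: "0 < j" "j < p" and u: "u \<in> U" for j u
  proof
    assume "(EG_act p 1 ^^ j) u \<in> U"
    then have a: "cmod (?\<omega> j * u n - z n) < r" and b: "cmod (u n - z n) < r"
      using u EG_act_pow[OF p _ j(2), of u] by (auto simp: U_def)
    have "cmod (?\<omega> j * u n - u n) \<le> cmod (?\<omega> j * u n - z n) + cmod (u n - z n)"
      using norm_triangle_ineq4[of "?\<omega> j * u n - z n" "u n - z n"] by simp
    then have c: "cmod (?\<omega> j * u n - u n) < 2 * r" using a b by linarith
    have "cmod (z n) \<le> cmod (u n) + cmod (u n - z n)"
      using norm_triangle_ineq4[of "u n" "u n - z n"] by simp
    then have "cmod (z n) - r \<le> cmod (u n)" using b by linarith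
    then have "\<rho> * (cmod (z n) - r) \<le> \<rho> * cmod (u n)" using \<rho> by (intro mult_left_mono) auto
    also have "\<dots> \<le> cmod (?\<omega> j - 1) * cmod (u n)" using \<rho>j[OF j] by (intro mult_right_mono) auto
    also have "\<dots> = cmod (?\<omega> j * u n - u n)"
      by (simp add: norm_mult[symmetric] left_diff_distrib)
    finally show False using c r2 by linarith
  qed
  ultimately show ?thesis by blast
qed

lemma equivariant_map_pow:
  assumes p: "prime p" and fa: "free_action (integer_mod_group p) X \<phi>" and fb: "free_action (integer_mod_group p) Y \<psi>"
    and f: "equivariant_map (integer_mod_group p) X \<phi> Y \<psi> f"
  shows "equivariant_pair p X (\<phi> 1) Y (\<psi> 1) f"
proof -
  interpret D: free_cyclic p X "\<phi> 1" by (rule free_action_free_cyclic[OF p fa])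
  interpret C: free_cyclic p Y "\<psi> 1" by (rule free_action_free_cyclic[OF p fb])
  have "1 \<in> carrier (integer_mod_group p)" using p prime_gt_1_nat[of p] by (auto simp: carrier_integer_mod_group)
  then show ?thesis using f by unfold_locales (auto simp: equivariant_map_def)
qed

text \<open>Even covering is inherited from \<open>EG\<close>: the preimage under \<open>f\<close>
  of an evenly covered set is evenly covered.\<close>

lemma orbit_space_cover:
  assumes p: "prime p" and fa: "free_action (integer_mod_group p) X \<phi>"
    and f: "equivariant_map (integer_mod_group p) X \<phi> EG_space (EG_act p) f"
  shows "cyclic_cover p X (\<phi> 1) (orbit_space (integer_mod_group p) X \<phi>) (orbit (integer_mod_group p) \<phi>)"
proof -
  have fE: "free_action (integer_mod_group p) EG_space (EG_act p)"
    using free_action_EG p prime_gt_0_nat by blast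
  interpret equivariant_pair p X "\<phi> 1" EG_space "EG_act p 1" f
    by (rule equivariant_map_pow[OF p fa fE f])
  show ?thesis
  proof
    show "quotient_map X (orbit_space (integer_mod_group p) X \<phi>) (orbit (integer_mod_group p) \<phi>)"
      unfolding orbit_space_def by (rule quotient_map_quotient_topology)
    fix z z' assume z: "z \<in> topspace X" and z': "z' \<in> topspace X"
    show "(orbit (integer_mod_group p) \<phi> z = orbit (integer_mod_group p) \<phi> z') \<longleftrightarrow> (\<exists>j<p. z' = (\<phi> 1 ^^ j) z)"
    proof
      assume e: "orbit (integer_mod_group p) \<phi> z = orbit (integer_mod_group p) \<phi> z'"
      have "z' \<in> orbit (integer_mod_group p) \<phi> z'"
        unfolding orbit_eq[OF p fa z'] using D.p_pos by (auto intro!: exI[where x = 0])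
      then show "\<exists>j<p. z' = (\<phi> 1 ^^ j) z" unfolding e[symmetric] orbit_eq[OF p fa z] by auto
    next
      assume "\<exists>j<p. z' = (\<phi> 1 ^^ j) z"
      then obtain j where j: "j < p" "z' = (\<phi> 1 ^^ j) z" by blast
      have "(\<phi> 1 ^^ i) z' = (\<phi> 1 ^^ ((i + j) mod p)) z" for i
        using D.pow_mod[OF z, of "i + j"] j(2) by (simp add: funpow_add)
      then have 1: "\<exists>l<p. (\<phi> 1 ^^ i) z' = (\<phi> 1 ^^ l) z" for i
        using D.p_pos mod_less_divisor by blast
      have "\<exists>l<p. (\<phi> 1 ^^ i) z = (\<phi> 1 ^^ l) z'" if "i < p" for i
      proof -
        let ?l = "(i + (p - j)) mod p"
        have "(\<phi> 1 ^^ ?l) z' = (\<phi> 1 ^^ (i + (p - j))) z'"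
          using D.pow_mod[OF z', of "i + (p - j)"] by simp
        also have "\<dots> = (\<phi> 1 ^^ (i + (p - j) + j)) z" by (simp only: funpow_add j(2) comp_apply)
        also have "\<dots> = (\<phi> 1 ^^ (i + p)) z" using j by simp
        also have "\<dots> = (\<phi> 1 ^^ i) z" using D.period[OF z] by (simp add: funpow_add)
        finally show ?thesis using D.p_pos mod_less_divisor by metis
      qed
      with 1 show "orbit (integer_mod_group p) \<phi> z = orbit (integer_mod_group p) \<phi> z'"
        unfolding orbit_eq[OF p fa z] orbit_eq[OF p fa z'] by blast
    qed
    from z have "f z \<in> topspace EG_space" using f_cont by (auto simp: continuous_map_def)
    from EG_evenly[OF p this] obtain U where U: "openin EG_space U" "f z \<in> U"
      "\<And>j u. 0 < j \<Longrightarrow> j < p \<Longrightarrow> u \<in> U \<Longrightarrow> (EG_act p 1 ^^ j) u \<notin> U" by blast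
    let ?V = "{x \<in> topspace X. f x \<in> U}"
    have "openin X ?V" by (rule openin_continuous_map_preimage[OF f_cont U(1)])
    moreover have "(\<phi> 1 ^^ j) u \<notin> ?V" if "0 < j" "j < p" "u \<in> ?V" for j u
      using U(3)[OF that(1,2)] that(3) f_pow[of u j] by auto
    ultimately show "\<exists>U. openin X U \<and> z \<in> U \<and> (\<forall>j u. 0 < j \<longrightarrow> j < p \<longrightarrow> u \<in> U \<longrightarrow> (\<phi> 1 ^^ j) u \<notin> U)"
      using z U(2) by (intro exI[where x = ?V]) blast
  qed
qed

lemma orbit_space_map:
  assumes p: "prime p" and fa: "free_action (integer_mod_group p) X \<phi>" and fb: "free_action (integer_mod_group p) Y \<psi>"
    and f: "equivariant_map (integer_mod_group p) X \<phi> Y \<psi> f"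
  shows "continuous_map (orbit_space (integer_mod_group p) X \<phi>) (orbit_space (integer_mod_group p) Y \<psi>) (image f)"
    and "\<And>x. x \<in> topspace X \<Longrightarrow> f ` orbit (integer_mod_group p) \<phi> x = orbit (integer_mod_group p) \<psi> (f x)"
proof -
  let ?G = "integer_mod_group p"
  show *: "f ` orbit ?G \<phi> x = orbit ?G \<psi> (f x)" if x: "x \<in> topspace X" for x
    using f x by (auto simp: orbit_def equivariant_map_def image_iff) metis+
  have q: "quotient_map X (orbit_space ?G X \<phi>) (orbit ?G \<phi>)" "quotient_map Y (orbit_space ?G Y \<psi>) (orbit ?G \<psi>)"
    unfolding orbit_space_def by (rule quotient_map_quotient_topology)+
  have "continuous_map X (orbit_space ?G Y \<psi>) (orbit ?G \<psi> \<circ> f)"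
    using f quotient_imp_continuous_map[OF q(2)] by (auto simp: equivariant_map_def intro: continuous_map_compose)
  then have "continuous_map X (orbit_space ?G Y \<psi>) (image f \<circ> orbit ?G \<phi>)"
    by (rule continuous_map_eq) (simp add: *)
  then show "continuous_map (orbit_space ?G X \<phi>) (orbit_space ?G Y \<psi>) (image f)"
    by (rule continuous_compose_quotient_map[OF q(1)])
qed

text \<open>A class of \<open>BG\<close> becomes upstairs an invariant cocycle on the contractible
  \<open>EG\<close>, hence a multiple of \<open>N w_k\<close> up to null terms; by naturality its
  pullback to \<open>X\<close> is non-zero only if \<open>N v_k\<close> is. Conversely
  \<open>N w_k\<close> descends to a cocycle on \<open>BG\<close>. Uniqueness of zigzags makes the
  equivariant map immaterial.\<close>

lemma hind_degrees_iff:
  assumes p: "prime p" and fa: "free_action (integer_mod_group p) X \<phi>"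
    and f: "equivariant_map (integer_mod_group p) X \<phi> EG_space (EG_act p) f"
    and v: "zigzag p X (\<phi> 1) v"
  shows "k \<in> hind_degrees p X \<phi> \<longleftrightarrow> \<not> cnull p X (\<phi> 1) k (nm p (\<phi> 1) k (v k))"
proof -
  let ?G = "integer_mod_group p"
  let ?XG = "orbit_space ?G X \<phi>" and ?BG = "orbit_space ?G EG_space (EG_act p)"
  have p0: "p > 0" using p prime_gt_0_nat by blast
  have fE: "free_action ?G EG_space (EG_act p)"
    using free_action_EG p0 by blast
  have idE: "equivariant_map ?G EG_space (EG_act p) EG_space (EG_act p) id"
    by (simp add: equivariant_map_def)
  interpret X: cyclic_cover p X "\<phi> 1" ?XG "orbit ?G \<phi>"
    by (rule orbit_space_cover[OF p fa f])
  interpret E: cyclic_cover p EG_space "EG_act p 1" ?BG "orbit ?G (EG_act p)"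
    by (rule orbit_space_cover[OF p fE idE])
  obtain w where w: "E.ZZ w" using E.zigzag_exists by blast
  have square: "X.NL k (pb k (orbit ?G \<phi>) (pb k (image g) c) - pb k g (pb k (orbit ?G (EG_act p)) c))"
    if g: "equivariant_map ?G X \<phi> EG_space (EG_act p) g" for g c
  proof -
    have "simplex_map k (image g \<circ> orbit ?G \<phi>) \<sigma> = simplex_map k (orbit ?G (EG_act p) \<circ> g) \<sigma>"
      if "singular_simplex k X \<sigma>" for \<sigma>
      by (rule simplex_map_eq[OF that]) (simp add: orbit_space_map(2)[OF p fa fE g])
    then show ?thesis by (simp add: nul_def pb_def simplex_map_compose)
  qed
  have nontriv: "(\<exists>C\<in>carrier (cohomology_group k ?BG ?G).
      cohomology_induced k ?XG ?G (image g) C \<noteq> \<one>\<^bsub>cohomology_group k ?XG ?G\<^esub>) \<longleftrightarrow>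
      (\<exists>c. nul p (singular_simplex (Suc k) ?BG) (cobd k c) \<and> \<not> cob p ?XG k (pb k (image g) c))"
    if "equivariant_map ?G X \<phi> EG_space (EG_act p) g" for g
    by (rule cohomology_induced_nontrivial_iff[OF p0 orbit_space_map(1)[OF p fa fE that]])
  have nontriv': "\<not> cob p ?XG k (pb k (image g) c) \<longleftrightarrow> \<not> X.CN k (pb k g (pb k (orbit ?G (EG_act p)) c))"
    if g: "equivariant_map ?G X \<phi> EG_space (EG_act p) g" for g c
    unfolding X.cob_q using cnull_cong[OF square[OF g]] cnull_cong[OF nul_sym[OF square[OF g]]] by blast
  show ?thesis
  proof
    assume "k \<in> hind_degrees p X \<phi>"
    then obtain g c where g: "equivariant_map ?G X \<phi> EG_space (EG_act p) g"
      and c: "nul p (singular_simplex (Suc k) ?BG) (cobd k c)"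
      and nc: "\<not> X.CN k (pb k g (pb k (orbit ?G (EG_act p)) c))"
      unfolding hind_degrees_def Let_def using nontriv nontriv' by blast
    interpret eq: equivariant_pair p X "\<phi> 1" EG_space "EG_act p 1" g
      by (rule equivariant_map_pow[OF p fa fE g])
    let ?\<gamma> = "pb k (orbit ?G (EG_act p)) c"
    have "E.NL (Suc k) (cobd k ?\<gamma>)" using c E.nul_q by (simp add: cobd_pb)
    then obtain a where a: "E.CN k (?\<gamma> - smul a (nm p (EG_act p 1) k (w k)))"
      using E.contractible_class[OF contractible_EG_space w E.pb_q_inv] by blast
    have 1: "X.CN k (pb k g ?\<gamma> - smul a (pb k g (nm p (EG_act p 1) k (w k))))"
      using eq.pb_cnull[OF a] by (simp add: pb_diff pb_smul)
    have 2: "X.CN k (nm p (\<phi> 1) k (pb k g (w k)) - nm p (\<phi> 1) k (v k))"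
      by (rule X.zigzag_unique[OF eq.pb_zigzag[OF w] v])
    show "\<not> X.CN k (nm p (\<phi> 1) k (v k))"
    proof
      assume "X.CN k (nm p (\<phi> 1) k (v k))"
      from cnull_add[OF 2 this] have "X.CN k (nm p (\<phi> 1) k (pb k g (w k)))" by simp
      from cnull_cong[OF eq.pb_nrm this] have "X.CN k (pb k g (nm p (EG_act p 1) k (w k)))" .
      from cnull_add[OF 1 cnull_smul[OF this, of a]] nc show False by simp
    qed
  next
    assume nv: "\<not> X.CN k (nm p (\<phi> 1) k (v k))"
    interpret eq: equivariant_pair p X "\<phi> 1" EG_space "EG_act p 1" f
      by (rule equivariant_map_pow[OF p fa fE f])
    let ?\<gamma> = "nm p (EG_act p 1) k (w k)"
    obtain c where c: "E.NL k (pb k (orbit ?G (EG_act p)) c - ?\<gamma>)"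
      using E.descend[OF E.tw_nrm] by blast
    have "E.NL (Suc k) (cobd k ?\<gamma>)" by (rule E.zigzag_cocycle[OF w])
    from nul_sub[OF nul_cobd[OF c, unfolded cobd_diff] this]
    have "nul p (singular_simplex (Suc k) ?BG) (cobd k c)"
      using E.nul_q by (simp add: cobd_pb)
    moreover have "\<not> X.CN k (pb k f (pb k (orbit ?G (EG_act p)) c))"
    proof
      assume a: "X.CN k (pb k f (pb k (orbit ?G (EG_act p)) c))"
      have "X.NL k (pb k f ?\<gamma> - pb k f (pb k (orbit ?G (EG_act p)) c))"
        using eq.nul_pbf[OF nul_sym[OF c]] by (simp add: pb_diff)
      from cnull_cong[OF nul_trans[OF nul_sym[OF eq.pb_nrm] this] a]
      have "X.CN k (nm p (\<phi> 1) k (pb k f (w k)))" .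
      from cnull_add[OF X.zigzag_unique[OF v eq.pb_zigzag[OF w]] this] nv show False by simp
    qed
    ultimately show "k \<in> hind_degrees p X \<phi>"
      unfolding hind_degrees_def Let_def using f nontriv[OF f] nontriv'[OF f] by blast
  qed
qed

section \<open>Cup products\<close>

text \<open>Inclusion of the last face. The first face needs no such map, since a point of
  \<open>standard_simplex k\<close> is also a point of every larger standard simplex.\<close>

definition shift :: "nat \<Rightarrow> (nat \<Rightarrow> real) \<Rightarrow> nat \<Rightarrow> real" where
  "shift k x = (\<lambda>i. if i < k then 0 else x (i - k))"

definition front :: "nat \<Rightarrow> ((nat \<Rightarrow> real) \<Rightarrow> 'a) \<Rightarrow> (nat \<Rightarrow> real) \<Rightarrow> 'a" where
  "front k \<sigma> = restrict \<sigma> (standard_simplex k)"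

definition rear :: "nat \<Rightarrow> nat \<Rightarrow> ((nat \<Rightarrow> real) \<Rightarrow> 'a) \<Rightarrow> (nat \<Rightarrow> real) \<Rightarrow> 'a" where
  "rear k l \<sigma> = restrict (\<sigma> \<circ> shift k) (standard_simplex l)"

text \<open>The Alexander-Whitney product.\<close>

definition cup :: "nat \<Rightarrow> nat \<Rightarrow> 'a cochain \<Rightarrow> 'a cochain \<Rightarrow> 'a cochain" where
  "cup k l a b = (\<lambda>\<sigma>. a (front k \<sigma>) * b (rear k l \<sigma>))"

lemma shift_Suc: "shift (Suc k) x = simplical_face 0 (shift k x)"
  by (auto simp: shift_def simplical_face_def fun_eq_iff)

lemma shift_0: "shift 0 x = x"
  by (simp add: shift_def)

lemma shift_in_standard_simplex:
  "x \<in> standard_simplex l \<Longrightarrow> shift k x \<in> standard_simplex (k + l)"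
proof (induction k)
  case (Suc k)
  then show ?case
    using simplical_face_in_standard_simplex[of "Suc (k + l)" 0 "shift k x"] by (simp add: shift_Suc)
qed (simp add: shift_0)

lemma simplical_face_high: "x \<in> standard_simplex k \<Longrightarrow> k < i \<Longrightarrow> simplical_face i x = x"
  by (auto simp: simplical_face_def standard_simplex_def fun_eq_iff)

lemma simplical_face_shift_low: "i \<le> k \<Longrightarrow> simplical_face i (shift k x) = shift (Suc k) x"
  by (auto simp: simplical_face_def shift_def fun_eq_iff)

lemma simplical_face_shift_high:
  "k \<le> i \<Longrightarrow> simplical_face i (shift k x) = shift k (simplical_face (i - k) x)"
  by (auto simp: simplical_face_def shift_def fun_eq_iff diff_right_commute less_diff_conv2)

lemma face_mem: "i \<le> Suc k \<Longrightarrow> x \<in> standard_simplex k \<Longrightarrow> simplical_face i x \<in> standard_simplex (Suc k)"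
  using simplical_face_in_standard_simplex[of "Suc k" i x] by simp

lemma front_face_low:
  assumes "i \<le> Suc k"
  shows "front k (singular_face (Suc (k + l)) i \<sigma>) = singular_face (Suc k) i (front (Suc k) \<sigma>)"
  using assms standard_simplex_mono[of k "k + l"] face_mem[of i k]
  by (intro ext) (auto simp: front_def singular_face_def)

lemma front_face_high:
  assumes "k < i"
  shows "front k (singular_face (Suc (k + l)) i \<sigma>) = front k \<sigma>"
  using assms standard_simplex_mono[of k "k + l"] simplical_face_high[of _ k i]
  by (intro ext) (auto simp: front_def singular_face_def)

lemma face_front_last: "singular_face (Suc k) (Suc k) (front (Suc k) \<sigma>) = front k \<sigma>"
  using standard_simplex_mono[of k "Suc k"] face_mem[of "Suc k" k] simplical_face_high[of _ k "Suc k"]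
  by (intro ext) (auto simp: front_def singular_face_def)

lemma rear_face_low:
  assumes "i \<le> k"
  shows "rear k l (singular_face (Suc (k + l)) i \<sigma>) = rear (Suc k) l \<sigma>"
  using assms shift_in_standard_simplex[of _ l k] simplical_face_shift_low[OF assms]
  by (intro ext) (auto simp: rear_def singular_face_def)

lemma rear_face_high:
  assumes "k \<le> i" "i \<le> Suc (k + l)"
  shows "rear k l (singular_face (Suc (k + l)) i \<sigma>) = singular_face (Suc l) (i - k) (rear k (Suc l) \<sigma>)"
  using assms shift_in_standard_simplex[of _ l k] simplical_face_shift_high[OF assms(1)] face_mem[of "i - k" l]
  by (intro ext) (auto simp: rear_def singular_face_def)

lemma face_rear_0: "singular_face (Suc l) 0 (rear k (Suc l) \<sigma>) = rear (Suc k) l \<sigma>"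
  using rear_face_high[of k k l \<sigma>] rear_face_low[of k k l \<sigma>] by simp

lemma singular_simplex_front: "singular_simplex (k + l) Z \<sigma> \<Longrightarrow> singular_simplex k Z (front k \<sigma>)"
proof (induction l arbitrary: \<sigma>)
  case 0
  then have "front k \<sigma> = \<sigma>" by (auto simp: front_def singular_simplex_def extensional_restrict)
  then show ?case using 0 by simp
next
  case (Suc l)
  then have "singular_simplex (k + l) Z (singular_face (Suc (k + l)) (Suc (k + l)) \<sigma>)"
    by (intro singular_simplex_face) auto
  from Suc.IH[OF this] show ?case using front_face_high[of k "Suc (k + l)" l \<sigma>] by simp
qed

lemma singular_simplex_rear: "singular_simplex (k + l) Z \<sigma> \<Longrightarrow> singular_simplex l Z (rear k l \<sigma>)"
proof (induction k arbitrary: l)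
  case 0
  then have "rear 0 l \<sigma> = \<sigma>"
    by (auto simp: rear_def shift_0 o_def singular_simplex_def extensional_restrict)
  then show ?case using 0 by simp
next
  case (Suc k)
  then have "singular_simplex (Suc l) Z (rear k (Suc l) \<sigma>)" by simp
  from singular_simplex_face[OF this, of 0] show ?case by (simp add: face_rear_0)
qed

lemma front_simplex_map: "front k (simplex_map (k + l) f \<sigma>) = simplex_map k f (front k \<sigma>)"
  using standard_simplex_mono[of k "k + l"] by (auto simp: front_def simplex_map_def fun_eq_iff)

lemma rear_simplex_map: "rear k l (simplex_map (k + l) f \<sigma>) = simplex_map l f (rear k l \<sigma>)"
  using shift_in_standard_simplex[of _ l k] by (auto simp: rear_def simplex_map_def fun_eq_iff)

lemma pb_cup: "pb (k + l) f (cup k l a b) = cup k l (pb k f a) (pb l f b)"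
  by (simp add: pb_def cup_def front_simplex_map rear_simplex_map)

lemma cup_diff_left: "cup k l (a - a') b = cup k l a b - cup k l a' b"
  and cup_diff_right: "cup k l a (b - b') = cup k l a b - cup k l a b'"
  by (auto simp: cup_def fun_eq_iff algebra_simps)

lemma nul_cup_left: "nul p (singular_simplex k Z) a \<Longrightarrow> nul p (singular_simplex (k + l) Z) (cup k l a b)"
  by (auto simp: nul_def cup_def intro: singular_simplex_front)

lemma nul_cup_right: "nul p (singular_simplex l Z) b \<Longrightarrow> nul p (singular_simplex (k + l) Z) (cup k l a b)"
  by (auto simp: nul_def cup_def intro: singular_simplex_rear)

text \<open>The Leibniz rule without its second term, as \<open>b\<close> is a cocycle. The faces
  with index above \<open>k\<close> yield \<open>\<delta> b\<close> on the rear face except for its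
  face 0, and that missing term is the contribution of the last face of the front to
  \<open>\<delta> a\<close>.\<close>

lemma cobd_cup:
  assumes b: "nul p (singular_simplex (Suc l) Z) (cobd l b)"
  shows "nul p (singular_simplex (Suc (k + l)) Z) (cobd (k + l) (cup k l a b) - cup (Suc k) l (cobd k a) b)"
  unfolding nul_def
proof (intro allI impI)
  fix \<sigma> assume \<sigma>: "singular_simplex (Suc (k + l)) Z \<sigma>"
  define \<rho> where "\<rho> = rear k (Suc l) \<sigma>"
  define A where "A = a (front k \<sigma>)"
  define f where "f i = (-1) ^ i * cup k l a b (singular_face (Suc (k + l)) i \<sigma>)" for i
  define g where "g i = (-1) ^ i * a (singular_face (Suc k) i (front (Suc k) \<sigma>)) * b (rear (Suc k) l \<sigma>)" for i
  have "cobd (k + l) (cup k l a b) \<sigma> = sum f {..Suc (k + l)}"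
    by (simp add: cobd_def f_def)
  also have "\<dots> = sum f {..k} + sum f {Suc k..Suc (k + l)}"
    using sum_up_index_split[of f k "Suc l"] by (simp only: add_Suc_right)
  also have "sum f {..k} = sum g {..k}"
    by (rule sum.cong) (auto simp: f_def g_def cup_def front_face_low rear_face_low)
  also have "sum f {Suc k..Suc (k + l)} = (-1) ^ k * A * (\<Sum>j=1..Suc l. (-1) ^ j * b (singular_face (Suc l) j \<rho>))"
  proof -
    have "sum f {Suc k..Suc (k + l)} = (\<Sum>j=1..Suc l. f (j + k))"
      using sum.shift_bounds_cl_nat_ivl[of f 1 k "Suc l"] by (simp add: add.commute)
    also have "\<dots> = (\<Sum>j=1..Suc l. (-1) ^ k * A * ((-1) ^ j * b (singular_face (Suc l) j \<rho>)))"
      by (rule sum.cong)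
         (auto simp: f_def cup_def front_face_high rear_face_high A_def \<rho>_def power_add mult_ac)
    finally show ?thesis by (simp only: sum_distrib_left)
  qed
  also have "(\<Sum>j=1..Suc l. (-1) ^ j * b (singular_face (Suc l) j \<rho>)) = cobd l b \<rho> - b (rear (Suc k) l \<sigma>)"
  proof -
    have "cobd l b \<rho> = b (singular_face (Suc l) 0 \<rho>) + (\<Sum>j=1..Suc l. (-1) ^ j * b (singular_face (Suc l) j \<rho>))"
      unfolding cobd_def by (simp add: atMost_atLeast0 sum.atLeast_Suc_atMost del: sum.atMost_Suc sum.cl_ivl_Suc)
    then show ?thesis by (simp add: \<rho>_def face_rear_0)
  qed
  also have "cup (Suc k) l (cobd k a) b \<sigma> = sum g {..k} - (-1) ^ k * A * b (rear (Suc k) l \<sigma>)"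
  proof -
    have "cup (Suc k) l (cobd k a) b \<sigma> = sum g {..Suc k}"
      unfolding cup_def cobd_def g_def by (simp only: sum_distrib_right)
    then show ?thesis by (simp add: g_def face_front_last A_def)
  qed
  ultimately have e: "(cobd (k + l) (cup k l a b) - cup (Suc k) l (cobd k a) b) \<sigma> = (-1) ^ k * A * cobd l b \<rho>"
    by (simp add: algebra_simps)
  have "singular_simplex (Suc l) Z \<rho>" unfolding \<rho>_def using \<sigma> by (intro singular_simplex_rear) simp
  then show "int p dvd (cobd (k + l) (cup k l a b) - cup (Suc k) l (cobd k a) b) \<sigma>"
    unfolding e using b by (auto simp: nul_def)
qed

section \<open>Products with invariant cocycles\<close>

context free_cyclic
begin

lemma tw_cup:
  assumes "NL l (tw l b - b)"
  shows "NL (k + l) (tw (k + l) (cup k l a b) - cup k l (tw k a) b)"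
  using nul_cup_right[OF assms, of k "tw k a"] by (simp add: pb_cup cup_diff_right)

text \<open>The projection formula: an invariant factor can be pulled out of the norm.\<close>

lemma nrm_cup:
  assumes "NL l (tw l b - b)"
  shows "NL (k + l) (nrm (k + l) (cup k l a b) - cup k l (nrm k a) b)"
  unfolding nul_def
proof (intro allI impI)
  fix \<sigma> assume \<sigma>: "singular_simplex (k + l) Z \<sigma>"
  have "(nrm (k + l) (cup k l a b) - cup k l (nrm k a) b) \<sigma> =
     (\<Sum>j<p. a (simplex_map k (T ^^ j) (front k \<sigma>)) * (b (simplex_map l (T ^^ j) (rear k l \<sigma>)) - b (rear k l \<sigma>)))"
    by (simp add: nm_def cup_def front_simplex_map rear_simplex_map sum_distrib_right sum_subtractf right_diff_distrib)
  also have "int p dvd \<dots>"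
    by (intro dvd_sum dvd_mult inv_pow[OF assms] singular_simplex_rear \<sigma>)
  finally show "int p dvd (nrm (k + l) (cup k l a b) - cup k l (nrm k a) b) \<sigma>" .
qed

lemma per_cup:
  assumes "PER k g' g" and inv: "NL l (tw l b - b)" and cyc: "NL (Suc l) (cobd l b)"
  shows "PER (k + l) (cup k l g' b) (cup (Suc (Suc k)) l g b)"
proof -
  obtain s r where sr: "NL (Suc (Suc k)) (g - cobd (Suc k) s)"
     "NL (Suc k) (tw (Suc k) s - s - cobd k r)" "NL k (nrm k r - g')"
    using assms(1) unfolding per_def by blast
  have 1: "NL (Suc (Suc (k + l))) (cup (Suc (Suc k)) l g b - cobd (Suc (k + l)) (cup (Suc k) l s b))"
    using nul_diff[OF nul_cup_left[OF sr(1), of l b, unfolded add_Suc] cobd_cup[OF cyc, of "Suc k" s, unfolded add_Suc]]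
    by (simp add: cup_diff_left)
  have "NL (Suc (k + l)) (cup (Suc k) l (tw (Suc k) s) b - cup (Suc k) l s b - cup (Suc k) l (cobd k r) b)"
    using nul_cup_left[OF sr(2), of l b, unfolded add_Suc] by (simp add: cup_diff_left)
  from nul_diff[OF nul_add[OF this tw_cup[OF inv, of "Suc k" s, unfolded add_Suc]] cobd_cup[OF cyc, of k r]]
  have 2: "NL (Suc (k + l)) (tw (Suc (k + l)) (cup (Suc k) l s b) - cup (Suc k) l s b - cobd (k + l) (cup k l r b))"
    by (simp add: algebra_simps)
  have 3: "NL (k + l) (nrm (k + l) (cup k l r b) - cup k l g' b)"
    using nul_add[OF nrm_cup[OF inv, of k r] nul_cup_left[OF sr(3), of l b]] by (simp add: cup_diff_left)
  from 1 2 3 show ?thesis unfolding per_def by blast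
qed

lemma cnull_cup:
  assumes "CN k a" and inv: "NL l (tw l b - b)" and cyc: "NL (Suc l) (cobd l b)"
  shows "CN (k + l) (cup k l a b)"
proof (cases k)
  case 0
  then show ?thesis using assms(1) nul_cup_left[of p 0 Z a l b] by (auto simp: cnull_def intro: cnull_nul[unfolded cnull_def])
next
  case (Suc j)
  then obtain e where e: "NL j (tw j e - e)" "NL (Suc j) (a - cobd j e)"
    using assms(1) by (auto simp: cnull_def)
  have "NL (j + l) (tw (j + l) (cup j l e b) - cup j l e b)"
    using nul_add[OF tw_cup[OF inv, of j e] nul_cup_left[OF e(1), of l b]] by (simp add: cup_diff_left)
  moreover have "NL (Suc (j + l)) (cup (Suc j) l a b - cobd (j + l) (cup j l e b))"
    using nul_diff[OF nul_cup_left[OF e(2), of l b, unfolded add_Suc] cobd_cup[OF cyc, of j e]] by (simp add: cup_diff_left)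
  ultimately show ?thesis using Suc by (auto simp: cnull_def)
qed

text \<open>The induction starts from \<open>N v_0 = 1\<close> and multiplies both terms by the
  class of degree two, so the left factor has even degree. This replaces a computation of the
  cohomology ring of \<open>BG\<close>.\<close>

lemma zigzag_cup:
  assumes v: "ZZ v" and inv: "NL l (tw l b - b)" and cyc: "NL (Suc l) (cobd l b)"
    and bl: "CN l (b - nrm l (v l))"
  shows "CN (2 * a + l) (cup (2 * a) l (nrm (2 * a) (v (2 * a))) b - nrm (2 * a + l) (v (2 * a + l)))"
proof (induction a)
  case 0
  have "NL 0 (nrm 0 (v 0) - 1)" using v by (simp add: zigzag_def)
  from nul_cup_left[OF this, of l b] have "NL l (cup 0 l (nrm 0 (v 0)) b - cup 0 l 1 b)"
    by (simp add: cup_diff_left)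
  moreover have "NL l (cup 0 l 1 b - b)"
    unfolding nul_def
  proof (intro allI impI)
    fix \<sigma> assume "singular_simplex l Z \<sigma>"
    then have "rear 0 l \<sigma> = \<sigma>"
      by (auto simp: rear_def shift_0 o_def singular_simplex_def extensional_restrict)
    then show "int p dvd (cup 0 l 1 b - b) \<sigma>" by (simp add: cup_def)
  qed
  ultimately have "NL l (cup 0 l (nrm 0 (v 0)) b - b)" by (rule nul_trans)
  from cnull_add[OF cnull_nul[OF this] bl] have "CN l (cup 0 l (nrm 0 (v 0)) b - nrm l (v l))" by simp
  then show ?case by (simp only: mult_0_right add_0)
next
  case (Suc a)
  have "PER (2 * a + l) (cup (2 * a) l (nrm (2 * a) (v (2 * a))) b - nrm (2 * a + l) (v (2 * a + l)))
     (cup (Suc (Suc (2 * a))) l (nrm (Suc (Suc (2 * a))) (v (Suc (Suc (2 * a))))) b - nrm (Suc (Suc (2 * a + l))) (v (Suc (Suc (2 * a + l)))))"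
    by (rule per_diff[OF per_cup[OF zigzag_per[OF v] inv cyc] zigzag_per[OF v]])
  note P = cnull_per[OF this Suc]
  have eq: "2 * Suc a = Suc (Suc (2 * a))" by simp
  show ?case unfolding eq add_Suc by (rule P)
qed

end

section \<open>Small simplices\<close>

text \<open>Cochains that vanish on small simplices form a relative complex, all simplices modulo
  small ones; subdivision makes it acyclic for an open cover.\<close>

definition small :: "'a topology \<Rightarrow> 'a set \<Rightarrow> 'a set \<Rightarrow> nat \<Rightarrow> ((nat \<Rightarrow> real) \<Rightarrow> 'a) \<Rightarrow> bool" where
  "small Z A B k \<sigma> \<longleftrightarrow> singular_simplex k (subtopology Z A) \<sigma> \<or> singular_simplex k (subtopology Z B) \<sigma>"

lemma small_face: "small Z A B (Suc k) \<sigma> \<Longrightarrow> i \<le> Suc k \<Longrightarrow> small Z A B k (singular_face (Suc k) i \<sigma>)"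
  by (auto simp: small_def intro: singular_simplex_face)

lemma nul_small_cobd: "nul p (small Z A B k) c \<Longrightarrow> nul p (small Z A B (Suc k)) (cobd k c)"
  by (auto simp: nul_def cobd_def simp del: sum.atMost_Suc intro!: dvd_sum dvd_mult small_face)

lemma small_0:
  assumes "singular_simplex 0 Z \<sigma>" "topspace Z \<subseteq> A \<union> B"
  shows "small Z A B 0 \<sigma>"
proof -
  have "\<sigma> ` standard_simplex 0 \<subseteq> topspace Z"
    using assms(1) by (auto simp: singular_simplex_def continuous_map_def)
  then show ?thesis using assms
    by (auto simp: small_def singular_simplex_subtopology standard_simplex_0)
qed

lemma singular_chain_sdpow:
  "singular_chain k X c \<Longrightarrow> singular_chain k X ((singular_subdivision k ^^ m) c)"
  by (induction m) (auto intro: singular_chain_singular_subdivision)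

lemma chain_boundary_sdpow:
  "singular_chain k X c \<Longrightarrow> chain_boundary k ((singular_subdivision k ^^ m) c)
    = (singular_subdivision (k - Suc 0) ^^ m) (chain_boundary k c)"
proof (induction m)
  case (Suc m)
  then show ?case
    using chain_boundary_singular_subdivision[OF singular_chain_sdpow[OF Suc.prems, of m]] by simp
qed simp

text \<open>Let \<open>H m\<close> be the homotopy between the identity and the \<open>m\<close>-th
  subdivision. Up to sign, \<open>\<alpha>\<close> evaluated on \<open>H m\<close> is a primitive
  once \<open>m\<close> is so large that the subdivision is small. The required \<open>m\<close>
  depends on the simplex, so values for different \<open>m\<close> have to be compared.\<close>

lemma small_acyclic:
  assumes op: "openin Z A" "openin Z B" and cov: "topspace Z \<subseteq> A \<union> B"
    and cyc: "nul p (singular_simplex (Suc (Suc j)) Z) (cobd (Suc j) \<alpha>)"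
    and sm: "nul p (small Z A B (Suc j)) \<alpha>"
  shows "\<exists>\<eta>. nul p (small Z A B j) \<eta> \<and> nul p (singular_simplex (Suc j) Z) (\<alpha> - cobd j \<eta>)"
proof -
  let ?small = "small Z A B"
  obtain h :: "nat \<Rightarrow> 'a chain \<Rightarrow> 'a chain" where h0: "\<And>k. h k 0 = 0"
    and hdiff: "\<And>k c d. h k (c - d) = h k c - h k d"
    and hch: "\<And>k X c. singular_chain k X c \<Longrightarrow> singular_chain (Suc k) X (h k c)"
    and hbd: "\<And>k X c. singular_chain k X c \<Longrightarrow>
       chain_boundary (Suc k) (h k c) + h (k - Suc 0) (chain_boundary k c) = singular_subdivision k c - c"
    using chain_homotopic_singular_subdivision by metis
  define sd where "sd k m c = (singular_subdivision k ^^ m) c" for k m and c :: "'a chain"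
  define H where "H m k c = (\<Sum>i<m. h k (sd k i c))" for m k c
  have sd_diff: "sd k m (c - d) = sd k m c - sd k m d" for k m c d
    by (simp add: sd_def singular_subdivision_power_diff)
  have sd_ch: "singular_chain k X c \<Longrightarrow> singular_chain k X (sd k m c)" for k X c m
    by (simp add: sd_def singular_chain_sdpow)
  have H_diff: "H m k (c - d) = H m k c - H m k d" for m k c d
    by (simp add: H_def sd_diff hdiff sum_subtractf)
  have H_0: "H m k 0 = 0" for m k
    using H_diff[of m k 0 0] by simp
  have H_Suc: "H (Suc m) k c = H m k c + h k (sd k m c)" for m k c
    by (simp add: H_def)
  have H_ch: "singular_chain k Z c \<Longrightarrow> singular_chain (Suc k) Z (H m k c)" for m k c
    unfolding H_def by (intro singular_chain_sum hch sd_ch)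
  have H_bd: "chain_boundary (Suc k) (H m k c) + H m (k - Suc 0) (chain_boundary k c) = sd k m c - c"
    if c: "singular_chain k Z c" for k m c
  proof (induction m)
    case 0
    show ?case by (simp add: H_def sd_def)
  next
    case (Suc m)
    have step: "chain_boundary (Suc k) (h k (sd k m c)) + h (k - Suc 0) (sd (k - Suc 0) m (chain_boundary k c))
      = sd k (Suc m) c - sd k m c"
      using hbd[OF sd_ch[OF c, of m]] chain_boundary_sdpow[OF c, of m] by (simp add: sd_def)
    have "chain_boundary (Suc k) (H (Suc m) k c) + H (Suc m) (k - Suc 0) (chain_boundary k c) =
      (chain_boundary (Suc k) (H m k c) + H m (k - Suc 0) (chain_boundary k c)) +
      (chain_boundary (Suc k) (h k (sd k m c)) + h (k - Suc 0) (sd (k - Suc 0) m (chain_boundary k c)))"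
      by (simp add: H_Suc chain_boundary_add algebra_simps)
    also have "\<dots> = (sd k m c - c) + (sd k (Suc m) c - sd k m c)"
      by (simp only: Suc step)
    finally show ?case by simp
  qed
  have small_h: "int p dvd cev \<alpha> (h j c)" if "Poly_Mapping.keys c \<subseteq> Collect (?small j)" for c
    using that
  proof (induction c rule: frag_induction)
    case zero
    then show ?case by (simp add: h0)
  next
    case (one \<tau>)
    then consider "singular_simplex j (subtopology Z A) \<tau>" | "singular_simplex j (subtopology Z B) \<tau>"
      by (auto simp: small_def)
    then have "Poly_Mapping.keys (h j (frag_of \<tau>)) \<subseteq> Collect (?small (Suc j))"
    proof cases
      case 1
      then have "singular_chain (Suc j) (subtopology Z A) (h j (frag_of \<tau>))"
        by (intro hch) (simp add: singular_chain_of)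
      then show ?thesis by (auto simp: singular_chain_def small_def)
    next
      case 2
      then have "singular_chain (Suc j) (subtopology Z B) (h j (frag_of \<tau>))"
        by (intro hch) (simp add: singular_chain_of)
      then show ?thesis by (auto simp: singular_chain_def small_def)
    qed
    then show ?case using sm by (intro cev_dvd) (auto simp: nul_def)
  next
    case (diff a b)
    then show ?case by (simp add: hdiff cev_diff)
  qed
  have fine: "\<exists>n. \<forall>m\<ge>n. Poly_Mapping.keys (sd k m (frag_of \<tau>)) \<subseteq> Collect (?small k)"
    if \<tau>: "singular_simplex k Z \<tau>" for k \<tau>
  proof -
    have c: "singular_chain k Z (frag_of \<tau>)" using \<tau> by (simp add: singular_chain_of)
    obtain n where n: "\<And>m f. \<lbrakk>n \<le> m; f \<in> Poly_Mapping.keys ((singular_subdivision k ^^ m) (frag_of \<tau>))\<rbrakk>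
                      \<Longrightarrow> \<exists>V\<in>{A, B}. f \<in> (standard_simplex k) \<rightarrow> V"
      using sufficient_iterated_singular_subdivision_exists[OF _ _ c, of "{A, B}"] op cov by auto
    have "?small k f" if "n \<le> m" "f \<in> Poly_Mapping.keys (sd k m (frag_of \<tau>))" for m f
    proof -
      have "singular_simplex k Z f" using sd_ch[OF c, of m] that(2) by (auto simp: singular_chain_def)
      moreover have "\<exists>V\<in>{A, B}. f \<in> (standard_simplex k) \<rightarrow> V" using n[of m f] that by (simp add: sd_def)
      ultimately show ?thesis by (auto simp: small_def singular_simplex_subtopology)
    qed
    then show ?thesis by blast
  qed
  \<comment> \<open>All later subdivisions are required to be small as well. Raising
    \<open>m\<close> beyond \<open>M \<tau>\<close> then only adds values of \<open>\<alpha>\<close>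
    on small simplices, and a small \<open>\<tau>\<close> has \<open>M \<tau> = 0\<close>, so that
    \<open>\<eta>\<close> vanishes on it.\<close>
  define M where "M \<tau> = (LEAST n. \<forall>m\<ge>n. Poly_Mapping.keys (sd j m (frag_of \<tau>)) \<subseteq> Collect (?small j))" for \<tau>
  have M: "Poly_Mapping.keys (sd j m (frag_of \<tau>)) \<subseteq> Collect (?small j)"
    if "singular_simplex j Z \<tau>" "M \<tau> \<le> m" for \<tau> m
    using LeastI_ex[OF fine[OF that(1)]] that(2) unfolding M_def by blast
  define \<eta> where "\<eta> \<tau> = - cev \<alpha> (H (M \<tau>) j (frag_of \<tau>))" for \<tau>
  have stab: "int p dvd \<eta> \<tau> + cev \<alpha> (H m j (frag_of \<tau>))" if \<tau>: "singular_simplex j Z \<tau>" and m: "M \<tau> \<le> m" for \<tau> m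
    using m
  proof (induction m rule: dec_induct)
    case base
    show ?case by (simp add: \<eta>_def)
  next
    case (step m)
    have "int p dvd cev \<alpha> (h j (sd j m (frag_of \<tau>)))" by (rule small_h[OF M[OF \<tau> step.hyps(1)]])
    with step.IH show ?case by (simp add: H_Suc cev_add add.assoc[symmetric])
  qed
  have stab_ch: "int p dvd cev \<eta> x + cev \<alpha> (H m j x)"
    if "Poly_Mapping.keys x \<subseteq> {\<tau>. singular_simplex j Z \<tau> \<and> M \<tau> \<le> m}" for x m
    using that
  proof (induction x rule: frag_induction)
    case zero
    then show ?case by (simp add: H_0)
  next
    case (one \<tau>)
    then show ?case using stab by simp
  next
    case (diff a b)
    from dvd_diff[OF this] show ?case by (simp add: H_diff cev_diff algebra_simps)
  qed
  have "nul p (?small j) \<eta>"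
    unfolding nul_def
  proof (intro allI impI)
    fix \<tau> assume s: "?small j \<tau>"
    have "Poly_Mapping.keys (sd j m (frag_of \<tau>)) \<subseteq> Collect (?small j)" for m
    proof -
      from s consider "singular_simplex j (subtopology Z A) \<tau>" | "singular_simplex j (subtopology Z B) \<tau>"
        by (auto simp: small_def)
      then show ?thesis
      proof cases
        case 1
        then have "singular_chain j (subtopology Z A) (sd j m (frag_of \<tau>))"
          by (intro sd_ch) (simp add: singular_chain_of)
        then show ?thesis by (auto simp: singular_chain_def small_def)
      next
        case 2
        then have "singular_chain j (subtopology Z B) (sd j m (frag_of \<tau>))"
          by (intro sd_ch) (simp add: singular_chain_of)
        then show ?thesis by (auto simp: singular_chain_def small_def)
      qed
    qed
    then have "M \<tau> = 0" unfolding M_def by (intro Least_eq_0) blast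
    then show "int p dvd \<eta> \<tau>" by (simp add: \<eta>_def H_def)
  qed
  moreover have "nul p (singular_simplex (Suc j) Z) (\<alpha> - cobd j \<eta>)"
    unfolding nul_def
  proof (intro allI impI)
    fix \<sigma> assume \<sigma>: "singular_simplex (Suc j) Z \<sigma>"
    let ?c = "frag_of \<sigma>"
    let ?x = "chain_boundary (Suc j) ?c"
    have c: "singular_chain (Suc j) Z ?c" using \<sigma> by (simp add: singular_chain_of)
    obtain n where n: "\<forall>m\<ge>n. Poly_Mapping.keys (sd (Suc j) m ?c) \<subseteq> Collect (?small (Suc j))"
      using fine[OF \<sigma>] by blast
    \<comment> \<open>One exponent that is large enough for \<open>\<sigma>\<close> and for all its
      faces.\<close>
    define m where "m = n + (\<Sum>\<tau>\<in>Poly_Mapping.keys ?x. M \<tau>)"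
    have "M \<tau> \<le> m" if "\<tau> \<in> Poly_Mapping.keys ?x" for \<tau>
      unfolding m_def using member_le_sum[of \<tau> "Poly_Mapping.keys ?x" M] that by (simp add: trans_le_add2)
    moreover have "singular_chain j Z ?x" by (rule singular_chain_boundary_alt[OF c])
    ultimately have 1: "int p dvd cev \<eta> ?x + cev \<alpha> (H m j ?x)"
      by (intro stab_ch) (auto simp: singular_chain_def)
    have "H m j ?x = sd (Suc j) m ?c - ?c - chain_boundary (Suc (Suc j)) (H m (Suc j) ?c)"
      using H_bd[OF c, of m] by (simp add: algebra_simps)
    then have 2: "cev \<alpha> (H m j ?x) = cev \<alpha> (sd (Suc j) m ?c) - \<alpha> \<sigma> - cev (cobd (Suc j) \<alpha>) (H m (Suc j) ?c)"
      by (simp add: cev_diff cev_chain_boundary)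
    have "n \<le> m" by (simp add: m_def)
    with n have "Poly_Mapping.keys (sd (Suc j) m ?c) \<subseteq> Collect (?small (Suc j))" by blast
    then have 3: "int p dvd cev \<alpha> (sd (Suc j) m ?c)"
      using sm by (intro cev_dvd) (auto simp: nul_def)
    have 4: "int p dvd cev (cobd (Suc j) \<alpha>) (H m (Suc j) ?c)"
      by (rule cev_dvd_nul[OF cyc H_ch[OF c]])
    have "int p dvd (cev \<alpha> (sd (Suc j) m ?c) - cev (cobd (Suc j) \<alpha>) (H m (Suc j) ?c)) - (cev \<eta> ?x + cev \<alpha> (H m j ?x))"
      using 1 3 4 by (intro dvd_diff)
    then show "int p dvd (\<alpha> - cobd j \<eta>) \<sigma>"
      unfolding 2 cev_chain_boundary by simp
  qed
  ultimately show ?thesis by blast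
qed

section \<open>Unions of invariant open sets\<close>

lemma connectedin_open_dichotomy:
  assumes "connectedin X S" "openin X U" "openin X E" "S \<subseteq> U \<union> E" "U \<inter> E = {}"
  shows "S \<subseteq> U \<or> S \<inter> U = {}"
proof (rule ccontr)
  assume n: "\<not> (S \<subseteq> U \<or> S \<inter> U = {})"
  have "U \<inter> E \<inter> S = {}" "U \<inter> S \<noteq> {}" "E \<inter> S \<noteq> {}" using n assms(4,5) by auto
  then show False using assms(1-4) unfolding connectedin by metis
qed

context free_cyclic
begin

lemma op_Suc_Suc: "opr (Suc (Suc i)) k c = opr i k c"
  by (simp add: op_def)

lemma nul_op_on:
  assumes "\<And>\<sigma> j. Q \<sigma> \<Longrightarrow> Q (simplex_map k (T ^^ j) \<sigma>)" "nul p Q c"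
  shows "nul p Q (opr i k c)"
  using assms(2) assms(1)[of _ 1] assms(1) by (auto simp: op_def nul_def pb_def nm_def intro!: dvd_sum)

lemma sub_free_cyclic:
  assumes V: "\<And>z. z \<in> V \<Longrightarrow> T z \<in> V"
  shows "free_cyclic p (subtopology Z V) T"
proof
  show "continuous_map (subtopology Z V) (subtopology Z V) T"
    using cont V by (auto simp: continuous_map_in_subtopology continuous_map_from_subtopology)
qed (use prime_p period free in auto)

lemma sub_simplex_pow:
  assumes V: "\<And>z. z \<in> V \<Longrightarrow> T z \<in> V"
  shows "singular_simplex k (subtopology Z V) \<sigma> \<Longrightarrow> singular_simplex k (subtopology Z V) (simplex_map k (T ^^ j) \<sigma>)"
  using free_cyclic.simplex_pow[OF sub_free_cyclic[OF V]] by blast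

lemma sub_nul: "NL k c \<Longrightarrow> nul p (singular_simplex k (subtopology Z V)) c"
  by (simp add: nul_def singular_simplex_subtopology)

lemma sub_zigzag: "ZZ v \<Longrightarrow> zigzag p (subtopology Z V) T v"
  unfolding zigzag_def by (simp add: sub_nul)

text \<open>Dimension shifting along the resolution. A primitive \<open>s\<close> from the
  non-equivariant case is corrected: \<open>opr i s\<close> is a cocycle one degree lower, killed by
  \<open>opr (i + 1)\<close>, so by induction it is \<open>\<delta> r\<close> with \<open>r\<close>
  killed by \<open>opr (i + 1)\<close>. Exactness and period two give \<open>r = opr i q\<close>,
  and \<open>s - \<delta> q\<close> is the solution.\<close>

lemma small_equivariant:
  assumes op: "openin Z A" "openin Z B" and cov: "topspace Z \<subseteq> A \<union> B"
    and inv: "\<And>z. z \<in> A \<Longrightarrow> T z \<in> A" "\<And>z. z \<in> B \<Longrightarrow> T z \<in> B"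
  shows "\<lbrakk>NL (Suc j) (opr i (Suc j) \<alpha>); NL (Suc (Suc j)) (cobd (Suc j) \<alpha>); nul p (small Z A B (Suc j)) \<alpha>\<rbrakk> \<Longrightarrow>
    \<exists>\<eta>. NL j (opr i j \<eta>) \<and> nul p (small Z A B j) \<eta> \<and> NL (Suc j) (\<alpha> - cobd j \<eta>)"
proof (induction j arbitrary: i \<alpha>)
  case 0
  obtain s where s: "nul p (small Z A B 0) s" "NL (Suc 0) (\<alpha> - cobd 0 s)"
    using small_acyclic[OF op cov 0(2,3)] by blast
  have "NL 0 s" using s(1) small_0[OF _ cov] by (auto simp: nul_def)
  then show ?case using s nul_op by blast
next
  case (Suc j)
  let ?small = "small Z A B"
  have closed: "?small k \<sigma> \<Longrightarrow> ?small k (simplex_map k (T ^^ l) \<sigma>)" for k l \<sigma>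
    using sub_simplex_pow[OF inv(1)] sub_simplex_pow[OF inv(2)] unfolding small_def by blast
  obtain s where s: "nul p (?small (Suc j)) s" "NL (Suc (Suc j)) (\<alpha> - cobd (Suc j) s)"
    using small_acyclic[OF op cov Suc.prems(2,3)] by blast
  let ?x = "opr i (Suc j) s"
  have x1: "NL (Suc j) (opr (Suc i) (Suc j) ?x)"
    using op_op[of "Suc j" "Suc i" s] by (simp only: op_Suc_Suc)
  have "NL (Suc (Suc j)) (opr i (Suc (Suc j)) (cobd (Suc j) s))"
    using nul_sub[OF op_cong[OF nul_sym[OF s(2)]] Suc.prems(1)] .
  then have x2: "NL (Suc (Suc j)) (cobd (Suc j) ?x)" by (simp only: cobd_op)
  have x3: "nul p (?small (Suc j)) ?x" by (rule nul_op_on[OF closed s(1)])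
  obtain r where r: "NL j (opr (Suc i) j r)" "nul p (?small j) r" "NL (Suc j) (?x - cobd j r)"
    using Suc.IH[OF x1 x2 x3] by blast
  obtain q where q: "NL j (r - opr (Suc (Suc i)) j q)"
    "\<And>Q. (\<And>\<sigma> l. Q \<sigma> \<Longrightarrow> Q (simplex_map j (T ^^ l) \<sigma>)) \<Longrightarrow> nul p Q r \<Longrightarrow> nul p Q q"
    using op_ex[OF r(1)] by blast
  \<comment> \<open>Here exactness has to respect vanishing on an invariant set of
    simplices.\<close>
  have qs: "nul p (?small j) q" by (rule q(2)[OF closed r(2)])
  have "NL (Suc j) (cobd j r - opr i (Suc j) (cobd j q))"
    using nul_cobd[OF q(1)] by (simp only: op_Suc_Suc cobd_diff cobd_op)
  from nul_trans[OF r(3) this] have e1: "NL (Suc j) (opr i (Suc j) (s - cobd j q))"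
    by (simp only: op_diff)
  have e2: "nul p (?small (Suc j)) (s - cobd j q)"
    by (rule nul_diff[OF s(1) nul_small_cobd[OF qs]])
  have "NL (Suc (Suc j)) (\<alpha> - cobd (Suc j) (s - cobd j q))"
    using nul_add[OF s(2) nul_cobd_cobd[of p j Z q]] by (simp add: lin)
  with e1 e2 show ?case by blast
qed

lemma small_cnull:
  assumes op: "openin Z A" "openin Z B" and cov: "topspace Z \<subseteq> A \<union> B"
    and inv: "\<And>z. z \<in> A \<Longrightarrow> T z \<in> A" "\<And>z. z \<in> B \<Longrightarrow> T z \<in> B"
    and \<alpha>: "NL k (tw k \<alpha> - \<alpha>)" "NL (Suc k) (cobd k \<alpha>)" "nul p (small Z A B k) \<alpha>"
  shows "CN k \<alpha>"
proof (cases k)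
  case 0
  have "NL 0 \<alpha>" using \<alpha>(3) small_0[OF _ cov] 0 by (auto simp: nul_def)
  then show ?thesis using 0 cnull_nul by blast
next
  case (Suc j)
  have "NL (Suc j) (opr 1 (Suc j) \<alpha>)" using \<alpha>(1) unfolding Suc by (simp add: op_def)
  from small_equivariant[OF op cov inv this] \<alpha>(2,3)
  obtain \<eta> where "NL j (opr 1 j \<eta>)" "NL (Suc j) (\<alpha> - cobd j \<eta>)" unfolding Suc by blast
  then show ?thesis unfolding Suc cnull_def by (auto simp: op_def)
qed

text \<open>Extend the primitive on \<open>V\<close> by zero to all simplices. As \<open>V\<close>
  is invariant, the extension is invariant too, and subtracting its coboundary does not change the
  class.\<close>

lemma cnull_extend:
  assumes V: "\<And>z. z \<in> V \<Longrightarrow> T z \<in> V" and g: "NL k (tw k g - g)" "NL (Suc k) (cobd k g)"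
    and null: "cnull p (subtopology Z V) T k g"
  obtains g' where "NL k (tw k g' - g')" "NL (Suc k) (cobd k g')" "CN k (g' - g)"
    "nul p (singular_simplex k (subtopology Z V)) g'"
proof (cases k)
  case 0
  have "CN k (g - g)" by (simp add: cnull_nul)
  then show ?thesis using that[of g] g null unfolding 0 cnull_def by simp
next
  case (Suc j)
  let ?P = "singular_simplex j (subtopology Z V)"
  obtain e where e: "nul p ?P (tw j e - e)" "nul p (singular_simplex (Suc j) (subtopology Z V)) (g - cobd j e)"
    using null unfolding Suc cnull_def by auto
  define e' where "e' \<sigma> = (if ?P \<sigma> then e \<sigma> else 0)" for \<sigma>
  have PT: "?P (simplex_map j T \<sigma>) \<longleftrightarrow> ?P \<sigma>" if \<sigma>: "singular_simplex j Z \<sigma>" for \<sigma>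
  proof
    assume "?P (simplex_map j T \<sigma>)"
    from sub_simplex_pow[OF V this, of "p - 1"] have "?P (simplex_map j (T ^^ p) \<sigma>)"
      using simplex_map_pow_add[of j "p - 1" 1 \<sigma>] p_pos by simp
    then show "?P \<sigma>" using simplex_map_period[OF \<sigma>] by simp
  next
    assume "?P \<sigma>"
    from sub_simplex_pow[OF V this, of 1] show "?P (simplex_map j T \<sigma>)" by simp
  qed
  have inv: "NL j (tw j e' - e')"
    using e(1) PT by (auto simp: nul_def pb_def e'_def)
  let ?g = "g - cobd j e'"
  have "NL (Suc j) (cobd j (tw j e' - e'))" by (rule nul_cobd[OF inv])
  then have i2: "NL (Suc j) (tw (Suc j) (cobd j e') - cobd j e')" by (simp add: cobd_diff cobd_pb)
  have 1: "NL (Suc j) (tw (Suc j) ?g - ?g)"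
    using nul_diff[OF g(1)[unfolded Suc] i2] by (simp add: lin)
  have 2: "NL (Suc (Suc j)) (cobd (Suc j) ?g)"
    using nul_diff[OF g(2)[unfolded Suc] nul_cobd_cobd[of p j Z e']] by (simp add: cobd_diff)
  have "NL (Suc j) (cobd j e' - cobd j e')" by simp
  then have "CN (Suc j) (cobd j e')" unfolding cnull_def using inv by auto
  from cnull_minus[OF this] have 3: "CN (Suc j) (?g - g)" by simp
  have "cobd j e' \<sigma> = cobd j e \<sigma>" if "singular_simplex (Suc j) (subtopology Z V) \<sigma>" for \<sigma>
    unfolding cobd_def e'_def using singular_simplex_face[OF that] by (intro sum.cong) auto
  then have 4: "nul p (singular_simplex (Suc j) (subtopology Z V)) ?g"
    using e(2) by (simp add: nul_def)
  show ?thesis using that[of ?g] 1 2 3 4 unfolding Suc by blast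
qed

text \<open>The two classes have representatives that vanish on \<open>A\<close> and on
  \<open>B\<close> respectively. Their product vanishes on every small simplex, hence is null; on
  the other hand it represents the class in the sum of the degrees.\<close>

lemma zigzag_union:
  assumes v: "ZZ v" and op: "openin Z A" "openin Z B" and cov: "topspace Z \<subseteq> A \<union> B"
    and inv: "\<And>z. z \<in> A \<Longrightarrow> T z \<in> A" "\<And>z. z \<in> B \<Longrightarrow> T z \<in> B"
    and A: "cnull p (subtopology Z A) T (2 * a) (nrm (2 * a) (v (2 * a)))"
    and B: "cnull p (subtopology Z B) T l (nrm l (v l))"
  shows "CN (2 * a + l) (nrm (2 * a + l) (v (2 * a + l)))"
proof -
  obtain \<alpha> where \<alpha>: "NL (2 * a) (tw (2 * a) \<alpha> - \<alpha>)" "NL (Suc (2 * a)) (cobd (2 * a) \<alpha>)"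
     "CN (2 * a) (\<alpha> - nrm (2 * a) (v (2 * a)))" "nul p (singular_simplex (2 * a) (subtopology Z A)) \<alpha>"
    using cnull_extend[OF inv(1) tw_nrm zigzag_cocycle[OF v] A] by blast
  obtain \<beta> where \<beta>: "NL l (tw l \<beta> - \<beta>)" "NL (Suc l) (cobd l \<beta>)"
     "CN l (\<beta> - nrm l (v l))" "nul p (singular_simplex l (subtopology Z B)) \<beta>"
    using cnull_extend[OF inv(2) tw_nrm zigzag_cocycle[OF v] B] by blast
  let ?k = "2 * a"
  have c1: "NL (?k + l) (tw (?k + l) (cup ?k l \<alpha> \<beta>) - cup ?k l \<alpha> \<beta>)"
    using nul_add[OF tw_cup[OF \<beta>(1), of ?k \<alpha>] nul_cup_left[OF \<alpha>(1), of l \<beta>]] by (simp add: cup_diff_left)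
  have c2: "NL (Suc (?k + l)) (cobd (?k + l) (cup ?k l \<alpha> \<beta>))"
    using nul_sub[OF cobd_cup[OF \<beta>(2)] nul_cup_left[OF \<alpha>(2), of l \<beta>, unfolded add_Suc]] .
  have c3: "nul p (small Z A B (?k + l)) (cup ?k l \<alpha> \<beta>)"
    using \<alpha>(4) \<beta>(4) unfolding nul_def small_def cup_def
    by (intro allI impI, elim disjE)
       (rule dvd_mult2, simp add: singular_simplex_front, rule dvd_mult, simp add: singular_simplex_rear)
  have "CN (?k + l) (cup ?k l \<alpha> \<beta>)" by (rule small_cnull[OF op cov inv c1 c2 c3])
  from cnull_diff[OF this cnull_cup[OF \<alpha>(3) \<beta>(1,2)]]
  have "CN (?k + l) (cup ?k l (nrm ?k (v ?k)) \<beta>)" by (simp add: cup_diff_left)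
  from cnull_diff[OF this zigzag_cup[OF v \<beta>(1,2,3), of a]]
  show ?thesis by simp
qed

text \<open>On the disjoint union of the translates of \<open>U\<close> there is a zigzag
  concentrated in degree 0: the indicator of \<open>U\<close> is locally constant and has norm 1. By
  uniqueness the classes of positive degree vanish; 2 is the first even one.\<close>

lemma evenly_covered_null:
  assumes v: "ZZ v" and U: "openin Z U" "\<And>j u. 0 < j \<Longrightarrow> j < p \<Longrightarrow> u \<in> U \<Longrightarrow> (T ^^ j) u \<notin> U"
    and opj: "\<And>j. j < p \<Longrightarrow> openin Z ((T ^^ j) ` U)"
  shows "cnull p (subtopology Z (\<Union>j<p. (T ^^ j) ` U)) T 2 (nrm 2 (v 2))"
    and "\<And>z. z \<in> (\<Union>j<p. (T ^^ j) ` U) \<Longrightarrow> T z \<in> (\<Union>j<p. (T ^^ j) ` U)"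
proof -
  let ?W = "\<Union>j<p. (T ^^ j) ` U"
  have sub: "U \<subseteq> topspace Z" using U(1) openin_subset by blast
  show TW: "T z \<in> ?W" if "z \<in> ?W" for z
  proof -
    obtain j u where ju: "j < p" "u \<in> U" "z = (T ^^ j) u" using \<open>z \<in> ?W\<close> by auto
    have "T z = (T ^^ (Suc j mod p)) u" using pow_mod[of u "Suc j"] ju sub by auto
    then show ?thesis using ju p_pos by auto
  qed
  interpret W: free_cyclic p "subtopology Z ?W" T by (rule sub_free_cyclic[OF TW])
  define e where "e = (\<lambda>j::nat. if j = 0 then 1 else 0 :: real)"
  have e: "e \<in> standard_simplex 0" by (simp add: e_def standard_simplex_0)
  define w0 where "w0 \<sigma> = (if \<sigma> e \<in> U then 1 else 0 :: int)" for \<sigma> :: "(nat \<Rightarrow> real) \<Rightarrow> 'a"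
  define w where "w k = (if k = 0 then w0 else 0)" for k :: nat
  have uniq: "\<exists>!j. j < p \<and> (T ^^ j) z \<in> U" if z: "z \<in> ?W" for z
  proof -
    obtain i u where iu: "i < p" "u \<in> U" "z = (T ^^ i) u" using z by auto
    have uZ: "u \<in> topspace Z" using iu sub by auto
    have "(T ^^ ((p - i) mod p)) z = (T ^^ ((p - i) + i)) u"
      using pow_mod[OF T_mem[OF uZ, of i], of "p - i"] iu(3) by (simp add: funpow_add)
    also have "\<dots> = u" using period[OF uZ] iu by simp
    finally have ex: "(T ^^ ((p - i) mod p)) z \<in> U" using iu by simp
    have one: False if "a < b" "b < p" "(T ^^ a) z \<in> U" "(T ^^ b) z \<in> U" for a b
    proof -
      have "(T ^^ b) z = (T ^^ (b - a)) ((T ^^ a) z)"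
        using that(1) by (metis comp_apply funpow_add le_add_diff_inverse2 less_imp_le)
      then show False using U(2)[of "b - a" "(T ^^ a) z"] that by auto
    qed
    show ?thesis
    proof (rule ex1I[of _ "(p - i) mod p"])
      show "(p - i) mod p < p \<and> (T ^^ ((p - i) mod p)) z \<in> U" using ex p_pos by simp
      fix j assume j: "j < p \<and> (T ^^ j) z \<in> U"
      show "j = (p - i) mod p"
      proof (rule ccontr)
        assume "j \<noteq> (p - i) mod p"
        then consider "j < (p - i) mod p" | "(p - i) mod p < j" by linarith
        then show False
          by cases (use one[of j "(p - i) mod p"] one[of "(p - i) mod p" j] j ex p_pos in auto)
      qed
    qed
  qed
  have "W.NL 0 (nrm 0 w0 - 1)"
    unfolding nul_def
  proof (intro allI impI)
    fix \<sigma> assume \<sigma>: "singular_simplex 0 (subtopology Z ?W) \<sigma>"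
    then have "\<sigma> ` standard_simplex 0 \<subseteq> ?W" by (simp only: singular_simplex_subtopology)
    then have zW: "\<sigma> e \<in> ?W" using e by (rule image_subset_iff[THEN iffD1, THEN bspec])
    obtain i where i: "i < p" "(T ^^ i) (\<sigma> e) \<in> U" "\<And>j. j < p \<Longrightarrow> (T ^^ j) (\<sigma> e) \<in> U \<Longrightarrow> j = i"
      using uniq[OF zW] by (elim ex1E conjE) metis
    have "nrm 0 w0 \<sigma> = (\<Sum>j<p. if j = i then 1 else 0)"
    proof (unfold nm_def, rule sum.cong[OF refl])
      fix j assume "j \<in> {..<p}"
      then have "(T ^^ j) (\<sigma> e) \<in> U \<longleftrightarrow> j = i" using i by (metis lessThan_iff)
      then show "w0 (simplex_map 0 (T ^^ j) \<sigma>) = (if j = i then 1 else 0)"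
        using e by (simp add: w0_def simplex_map_def)
    qed
    then show "int p dvd (nrm 0 w0 - 1) \<sigma>" using i(1) by simp
  qed
  moreover have "W.NL (Suc 0) (cobd 0 w0)"
    unfolding nul_def
  proof (intro allI impI)
    fix \<sigma> assume \<sigma>: "singular_simplex (Suc 0) (subtopology Z ?W) \<sigma>"
    have im: "\<sigma> ` standard_simplex (Suc 0) \<subseteq> ?W" and \<sigma>Z: "singular_simplex (Suc 0) Z \<sigma>"
      using \<sigma> by (auto simp: singular_simplex_subtopology)
    have conn: "connectedin Z (\<sigma> ` standard_simplex (Suc 0))"
      by (rule connectedin_continuous_map_image[where X = "subtopology (powertop_real UNIV) (standard_simplex (Suc 0))"])
         (use \<sigma>Z connectedin_standard_simplex in \<open>auto simp: singular_simplex_def connectedin_subtopology\<close>)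
    let ?E = "\<Union>j\<in>{0<..<p}. (T ^^ j) ` U"
    have oE: "openin Z ?E" using opj by auto
    have dis: "U \<inter> ?E = {}" using U(2) by auto
    have cv: "?W \<subseteq> U \<union> ?E"
    proof
      fix z assume "z \<in> ?W"
      then obtain j u where "j < p" "u \<in> U" "z = (T ^^ j) u" by auto
      then show "z \<in> U \<union> ?E" by (cases "j = 0") auto
    qed
    \<comment> \<open>Within the union, \<open>U\<close> and the other translates are disjoint open
      sets, so a path has both end points in \<open>U\<close> or neither.\<close>
    have dich: "\<sigma> ` standard_simplex (Suc 0) \<subseteq> U \<or> \<sigma> ` standard_simplex (Suc 0) \<inter> U = {}"
      by (rule connectedin_open_dichotomy[OF conn U(1) oE subset_trans[OF im cv] dis])
    have "singular_face (Suc 0) i \<sigma> e \<in> \<sigma> ` standard_simplex (Suc 0)" if "i \<le> Suc 0" for i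
      using face_mem[OF that e] e by (simp add: singular_face_def)
    then have "w0 (singular_face (Suc 0) 0 \<sigma>) = w0 (singular_face (Suc 0) (Suc 0) \<sigma>)"
      using dich unfolding w0_def by (meson disjoint_iff le_refl subsetD zero_le)
    then show "int p dvd cobd 0 w0 \<sigma>" by (simp add: cobd_def)
  qed
  moreover have "nm p T k 0 = 0" "pb k T 0 - 0 = (0 :: 'a cochain)" for k by (simp_all add: nm_0 pb_0)
  ultimately have "W.ZZ w"
    unfolding zigzag_def w_def op_def by (auto simp: cobd_0 nm_0 pb_0)
  from W.zigzag_unique[OF sub_zigzag[OF v] this, of 2]
  show "cnull p (subtopology Z ?W) T 2 (nrm 2 (v 2))" by (simp add: w_def nm_0)
qed

end

text \<open>Each evenly covered piece kills the class of degree two, and degrees add up when pieces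
  are united; so a finite cover by \<open>m\<close> pieces kills the class of degree
  \<open>2 m\<close>.\<close>

lemma (in cyclic_cover) compact_null:
  assumes v: "ZZ v" and comp: "compact_space Z"
  shows "\<exists>a. CN (2 * a) (nrm (2 * a) (v (2 * a)))"
proof -
  define \<W> where "\<W> = {\<Union>j<p. (T ^^ j) ` U | U. openin Z U \<and> (\<forall>j u. 0 < j \<longrightarrow> j < p \<longrightarrow> u \<in> U \<longrightarrow> (T ^^ j) u \<notin> U)}"
  have W: "openin Z W" "cnull p (subtopology Z W) T 2 (nrm 2 (v 2))" "\<And>z. z \<in> W \<Longrightarrow> T z \<in> W" if "W \<in> \<W>" for W
  proof -
    obtain U where U: "W = (\<Union>j<p. (T ^^ j) ` U)" "openin Z U"
      "\<And>j u. 0 < j \<Longrightarrow> j < p \<Longrightarrow> u \<in> U \<Longrightarrow> (T ^^ j) u \<notin> U"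
      using \<open>W \<in> \<W>\<close> unfolding \<W>_def by blast
    have opj: "openin Z ((T ^^ j) ` U)" if "j < p" for j using openin_pow_image[OF U(2)] that by simp
    show "openin Z W" unfolding U(1) using opj by auto
    show "cnull p (subtopology Z W) T 2 (nrm 2 (v 2))" "\<And>z. z \<in> W \<Longrightarrow> T z \<in> W"
      unfolding U(1) using evenly_covered_null[OF v U(2,3) opj] by blast+
  qed
  have "topspace Z \<subseteq> \<Union>\<W>"
  proof
    fix z assume "z \<in> topspace Z"
    from evenly[OF this] obtain U where U: "openin Z U" "z \<in> U"
      "\<forall>j u. 0 < j \<longrightarrow> j < p \<longrightarrow> u \<in> U \<longrightarrow> (T ^^ j) u \<notin> U" by blast
    have "z \<in> (\<Union>j<p. (T ^^ j) ` U)" using U(2) p_pos by (auto intro!: bexI[where x = 0])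
    moreover have "(\<Union>j<p. (T ^^ j) ` U) \<in> \<W>" unfolding \<W>_def using U by blast
    ultimately show "z \<in> \<Union>\<W>" by blast
  qed
  moreover have "\<forall>W\<in>\<W>. openin Z W" using W(1) by (rule ballI)
  ultimately have "\<exists>\<F>. finite \<F> \<and> \<F> \<subseteq> \<W> \<and> topspace Z \<subseteq> \<Union>\<F>"
    using comp unfolding compact_space_alt by (elim allE[where x = \<W>]) simp
  then obtain \<F> where F: "finite \<F>" "\<F> \<subseteq> \<W>" "topspace Z \<subseteq> \<Union>\<F>"
    by (elim exE conjE)
  have "openin Z (\<Union>\<F>) \<and> (\<forall>z\<in>\<Union>\<F>. T z \<in> \<Union>\<F>) \<and>
     (\<exists>a. cnull p (subtopology Z (\<Union>\<F>)) T (2 * a) (nrm (2 * a) (v (2 * a))))"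
    using F(1,2)
  proof (induction \<F> rule: finite_induct)
    case empty
    have "cnull p (subtopology Z {}) T (2 * 0) (nrm (2 * 0) (v (2 * 0)))"
      by (intro cnull_nul) (auto simp: nul_def singular_simplex_empty)
    then have "\<exists>a. cnull p (subtopology Z {}) T (2 * a) (nrm (2 * a) (v (2 * a)))" by (rule exI)
    then show ?case by simp
  next
    case (insert W \<F>)
    then have "\<F> \<subseteq> \<W>" by simp
    note IH = insert.IH[OF this]
    obtain a where a: "cnull p (subtopology Z (\<Union>\<F>)) T (2 * a) (nrm (2 * a) (v (2 * a)))"
      using IH[THEN conjunct2, THEN conjunct2] by (rule exE)
    note oF = IH[THEN conjunct1] and TF = bspec[OF IH[THEN conjunct2, THEN conjunct1]]
    have WW: "W \<in> \<W>" using insert by auto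
    let ?V = "W \<union> \<Union>\<F>"
    have TV: "T z \<in> ?V" if "z \<in> ?V" for z
      by (rule UnE[OF that]) (rule UnI1, erule W(3)[OF WW], rule UnI2, erule TF)
    interpret V: free_cyclic p "subtopology Z ?V" T by (rule sub_free_cyclic[OF TV])
    have st: "subtopology (subtopology Z ?V) W = subtopology Z W"
      "subtopology (subtopology Z ?V) (\<Union>\<F>) = subtopology Z (\<Union>\<F>)"
      by (simp_all add: subtopology_subtopology Int_absorb1)
    have ov: "openin (subtopology Z ?V) W" "openin (subtopology Z ?V) (\<Union>\<F>)"
      using W(1)[OF WW] oF by (auto simp: openin_subtopology)
    have cov: "topspace (subtopology Z ?V) \<subseteq> W \<union> \<Union>\<F>" unfolding topspace_subtopology by (rule Int_lower2)
    have W2: "cnull p (subtopology (subtopology Z ?V) W) T (2 * 1) (nrm (2 * 1) (v (2 * 1)))"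
      unfolding st using W(2)[OF WW] by (simp only: mult_1_right)
    have F2: "cnull p (subtopology (subtopology Z ?V) (\<Union>\<F>)) T (2 * a) (nrm (2 * a) (v (2 * a)))"
      unfolding st by (rule a)
    have "cnull p (subtopology Z ?V) T (2 * 1 + 2 * a) (nrm (2 * 1 + 2 * a) (v (2 * 1 + 2 * a)))"
      by (rule V.zigzag_union[OF sub_zigzag[OF v] ov cov W(3)[OF WW] TF W2 F2])
    moreover have "2 * 1 + 2 * a = 2 * Suc a" by simp
    ultimately have "cnull p (subtopology Z ?V) T (2 * Suc a) (nrm (2 * Suc a) (v (2 * Suc a)))" by (simp only:)
    then have "\<exists>a. cnull p (subtopology Z ?V) T (2 * a) (nrm (2 * a) (v (2 * a)))" by (rule exI)
    moreover have "openin Z ?V" using W(1)[OF WW] oF by (rule openin_Un)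
    moreover have "\<forall>z\<in>?V. T z \<in> ?V" using TV by (rule ballI)
    ultimately show ?case unfolding Union_insert by (intro conjI)
  qed
  moreover have "\<Union>\<F> = topspace Z"
  proof (rule equalityI[OF Union_least F(3)])
    fix W' assume "W' \<in> \<F>"
    then show "W' \<subseteq> topspace Z" using F(2) W(1) openin_subset by (meson subsetD)
  qed
  ultimately show ?thesis by simp
qed

section \<open>Joins\<close>

lemma continuous_map_complex_mult:
  fixes f g :: "'a \<Rightarrow> complex"
  assumes "continuous_map W euclidean f" "continuous_map W euclidean g"
  shows "continuous_map W euclidean (\<lambda>x. f x * g x)"
proof -
  have "continuous_map W euclidean (\<lambda>x. (f x, g x))"
    using continuous_map_pairedI[OF assms] by simp
  from continuous_map_compose[OF this, of euclidean "\<lambda>z. fst z * snd z"] show ?thesis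
    by (simp add: o_def continuous_on_mult continuous_on_fst continuous_on_snd)
qed

locale free_join =
  fixes p :: nat and X :: "'a topology" and \<phi> :: "int \<Rightarrow> 'a \<Rightarrow> 'a"
    and Y :: "'b topology" and \<psi> :: "int \<Rightarrow> 'b \<Rightarrow> 'b"
  assumes prime_p: "prime p"
    and faX: "free_action (integer_mod_group p) X \<phi>"
    and faY: "free_action (integer_mod_group p) Y \<psi>"
begin

abbreviation "G \<equiv> integer_mod_group p"
abbreviation "J \<equiv> join_space X Y"
abbreviation "jp \<equiv> join_point X Y"
abbreviation "DJ \<equiv> prod_topology X (prod_topology Y (top_of_set {0..1::real}))"
abbreviation "jact \<equiv> join_action X \<phi> Y \<psi>"

sublocale X: free_cyclic p X "\<phi> 1" by (rule free_action_free_cyclic[OF prime_p faX])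
sublocale Y: free_cyclic p Y "\<psi> 1" by (rule free_action_free_cyclic[OF prime_p faY])

section \<open>The join as a quotient and its free action\<close>

lemma jp_quotient: "quotient_map DJ J jp"
  unfolding join_space_def by (rule quotient_map_quotient_topology)

lemma topspace_J: "topspace J = jp ` topspace DJ"
  unfolding join_space_def by simp

lemma DJ_mem: "(x, y, t) \<in> topspace DJ \<longleftrightarrow> x \<in> topspace X \<and> y \<in> topspace Y \<and> 0 \<le> t \<and> t \<le> 1"
  by auto

lemma jp_mem: "x \<in> topspace X \<Longrightarrow> y \<in> topspace Y \<Longrightarrow> 0 \<le> t \<Longrightarrow> t \<le> 1 \<Longrightarrow> jp (x, y, t) \<in> topspace J"
  unfolding topspace_J using DJ_mem by blast

lemma J_cases:
  assumes "C \<in> topspace J"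
  obtains x y t where "x \<in> topspace X" "y \<in> topspace Y" "0 \<le> t" "t \<le> 1" "C = jp (x, y, t)"
  using assms unfolding topspace_J by (auto simp del: topspace_prod_topology simp: DJ_mem)

lemma jp_eq:
  assumes "x \<in> topspace X" "y \<in> topspace Y"
  shows "jp (x, y, t) = jp (x', y', t') \<longleftrightarrow> t = t' \<and> (t = 0 \<and> x = x' \<or> t = 1 \<and> y = y' \<or> x = x' \<and> y = y')"
proof
  assume e: "jp (x, y, t) = jp (x', y', t')"
  have "(x, y, t) \<in> jp (x, y, t)" using assms by (simp add: join_point_def)
  then have "(x, y, t) \<in> jp (x', y', t')" unfolding e .
  then show "t = t' \<and> (t = 0 \<and> x = x' \<or> t = 1 \<and> y = y' \<or> x = x' \<and> y = y')"
    by (auto simp: join_point_def)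
next
  assume "t = t' \<and> (t = 0 \<and> x = x' \<or> t = 1 \<and> y = y' \<or> x = x' \<and> y = y')"
  then show "jp (x, y, t) = jp (x', y', t')" by (auto simp: join_point_def)
qed

lemma jp_0: "jp (x, y, 0) = jp (x, y', 0)"
  and jp_1: "jp (x, y, 1) = jp (x', y, 1)"
  by (auto simp: join_point_def)

lemma action_mem:
  assumes "g \<in> carrier G"
  shows "x \<in> topspace X \<Longrightarrow> \<phi> g x \<in> topspace X" "y \<in> topspace Y \<Longrightarrow> \<psi> g y \<in> topspace Y"
proof -
  have "continuous_map X X (\<phi> g)" "continuous_map Y Y (\<psi> g)"
    using faX faY assms by (auto simp: free_action_def)
  then show "x \<in> topspace X \<Longrightarrow> \<phi> g x \<in> topspace X" "y \<in> topspace Y \<Longrightarrow> \<psi> g y \<in> topspace Y"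
    by (auto simp: continuous_map_def)
qed

lemma action_surj:
  assumes "g \<in> carrier G"
  shows "\<phi> g ` topspace X = topspace X" "\<psi> g ` topspace Y = topspace Y"
proof -
  interpret A: group_action G "topspace X" \<phi> using faX by (simp add: free_action_def)
  interpret B: group_action G "topspace Y" \<psi> using faY by (simp add: free_action_def)
  show "\<phi> g ` topspace X = topspace X" "\<psi> g ` topspace Y = topspace Y"
    using A.surj_prop[OF assms] B.surj_prop[OF assms] by auto
qed

text \<open>The action is defined on equivalence classes as sets, so the image of a class has to be
  a whole class. This takes both injectivity and surjectivity of the group elements.\<close>

lemma jact_jp:
  assumes g: "g \<in> carrier G" and xyt: "x \<in> topspace X" "y \<in> topspace Y" "0 \<le> t" "t \<le> 1"
  shows "jact g (jp (x, y, t)) = jp (\<phi> g x, \<psi> g y, t)"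
proof -
  interpret A: group_action G "topspace X" \<phi> using faX by (simp add: free_action_def)
  interpret B: group_action G "topspace Y" \<psi> using faY by (simp add: free_action_def)
  have inj: "\<phi> g x' = \<phi> g x \<longleftrightarrow> x' = x" if "x' \<in> topspace X" for x'
    using A.inj_prop[OF g] that xyt(1) by (auto dest: inj_onD)
  have inj': "\<psi> g y' = \<psi> g y \<longleftrightarrow> y' = y" if "y' \<in> topspace Y" for y'
    using B.inj_prop[OF g] that xyt(2) by (auto dest: inj_onD)
  have "(\<lambda>(x, y, t). (\<phi> g x, \<psi> g y, t)) ` jp (x, y, t) = jp (\<phi> g x, \<psi> g y, t)"
  proof (intro equalityI subsetI)
    fix u assume "u \<in> (\<lambda>(x, y, t). (\<phi> g x, \<psi> g y, t)) ` jp (x, y, t)"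
    then show "u \<in> jp (\<phi> g x, \<psi> g y, t)"
      using action_mem[OF g] by (auto simp: join_point_def)
  next
    fix u assume u: "u \<in> jp (\<phi> g x, \<psi> g y, t)"
    obtain x1 y1 t1 where u1: "u = (x1, y1, t1)" by (cases u) auto
    have m: "x1 \<in> topspace X" "y1 \<in> topspace Y" "t1 = t"
      and c: "t = 0 \<and> x1 = \<phi> g x \<or> t = 1 \<and> y1 = \<psi> g y \<or> x1 = \<phi> g x \<and> y1 = \<psi> g y"
      using u unfolding u1 by (auto simp: join_point_def)
    obtain x2 y2 where xy2: "x2 \<in> topspace X" "x1 = \<phi> g x2" "y2 \<in> topspace Y" "y1 = \<psi> g y2"
      using m action_surj[OF g] by blast
    have "(x2, y2, t) \<in> jp (x, y, t)"
      using c xy2 inj[OF xy2(1)] inj'[OF xy2(3)] by (auto simp: join_point_def)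
    then show "u \<in> (\<lambda>(x, y, t). (\<phi> g x, \<psi> g y, t)) ` jp (x, y, t)"
      unfolding u1 m(3) xy2(2,4) by (rule rev_image_eqI) simp
  qed
  then show ?thesis using jp_mem[OF xyt] by (simp add: join_action_def)
qed

lemma jact_continuous:
  assumes g: "g \<in> carrier G"
  shows "continuous_map J J (jact g)"
proof (rule continuous_compose_quotient_map[OF jp_quotient])
  have c: "continuous_map X X (\<phi> g)" "continuous_map Y Y (\<psi> g)"
    using faX faY g by (auto simp: free_action_def)
  have "continuous_map DJ DJ (\<lambda>(x, y, t). (\<phi> g x, \<psi> g y, t))"
  proof -
    have 1: "continuous_map DJ X (\<lambda>d. \<phi> g (fst d))"
      using continuous_map_compose[OF continuous_map_fst c(1)] by (simp add: o_def)
    have 2: "continuous_map DJ Y (\<lambda>d. \<psi> g (fst (snd d)))"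
      using continuous_map_compose[OF continuous_map_compose[OF continuous_map_snd continuous_map_fst] c(2)]
      by (simp add: o_def)
    have 3: "continuous_map DJ (top_of_set {0..1}) (\<lambda>d. snd (snd d))"
      using continuous_map_compose[OF continuous_map_snd continuous_map_snd] by (simp add: o_def)
    show ?thesis using 1 2 3
      by (simp add: case_prod_beta' continuous_map_pairedI)
  qed
  from continuous_map_compose[OF this quotient_imp_continuous_map[OF jp_quotient]]
  show "continuous_map DJ J (jact g \<circ> jp)"
    by (rule continuous_map_eq) (auto simp: jact_jp[OF g])
qed

lemma jact_comp:
  assumes g: "g \<in> carrier G" and h: "h \<in> carrier G" and C: "C \<in> topspace J"
  shows "jact (g \<otimes>\<^bsub>G\<^esub> h) C = jact g (jact h C)"
proof -
  obtain x y t where c: "x \<in> topspace X" "y \<in> topspace Y" "0 \<le> t" "t \<le> 1" "C = jp (x, y, t)"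
    by (rule J_cases[OF C])
  have gh: "g \<otimes>\<^bsub>G\<^esub> h \<in> carrier G"
    by (rule monoid.m_closed[OF group.is_monoid[OF group_integer_mod_group] g h])
  have "\<phi> (g \<otimes>\<^bsub>G\<^esub> h) x = \<phi> g (\<phi> h x)" "\<psi> (g \<otimes>\<^bsub>G\<^esub> h) y = \<psi> g (\<psi> h y)"
    using free_action_compose[OF faX g h c(1)] free_action_compose[OF faY g h c(2)] by simp_all
  then show ?thesis
    using jact_jp[OF gh c(1-4)] jact_jp[OF h c(1-4)] jact_jp[OF g action_mem(1)[OF h c(1)] action_mem(2)[OF h c(2)] c(3,4)]
    by (simp add: c(5))
qed

lemma jact_0: "C \<in> topspace J \<Longrightarrow> jact 0 C = C"
proof -
  assume C: "C \<in> topspace J"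
  obtain x y t where c: "x \<in> topspace X" "y \<in> topspace Y" "0 \<le> t" "t \<le> 1" "C = jp (x, y, t)"
    by (rule J_cases[OF C])
  have "0 \<in> carrier G" by simp
  from jact_jp[OF this c(1-4)] show ?thesis
    using free_action_0[OF faX c(1)] free_action_0[OF faY c(2)] by (simp add: c(5))
qed

lemma jact_mem: "g \<in> carrier G \<Longrightarrow> C \<in> topspace J \<Longrightarrow> jact g C \<in> topspace J"
  using jact_continuous by (auto simp: continuous_map_def)

lemma free_action_join: "free_action G J jact"
proof -
  have gr: "group G" by simp
  have bij: "jact g \<in> Bij (topspace J)" if g: "g \<in> carrier G" for g
  proof -
    have ig: "inv\<^bsub>G\<^esub> g \<in> carrier G" by (rule group.inv_closed[OF gr g])
    have "bij_betw (jact g) (topspace J) (topspace J)"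
    proof (rule bij_betw_byWitness[where f' = "jact (inv\<^bsub>G\<^esub> g)"])
      show "\<forall>a\<in>topspace J. jact (inv\<^bsub>G\<^esub> g) (jact g a) = a"
        using jact_comp[OF ig g] jact_0 group.l_inv[OF gr g] by (metis one_integer_mod_group)
      show "\<forall>a\<in>topspace J. jact g (jact (inv\<^bsub>G\<^esub> g) a) = a"
        using jact_comp[OF g ig] jact_0 group.r_inv[OF gr g] by (metis one_integer_mod_group)
    qed (use jact_mem g ig in auto)
    then show ?thesis by (simp add: Bij_def join_action_def)
  qed
  have "group_hom G (BijGroup (topspace J)) jact"
  proof (rule group_hom.intro)
    show "group_hom_axioms G (BijGroup (topspace J)) jact"
    proof (rule group_hom_axioms.intro, rule homI)
      show "jact x \<in> carrier (BijGroup (topspace J))" if "x \<in> carrier G" for x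
        using bij[OF that] by (simp add: BijGroup_def)
    next
      fix g h assume gh: "g \<in> carrier G" "h \<in> carrier G"
      have "jact (g \<otimes>\<^bsub>G\<^esub> h) = compose (topspace J) (jact g) (jact h)"
      proof
        fix C show "jact (g \<otimes>\<^bsub>G\<^esub> h) C = compose (topspace J) (jact g) (jact h) C"
          using jact_comp[OF gh, of C] by (cases "C \<in> topspace J") (simp_all add: compose_def join_action_def)
      qed
      then show "jact (g \<otimes>\<^bsub>G\<^esub> h) = jact g \<otimes>\<^bsub>BijGroup (topspace J)\<^esub> jact h"
        using bij[OF gh(1)] bij[OF gh(2)] by (simp add: BijGroup_def)
    qed
  qed (simp_all add: group_BijGroup)
  moreover have "jact g C \<noteq> C" if g: "g \<in> carrier G - {\<one>\<^bsub>G\<^esub>}" and C: "C \<in> topspace J" for g C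
  proof -
    obtain x y t where c: "x \<in> topspace X" "y \<in> topspace Y" "0 \<le> t" "t \<le> 1" "C = jp (x, y, t)"
      by (rule J_cases[OF C])
    have g': "g \<in> carrier G" using g by simp
    have "\<phi> g x \<noteq> x" "\<psi> g y \<noteq> y" using faX faY g c by (auto simp: free_action_def)
    then show ?thesis
      using jact_jp[OF g' c(1-4)] jp_eq[OF action_mem(1)[OF g' c(1)] action_mem(2)[OF g' c(2)]]
      by (auto simp: c(5))
  qed
  ultimately show ?thesis
    using jact_continuous by (simp add: free_action_def group_action_def)
qed

sublocale J: free_cyclic p J "jact 1" by (rule free_action_free_cyclic[OF prime_p free_action_join])

lemma one_carrier: "1 \<in> carrier G"
  using prime_gt_1_nat[OF prime_p] by (simp add: carrier_integer_mod_group)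

text \<open>The universal property of the quotient; identifications occur only at the two ends
  \<open>t = 0\<close> and \<open>t = 1\<close>.\<close>

lemma continuous_map_from_join:
  assumes F: "continuous_map DJ W F"
    and "\<And>x y y'. x \<in> topspace X \<Longrightarrow> y \<in> topspace Y \<Longrightarrow> y' \<in> topspace Y \<Longrightarrow> F (x, y, 0) = F (x, y', 0)"
    and "\<And>x x' y. x \<in> topspace X \<Longrightarrow> x' \<in> topspace X \<Longrightarrow> y \<in> topspace Y \<Longrightarrow> F (x, y, 1) = F (x', y, 1)"
  obtains f where "continuous_map J W f"
    "\<And>x y t. x \<in> topspace X \<Longrightarrow> y \<in> topspace Y \<Longrightarrow> 0 \<le> t \<Longrightarrow> t \<le> 1 \<Longrightarrow> f (jp (x, y, t)) = F (x, y, t)"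
proof
  let ?f = "\<lambda>C. F (SOME d. d \<in> C)"
  show fj: "?f (jp (x, y, t)) = F (x, y, t)"
    if xyt: "x \<in> topspace X" "y \<in> topspace Y" "0 \<le> t" "t \<le> 1" for x y t
  proof -
    have "(x, y, t) \<in> jp (x, y, t)" using xyt by (simp add: join_point_def)
    then have "(SOME d. d \<in> jp (x, y, t)) \<in> jp (x, y, t)" by (rule someI)
    moreover have "F d = F (x, y, t)" if "d \<in> jp (x, y, t)" for d
      using that xyt assms(2)[of x] assms(3)[of _ x y] by (cases d) (auto simp: join_point_def)
    ultimately show ?thesis by blast
  qed
  show "continuous_map J W ?f"
    by (rule continuous_compose_quotient_map[OF jp_quotient], rule continuous_map_eq[OF F])
       (auto simp: fj)
qed

lemma DJ_parameter: "continuous_map DJ euclideanreal (\<lambda>d. snd (snd d))"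
proof (rule continuous_map_into_fulltopology)
  show "continuous_map DJ (top_of_set {0..1}) (\<lambda>d. snd (snd d))"
    using continuous_map_compose[OF continuous_map_snd continuous_map_snd] by (simp add: o_def)
qed

text \<open>Interleave coordinates: \<open>(1 - t) fX\<close> at even indices and
  \<open>t fY\<close> at odd ones. One of the weights is always non-zero, and a weight 0 erases
  exactly the point that the join forgets.\<close>

lemma join_equivariant_EG:
  assumes fX: "equivariant_map G X \<phi> EG_space (EG_act p) fX"
    and fY: "equivariant_map G Y \<psi> EG_space (EG_act p) fY"
  obtains f where "equivariant_map G J jact EG_space (EG_act p) f"
proof -
  define F where "F = (\<lambda>(x, y, t). \<lambda>n. if even n then complex_of_real (1 - t) * fX x (n div 2)
     else complex_of_real t * fY y (n div 2))"
  have cX: "continuous_map X EG_space fX" and cY: "continuous_map Y EG_space fY"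
    using fX fY by (auto simp: equivariant_map_def)
  have EGc: "continuous_map EG_space euclidean (\<lambda>w. w n)" for n
    unfolding EG_space_def
    by (simp add: continuous_on_product_then_coordinatewise[OF continuous_on_id])
  have tcc: "continuous_map DJ euclidean (\<lambda>d. complex_of_real (snd (snd d)))"
    using continuous_map_compose[OF DJ_parameter, of euclidean complex_of_real] by (simp add: o_def continuous_on_of_real)
  have xc: "continuous_map DJ euclidean (\<lambda>d. fX (fst d) n)" for n
    using continuous_map_compose[OF continuous_map_compose[OF continuous_map_fst cX] EGc] by (simp add: o_def)
  have yc: "continuous_map DJ euclidean (\<lambda>d. fY (fst (snd d)) n)" for n
    using continuous_map_compose[OF continuous_map_compose[OF continuous_map_compose[OF continuous_map_snd continuous_map_fst] cY] EGc]
    by (simp add: o_def)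
  have Fn: "continuous_map DJ euclidean (\<lambda>d. F d n)" for n
  proof (cases "even n")
    case True
    have "continuous_map DJ euclidean (\<lambda>d. 1 - complex_of_real (snd (snd d)))"
      using continuous_map_compose[OF tcc, of euclidean "\<lambda>z. 1 - z"]
      by (simp add: o_def continuous_on_diff)
    from continuous_map_complex_mult[OF this xc]
    have "continuous_map DJ euclidean (\<lambda>d. (1 - complex_of_real (snd (snd d))) * fX (fst d) (n div 2))" .
    then show ?thesis using True by (simp add: F_def case_prod_beta)
  next
    case False
    have "continuous_map DJ euclidean (\<lambda>d. complex_of_real (snd (snd d)) * fY (fst (snd d)) (n div 2))"
      by (rule continuous_map_complex_mult[OF tcc yc])
    then show ?thesis using False by (simp add: F_def case_prod_beta)
  qed
  have nz: "F d \<noteq> (\<lambda>_. 0)" if d: "d \<in> topspace DJ" for d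
  proof -
    obtain x y t where xyt: "d = (x, y, t)" "x \<in> topspace X" "y \<in> topspace Y" "0 \<le> t" "t \<le> 1"
      using d by (cases d) auto
    have "fX x \<in> topspace EG_space" "fY y \<in> topspace EG_space"
      using cX cY xyt by (auto simp: continuous_map_def)
    then obtain n n' where n: "fX x n \<noteq> 0" "fY y n' \<noteq> 0"
      by (auto simp: EG_space_def fun_eq_iff)
    have "F d (2 * n) \<noteq> 0 \<or> F d (Suc (2 * n')) \<noteq> 0"
      using n xyt by (cases "t = 0") (auto simp: F_def)
    then show ?thesis by auto
  qed
  have "continuous_map DJ euclidean F"
    using Fn unfolding euclidean_product_topology[symmetric] continuous_map_componentwise_UNIV by blast
  then have F: "continuous_map DJ EG_space F"
    using nz unfolding EG_space_def by (auto simp: continuous_map_in_subtopology)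
  have F0: "F (x, y, 0) = F (x, y', 0)" and F1: "F (x, y, 1) = F (x', y, 1)" for x x' y y'
    by (simp_all add: F_def fun_eq_iff)
  obtain f where f: "continuous_map J EG_space f"
    "\<And>x y t. x \<in> topspace X \<Longrightarrow> y \<in> topspace Y \<Longrightarrow> 0 \<le> t \<Longrightarrow> t \<le> 1 \<Longrightarrow> f (jp (x, y, t)) = F (x, y, t)"
    using continuous_map_from_join[OF F F0 F1] by blast
  have "f (jact g C) = EG_act p g (f C)" if g: "g \<in> carrier G" and C: "C \<in> topspace J" for g C
  proof -
    obtain x y t where c: "x \<in> topspace X" "y \<in> topspace Y" "0 \<le> t" "t \<le> 1" "C = jp (x, y, t)"
      by (rule J_cases[OF C])
    have e: "fX (\<phi> g x) = EG_act p g (fX x)" "fY (\<psi> g y) = EG_act p g (fY y)"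
      using fX fY g c by (auto simp: equivariant_map_def)
    have m: "fX x \<in> topspace EG_space" "fY y \<in> topspace EG_space" "F (x, y, t) \<in> topspace EG_space"
      using cX cY F c by (auto simp: continuous_map_def)
    have "f (jact g C) = F (\<phi> g x, \<psi> g y, t)"
      using jact_jp[OF g c(1-4)] f(2)[OF action_mem(1)[OF g c(1)] action_mem(2)[OF g c(2)] c(3,4)] by (simp add: c(5))
    also have "\<dots> = EG_act p g (F (x, y, t))"
      using m by (auto simp: F_def e EG_act_def fun_eq_iff)
    finally show ?thesis using f(2)[OF c(1-4)] by (simp add: c(5))
  qed
  then have "equivariant_map G J jact EG_space (EG_act p) f"
    using f(1) by (simp add: equivariant_map_def)
  then show thesis by (rule that)
qed

lemma join_parameter:
  obtains \<theta> where "continuous_map J euclideanreal \<theta>"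
    "\<And>x y t. x \<in> topspace X \<Longrightarrow> y \<in> topspace Y \<Longrightarrow> 0 \<le> t \<Longrightarrow> t \<le> 1 \<Longrightarrow> \<theta> (jp (x, y, t)) = t"
proof -
  show thesis by (rule continuous_map_from_join[OF DJ_parameter]) (use that in auto)
qed

text \<open>By naturality an equivariant map from an invariant open part of the join transports the
  vanishing of the class. \<open>r\<close> lives on the product, since restricting a quotient map to
  the preimage of an open set gives a quotient map again.\<close>

lemma join_project:
  assumes W: "openin J W" and inv: "\<And>C. C \<in> W \<Longrightarrow> jact 1 C \<in> W"
    and r: "continuous_map (subtopology DJ {d \<in> topspace DJ. jp d \<in> W}) R r"
    and wd: "\<And>d d'. d \<in> topspace DJ \<Longrightarrow> d' \<in> topspace DJ \<Longrightarrow> jp d \<in> W \<Longrightarrow> jp d = jp d' \<Longrightarrow> r d = r d'"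
    and R: "free_cyclic p R S"
    and eqv: "\<And>x y t. x \<in> topspace X \<Longrightarrow> y \<in> topspace Y \<Longrightarrow> r (\<phi> 1 x, \<psi> 1 y, t) = S (r (x, y, t))"
    and v: "J.ZZ v" and w: "zigzag p R S w" and null: "cnull p R S k (nm p S k (w k))"
  shows "cnull p (subtopology J W) (jact 1) k (nm p (jact 1) k (v k))"
proof -
  interpret W: free_cyclic p "subtopology J W" "jact 1" by (rule J.sub_free_cyclic[OF inv])
  let ?U = "{d \<in> topspace DJ. jp d \<in> W}"
  have q: "quotient_map (subtopology DJ ?U) (subtopology J W) jp"
    by (rule quotient_map_restriction[OF jp_quotient]) (use W in auto)
  define f where "f C = r (SOME d. d \<in> topspace DJ \<and> jp d = C)" for C
  have fj: "f (jp d) = r d" if "d \<in> ?U" for d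
  proof -
    have "(SOME d'. d' \<in> topspace DJ \<and> jp d' = jp d) \<in> topspace DJ \<and> jp (SOME d'. d' \<in> topspace DJ \<and> jp d' = jp d) = jp d"
      by (rule someI[of _ d]) (use that in simp)
    then show ?thesis unfolding f_def using wd[of d] that by (metis (no_types, lifting) mem_Collect_eq)
  qed
  have "continuous_map (subtopology J W) R f"
    by (rule continuous_compose_quotient_map[OF q], rule continuous_map_eq[OF r])
       (simp add: fj del: topspace_prod_topology)
  moreover have "f (jact 1 C) = S (f C)" if "C \<in> topspace (subtopology J W)" for C
  proof -
    have C: "C \<in> topspace J" "C \<in> W" using that by auto
    obtain x y t where c: "x \<in> topspace X" "y \<in> topspace Y" "0 \<le> t" "t \<le> 1" "C = jp (x, y, t)"
      by (rule J_cases[OF C(1)])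
    have m: "(x, y, t) \<in> topspace DJ" "(\<phi> 1 x, \<psi> 1 y, t) \<in> topspace DJ"
      using c action_mem[OF one_carrier] by auto
    have j: "jact 1 C = jp (\<phi> 1 x, \<psi> 1 y, t)" using jact_jp[OF one_carrier c(1-4)] by (simp add: c(5))
    have "f (jact 1 C) = r (\<phi> 1 x, \<psi> 1 y, t)" unfolding j using fj m(2) inv[OF C(2)] j by simp
    moreover have "f C = r (x, y, t)" using fj[of "(x, y, t)"] m(1) C(2) c(5) by simp
    ultimately show ?thesis using eqv[OF c(1,2)] by simp
  qed
  ultimately have "equivariant_pair p (subtopology J W) (jact 1) R S f"
    by (intro equivariant_pair.intro W.free_cyclic_axioms R equivariant_pair_axioms.intro)
  then interpret E: equivariant_pair p "subtopology J W" "jact 1" R S f .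
  from cnull_cong[OF nul_sym[OF E.pb_nrm] E.pb_cnull[OF null]]
  have "cnull p (subtopology J W) (jact 1) k (nm p (jact 1) k (pb k f (w k)))" .
  from cnull_add[OF W.zigzag_unique[OF J.sub_zigzag[OF v] E.pb_zigzag[OF w]] this]
  show ?thesis by simp
qed

lemma join_upper:
  assumes v: "J.ZZ v" and vX: "X.ZZ vX" and vY: "Y.ZZ vY"
    and nX: "X.CN (2 * a) (X.nrm (2 * a) (vX (2 * a)))" and nY: "Y.CN l (Y.nrm l (vY l))"
  shows "J.CN (2 * a + l) (J.nrm (2 * a + l) (v (2 * a + l)))"
proof -
  obtain \<theta> where \<theta>: "continuous_map J euclideanreal \<theta>"
    "\<And>x y t. x \<in> topspace X \<Longrightarrow> y \<in> topspace Y \<Longrightarrow> 0 \<le> t \<Longrightarrow> t \<le> 1 \<Longrightarrow> \<theta> (jp (x, y, t)) = t"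
    using join_parameter by blast
  have \<theta>T: "\<theta> (jact 1 C) = \<theta> C" if C: "C \<in> topspace J" for C
  proof -
    obtain x y t where c: "x \<in> topspace X" "y \<in> topspace Y" "0 \<le> t" "t \<le> 1" "C = jp (x, y, t)"
      by (rule J_cases[OF C])
    then show ?thesis using jact_jp[OF one_carrier c(1-4)] \<theta>(2) action_mem[OF one_carrier] by simp
  qed
  \<comment> \<open>The coordinate in \<open>X\<close> is well defined away from
    \<open>t = 1\<close>, the one in \<open>Y\<close> away from \<open>t = 0\<close>.\<close>
  let ?A = "{C \<in> topspace J. \<theta> C \<in> {..<1}}" and ?B = "{C \<in> topspace J. \<theta> C \<in> {0<..}}"
  have oA: "openin J ?A" and oB: "openin J ?B"
    by (rule openin_continuous_map_preimage[OF \<theta>(1)]; simp)+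
  have cov: "topspace J \<subseteq> ?A \<union> ?B" by auto
  have TA: "jact 1 C \<in> ?A" if "C \<in> ?A" for C using that \<theta>T jact_mem[OF one_carrier] by auto
  have TB: "jact 1 C \<in> ?B" if "C \<in> ?B" for C using that \<theta>T jact_mem[OF one_carrier] by auto
  have cA: "cnull p (subtopology J ?A) (jact 1) (2 * a) (nm p (jact 1) (2 * a) (v (2 * a)))"
  proof (rule join_project[OF oA TA _ _ X.free_cyclic_axioms _ v vX nX, where r = fst])
    show "continuous_map (subtopology DJ {d \<in> topspace DJ. jp d \<in> ?A}) X fst"
      by (rule continuous_map_from_subtopology[OF continuous_map_fst])
    fix d d' assume d: "d \<in> topspace DJ" "d' \<in> topspace DJ" "jp d \<in> ?A" "jp d = jp d'"
    obtain x y t x' y' t' where e: "d = (x, y, t)" "d' = (x', y', t')" by (cases d, cases d') auto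
    have m: "x \<in> topspace X" "y \<in> topspace Y" "0 \<le> t" "t \<le> 1" using d(1) e by auto
    have "t < 1" using d(3) \<theta>(2)[OF m] e(1) by simp
    then show "fst d = fst d'" using d(4) jp_eq[OF m(1,2), of t x' y' t'] unfolding e by auto
  qed auto
  have cB: "cnull p (subtopology J ?B) (jact 1) l (nm p (jact 1) l (v l))"
  proof (rule join_project[OF oB TB _ _ Y.free_cyclic_axioms _ v vY nY, where r = "\<lambda>d. fst (snd d)"])
    show "continuous_map (subtopology DJ {d \<in> topspace DJ. jp d \<in> ?B}) Y (\<lambda>d. fst (snd d))"
      using continuous_map_from_subtopology[OF continuous_map_compose[OF continuous_map_snd continuous_map_fst]]
      by (simp add: o_def)
    fix d d' assume d: "d \<in> topspace DJ" "d' \<in> topspace DJ" "jp d \<in> ?B" "jp d = jp d'"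
    obtain x y t x' y' t' where e: "d = (x, y, t)" "d' = (x', y', t')" by (cases d, cases d') auto
    have m: "x \<in> topspace X" "y \<in> topspace Y" "0 \<le> t" "t \<le> 1" using d(1) e by auto
    have "0 < t" using d(3) \<theta>(2)[OF m] e(1) by simp
    then show "fst (snd d) = fst (snd d')" using d(4) jp_eq[OF m(1,2), of t x' y' t'] unfolding e by auto
  qed auto
  show ?thesis by (rule J.zigzag_union[OF v oA oB cov TA TB cA cB])
qed

end

section \<open>Joins of simplices\<close>

text \<open>The point \<open>(1 - t) a + t b\<close> of the join of two standard simplices, in
  barycentric coordinates of the simplex of dimension \<open>k + n + 1\<close>: coordinates
  \<open>0..k\<close> belong to \<open>a\<close>, the others to \<open>b\<close>.\<close>

definition jmap :: "nat \<Rightarrow> (nat \<Rightarrow> real) \<times> (nat \<Rightarrow> real) \<times> real \<Rightarrow> nat \<Rightarrow> real" where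
  "jmap k = (\<lambda>(a, b, t) i. if i \<le> k then (1 - t) * a i else t * b (i - Suc k))"

definition jdom :: "nat \<Rightarrow> nat \<Rightarrow> ((nat \<Rightarrow> real) \<times> (nat \<Rightarrow> real) \<times> real) set" where
  "jdom k n = standard_simplex k \<times> standard_simplex n \<times> {0..1}"

lemma jdom_iff: "(a, b, t) \<in> jdom k n \<longleftrightarrow> a \<in> standard_simplex k \<and> b \<in> standard_simplex n \<and> 0 \<le> t \<and> t \<le> 1"
  by (auto simp: jdom_def)

lemma sum_split_simplex:
  fixes f :: "nat \<Rightarrow> real"
  shows "(\<Sum>i\<le>Suc (k + n). f i) = (\<Sum>i\<le>k. f i) + (\<Sum>j\<le>n. f (Suc (k + j)))"
proof -
  have "(\<Sum>i\<le>Suc (k + n). f i) = (\<Sum>i\<le>k. f i) + (\<Sum>i=Suc k..Suc (k + n). f i)"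
    using sum_up_index_split[of f k "Suc n"] by (simp only: add_Suc_right)
  also have "(\<Sum>i=Suc k..Suc (k + n). f i) = (\<Sum>j=0..n. f (j + Suc k))"
    using sum.shift_bounds_cl_nat_ivl[of f 0 "Suc k" n] by (simp add: add.commute)
  finally show ?thesis by (simp add: atMost_atLeast0 add.commute)
qed

lemma sum_jmap_low: "a \<in> standard_simplex k \<Longrightarrow> (\<Sum>i\<le>k. jmap k (a, b, t) i) = 1 - t"
  by (simp add: jmap_def sum_distrib_left[symmetric] standard_simplex_def)

lemma jmap_mem:
  assumes "(a, b, t) \<in> jdom k n"
  shows "jmap k (a, b, t) \<in> standard_simplex (Suc (k + n))"
proof -
  have a: "a \<in> standard_simplex k" and b: "b \<in> standard_simplex n" and t: "0 \<le> t" "t \<le> 1"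
    using assms by (auto simp: jdom_iff)
  have "(\<Sum>j\<le>n. jmap k (a, b, t) (Suc (k + j))) = t"
    using b by (simp add: jmap_def sum_distrib_left[symmetric] standard_simplex_def)
  then have "(\<Sum>i\<le>Suc (k + n). jmap k (a, b, t) i) = 1"
    unfolding sum_split_simplex using sum_jmap_low[OF a] by simp
  moreover have "0 \<le> jmap k (a, b, t) i \<and> jmap k (a, b, t) i \<le> 1" for i
    using a b t by (auto simp: jmap_def standard_simplex_def intro: mult_le_one)
  moreover have "jmap k (a, b, t) i = 0" if "i > Suc (k + n)" for i
    using b that by (auto simp: jmap_def standard_simplex_def)
  ultimately show ?thesis unfolding standard_simplex_def by blast
qed

lemma jmap_inj:
  assumes d: "(a, b, t) \<in> jdom k n" and d': "(a', b', t') \<in> jdom k n" and e: "jmap k (a, b, t) = jmap k (a', b', t')"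
  shows "t = t'" "t \<noteq> 1 \<Longrightarrow> a = a'" "t \<noteq> 0 \<Longrightarrow> b = b'"
proof -
  have a: "a \<in> standard_simplex k" "a' \<in> standard_simplex k" using d d' by (auto simp: jdom_iff)
  show t: "t = t'" using sum_jmap_low[OF a(1), of b t] sum_jmap_low[OF a(2), of b' t'] e by simp
  show "a = a'" if "t \<noteq> 1"
  proof
    fix i show "a i = a' i"
    proof (cases "i \<le> k")
      case True
      then have "(1 - t) * a i = (1 - t) * a' i" using fun_cong[OF e, of i] t by (simp add: jmap_def)
      then show ?thesis using that by simp
    next
      case False
      then show ?thesis using a by (simp add: standard_simplex_def)
    qed
  qed
  show "b = b'" if "t \<noteq> 0"
  proof
    fix j
    have "t * b j = t * b' j" using fun_cong[OF e, of "Suc (k + j)"] t by (simp add: jmap_def)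
    then show "b j = b' j" using that by simp
  qed
qed

text \<open>Rescaling to total mass one; for \<open>u = 0\<close> all coordinates vanish and any
  vertex serves.\<close>

lemma normalize_in_simplex:
  fixes f :: "nat \<Rightarrow> real"
  assumes "\<And>i. 0 \<le> f i" "\<And>i. i > k \<Longrightarrow> f i = 0" and u: "(\<Sum>i\<le>k. f i) = u"
  obtains a where "a \<in> standard_simplex k" "\<And>i. u * a i = f i"
proof (cases "u = 0")
  case True
  have "f i = 0" for i
  proof (cases "i \<le> k")
    case True
    then show ?thesis using u \<open>u = 0\<close> sum_nonneg_eq_0_iff[of "{..k}" f] assms(1) by auto
  qed (use assms in auto)
  then show ?thesis using that[of "\<lambda>j. if j = 0 then 1 else 0"] True by simp
next
  case False
  have "u > 0" using False u sum_nonneg[of "{..k}" f] assms(1) by fastforce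
  have "f i \<le> u" for i
  proof (cases "i \<le> k")
    case True
    then show ?thesis using member_le_sum[of i "{..k}" f] assms(1) u by auto
  qed (use assms \<open>u > 0\<close> in auto)
  then have "(\<lambda>i. f i / u) \<in> standard_simplex k"
    using assms \<open>u > 0\<close> by (auto simp: standard_simplex_def sum_divide_distrib[symmetric])
  then show ?thesis using that[of "\<lambda>i. f i / u"] False by simp
qed

lemma jmap_surj:
  assumes s: "s \<in> standard_simplex (Suc (k + n))"
  obtains a b t where "(a, b, t) \<in> jdom k n" "jmap k (a, b, t) = s"
proof -
  define u where "u = (\<Sum>i\<le>k. s i)"
  have nn: "0 \<le> s i" "i > Suc (k + n) \<Longrightarrow> s i = 0" for i using s by (auto simp: standard_simplex_def)
  have 1: "(\<Sum>i\<le>k. if i \<le> k then s i else 0) = u" by (simp add: u_def)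
  obtain a where a: "a \<in> standard_simplex k" "\<And>i. u * a i = (if i \<le> k then s i else 0)"
    by (rule normalize_in_simplex[of "\<lambda>i. if i \<le> k then s i else 0" k u]) (use nn 1 in auto)
  have 2: "(\<Sum>j\<le>n. s (Suc (k + j))) = 1 - u"
    using s sum_split_simplex[of s k n] by (simp add: standard_simplex_def u_def)
  obtain b where b: "b \<in> standard_simplex n" "\<And>j. (1 - u) * b j = s (Suc (k + j))"
    by (rule normalize_in_simplex[of "\<lambda>j. s (Suc (k + j))" n "1 - u"]) (use nn 2 in auto)
  have "0 \<le> u" "0 \<le> 1 - u"
    using nn(1) unfolding u_def 2[symmetric, unfolded u_def] by (auto intro: sum_nonneg)
  then have "(a, b, 1 - u) \<in> jdom k n" using a b by (simp add: jdom_iff)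
  moreover have "jmap k (a, b, 1 - u) = s"
  proof
    fix i show "jmap k (a, b, 1 - u) i = s i"
      using a(2)[of i] b(2)[of "i - Suc k"] by (auto simp: jmap_def)
  qed
  ultimately show thesis by (rule that)
qed

lemma continuous_on_jmap: "continuous_on S (jmap k)"
proof (rule continuous_on_coordinatewise_then_product)
  fix i
  have a: "continuous_on S (\<lambda>d. fst d i)" for i :: nat
    and S :: "((nat \<Rightarrow> real) \<times> (nat \<Rightarrow> real) \<times> real) set"
    by (rule continuous_on_product_then_coordinatewise[OF continuous_on_fst[OF continuous_on_id]])
  have b: "continuous_on S (\<lambda>d. fst (snd d) i)" for i :: nat
    and S :: "((nat \<Rightarrow> real) \<times> (nat \<Rightarrow> real) \<times> real) set"
    by (rule continuous_on_product_then_coordinatewise[OF continuous_on_fst[OF continuous_on_snd[OF continuous_on_id]]])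
  have "continuous_on S (\<lambda>d. if i \<le> k then (1 - snd (snd d)) * fst d i else snd (snd d) * fst (snd d) (i - Suc k))"
    by (cases "i \<le> k") (auto intro!: continuous_intros a b)
  then show "continuous_on S (\<lambda>d. jmap k d i)" by (simp add: jmap_def case_prod_beta)
qed

lemma compact_standard_simplex: "compact (standard_simplex n)"
  using compactin_standard_simplex[of n] by (simp add: powertop_real_eq)

text \<open>A continuous surjection from a compact space to a Hausdorff space. Continuity of joined
  simplices can thus be tested in the coordinates \<open>(a, b, t)\<close>.\<close>

lemma jmap_quotient:
  "quotient_map (top_of_set (jdom k n)) (top_of_set (standard_simplex (Suc (k + n)))) (jmap k)"
proof (rule T1_Spaces.continuous_imp_quotient_map)
  have im: "jmap k ` jdom k n = standard_simplex (Suc (k + n))"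
  proof (intro equalityI subsetI)
    fix s assume "s \<in> jmap k ` jdom k n"
    then show "s \<in> standard_simplex (Suc (k + n))" using jmap_mem by (auto simp: jdom_def)
  next
    fix s assume "s \<in> standard_simplex (Suc (k + n))"
    then show "s \<in> jmap k ` jdom k n" by (elim jmap_surj) auto
  qed
  then show "jmap k ` topspace (top_of_set (jdom k n)) = topspace (top_of_set (standard_simplex (Suc (k + n))))"
    by simp
  show "continuous_map (top_of_set (jdom k n)) (top_of_set (standard_simplex (Suc (k + n)))) (jmap k)"
    using continuous_on_jmap im by (auto simp: continuous_map_in_subtopology)
  have "compact (jdom k n)"
    unfolding jdom_def by (intro compact_Times compact_standard_simplex compact_Icc)
  then show "compact_space (top_of_set (jdom k n))" by (simp add: compact_space_subtopology)
  show "Hausdorff_space (top_of_set (standard_simplex (Suc (k + n))))"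
    by (simp add: Hausdorff_space_subtopology)
qed

lemma face_jmap_left:
  "i \<le> Suc k \<Longrightarrow> simplical_face i (jmap k (a, b, t)) = jmap (Suc k) (simplical_face i a, b, t)"
  by (rule ext) (auto simp: simplical_face_def jmap_def)

lemma face_jmap_right:
  "simplical_face (Suc (k + j)) (jmap k (a, b, t)) = jmap k (a, simplical_face j b, t)"
proof
  fix i
  show "simplical_face (Suc (k + j)) (jmap k (a, b, t)) i = jmap k (a, simplical_face j b, t) i"
  proof (cases "i \<le> k")
    case True
    then show ?thesis by (simp add: simplical_face_def jmap_def)
  next
    case False
    then obtain l where "i = Suc (k + l)" by (metis add_Suc less_iff_Suc_add not_le)
    then show ?thesis by (auto simp: simplical_face_def jmap_def)
  qed
qed

lemma face_jmap_0: "simplical_face 0 s = jmap 0 (e, s, 1)"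
  by (rule ext) (auto simp: simplical_face_def jmap_def)

section \<open>Joins of singular simplices and slant products\<close>

context free_join
begin

text \<open>The join of \<open>\<sigma>\<close> and \<open>\<tau>\<close>. The preimage under
  \<open>jmap\<close> is ambiguous only at \<open>t = 0\<close> and \<open>t = 1\<close>, where
  \<open>join_point\<close> forgets exactly the ambiguous coordinate.\<close>

definition sj :: "nat \<Rightarrow> nat \<Rightarrow> ((nat \<Rightarrow> real) \<Rightarrow> 'a) \<Rightarrow> ((nat \<Rightarrow> real) \<Rightarrow> 'b) \<Rightarrow> (nat \<Rightarrow> real) \<Rightarrow> ('a \<times> 'b \<times> real) set" where
  "sj k n \<sigma> \<tau> = (\<lambda>s\<in>standard_simplex (Suc (k + n)).
     (\<lambda>(a, b, t). jp (\<sigma> a, \<tau> b, t)) (SOME d. d \<in> jdom k n \<and> jmap k d = s))"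

lemma sj_jmap:
  assumes d: "(a, b, t) \<in> jdom k n"
  shows "sj k n \<sigma> \<tau> (jmap k (a, b, t)) = jp (\<sigma> a, \<tau> b, t)"
proof -
  let ?d = "SOME d. d \<in> jdom k n \<and> jmap k d = jmap k (a, b, t)"
  obtain a' b' t' where e: "?d = (a', b', t')" by (cases ?d) auto
  have "?d \<in> jdom k n \<and> jmap k ?d = jmap k (a, b, t)"
    by (rule someI[of "\<lambda>d. d \<in> jdom k n \<and> jmap k d = jmap k (a, b, t)" "(a, b, t)"]) (simp add: d)
  then have d': "(a', b', t') \<in> jdom k n" "jmap k (a, b, t) = jmap k (a', b', t')" unfolding e by auto
  note inj = jmap_inj[OF d d']
  have "jp (\<sigma> a', \<tau> b', t') = jp (\<sigma> a, \<tau> b, t)"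
  proof -
    consider "t = 0" | "t = 1" | "t \<noteq> 0" "t \<noteq> 1" by blast
    then show ?thesis
    proof cases
      case 1
      then show ?thesis using inj jp_0[of "\<sigma> a" "\<tau> b'" "\<tau> b"] by simp
    next
      case 2
      then show ?thesis using inj jp_1[of "\<sigma> a'" "\<tau> b" "\<sigma> a"] by simp
    qed (use inj in simp)
  qed
  then show ?thesis using jmap_mem[OF d] e by (simp add: sj_def)
qed

lemma sj_ext_eq:
  assumes "f \<in> extensional (standard_simplex (Suc (k + n)))"
    and "\<And>a b t. (a, b, t) \<in> jdom k n \<Longrightarrow> f (jmap k (a, b, t)) = jp (\<sigma> a, \<tau> b, t)"
  shows "f = sj k n \<sigma> \<tau>"
proof
  fix s show "f s = sj k n \<sigma> \<tau> s"
  proof (cases "s \<in> standard_simplex (Suc (k + n))")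
    case True
    then obtain a b t where "(a, b, t) \<in> jdom k n" "jmap k (a, b, t) = s" by (rule jmap_surj)
    then show ?thesis using assms(2) sj_jmap by metis
  next
    case False
    then show ?thesis using assms(1) by (simp add: sj_def extensional_def)
  qed
qed

lemma sj_simplex:
  assumes \<sigma>: "singular_simplex k X \<sigma>" and \<tau>: "singular_simplex n Y \<tau>"
  shows "singular_simplex (Suc (k + n)) J (sj k n \<sigma> \<tau>)"
proof -
  have cs: "continuous_map (top_of_set (standard_simplex k)) X \<sigma>" "continuous_map (top_of_set (standard_simplex n)) Y \<tau>"
    using \<sigma> \<tau> by (auto simp: singular_simplex_def powertop_real_eq)
  let ?P = "prod_topology (top_of_set (standard_simplex k)) (prod_topology (top_of_set (standard_simplex n)) (top_of_set {0..1::real}))"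
  have P: "?P = top_of_set (jdom k n)" by (simp add: jdom_def)
  have "continuous_map ?P DJ (\<lambda>d. (\<sigma> (fst d), \<tau> (fst (snd d)), snd (snd d)))"
  proof -
    have 1: "continuous_map ?P X (\<lambda>d. \<sigma> (fst d))"
      using continuous_map_compose[OF continuous_map_fst cs(1)] by (simp only: o_def)
    have 2: "continuous_map ?P Y (\<lambda>d. \<tau> (fst (snd d)))"
      using continuous_map_compose[OF continuous_map_compose[OF continuous_map_snd continuous_map_fst] cs(2)]
      by (simp only: o_def)
    have 3: "continuous_map ?P (top_of_set {0..1}) (\<lambda>d. snd (snd d))"
      using continuous_map_compose[OF continuous_map_snd continuous_map_snd] by (simp only: o_def)
    show ?thesis by (intro continuous_map_pairedI 1 2 3)
  qed
  from continuous_map_compose[OF this quotient_imp_continuous_map[OF jp_quotient]]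
  have "continuous_map (top_of_set (jdom k n)) J (jp \<circ> (\<lambda>d. (\<sigma> (fst d), \<tau> (fst (snd d)), snd (snd d))))"
    unfolding P .
  then have "continuous_map (top_of_set (jdom k n)) J (sj k n \<sigma> \<tau> \<circ> jmap k)"
    by (rule continuous_map_eq) (auto simp: sj_jmap)
  from continuous_compose_quotient_map[OF jmap_quotient this]
  have "continuous_map (top_of_set (standard_simplex (Suc (k + n)))) J (sj k n \<sigma> \<tau>)" .
  then show ?thesis by (simp add: singular_simplex_def powertop_real_eq sj_def)
qed

lemma sj_face_left:
  assumes "i \<le> Suc k"
  shows "singular_face (Suc (Suc (k + n))) i (sj (Suc k) n \<sigma> \<tau>) = sj k n (singular_face (Suc k) i \<sigma>) \<tau>"
proof (rule sj_ext_eq)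
  show "singular_face (Suc (Suc (k + n))) i (sj (Suc k) n \<sigma> \<tau>) \<in> extensional (standard_simplex (Suc (k + n)))"
    by (simp add: singular_face_def)
  fix a b t assume d: "(a, b, t) \<in> jdom k n"
  have d': "(simplical_face i a, b, t) \<in> jdom (Suc k) n"
    using d face_mem[OF assms] by (simp add: jdom_iff)
  show "singular_face (Suc (Suc (k + n))) i (sj (Suc k) n \<sigma> \<tau>) (jmap k (a, b, t)) = jp (singular_face (Suc k) i \<sigma> a, \<tau> b, t)"
    using jmap_mem[OF d] d sj_jmap[OF d', of \<sigma> \<tau>] face_jmap_left[OF assms, of a b t]
    by (simp add: singular_face_def jdom_iff)
qed

lemma sj_face_right:
  assumes "j \<le> Suc n"
  shows "singular_face (Suc (Suc (k + n))) (Suc (k + j)) (sj k (Suc n) \<sigma> \<tau>) = sj k n \<sigma> (singular_face (Suc n) j \<tau>)"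
proof (rule sj_ext_eq)
  show "singular_face (Suc (Suc (k + n))) (Suc (k + j)) (sj k (Suc n) \<sigma> \<tau>) \<in> extensional (standard_simplex (Suc (k + n)))"
    by (simp add: singular_face_def)
  fix a b t assume d: "(a, b, t) \<in> jdom k n"
  have d': "(a, simplical_face j b, t) \<in> jdom k (Suc n)"
    using d face_mem[OF assms] by (simp add: jdom_iff)
  show "singular_face (Suc (Suc (k + n))) (Suc (k + j)) (sj k (Suc n) \<sigma> \<tau>) (jmap k (a, b, t)) = jp (\<sigma> a, singular_face (Suc n) j \<tau> b, t)"
    using jmap_mem[OF d] d sj_jmap[OF d', of \<sigma> \<tau>] face_jmap_right[of k j a b t]
    by (simp add: singular_face_def jdom_iff)
qed

text \<open>Removing the only vertex of the left factor leaves \<open>\<tau>\<close> at the end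
  \<open>t = 1\<close>, where the choice of \<open>x0\<close> is immaterial. This face yields the
  augmentation of the sequence on \<open>X\<close>.\<close>

lemma sj_face_0: "singular_face (Suc n) 0 (sj 0 n \<sigma> \<tau>) = simplex_map n (\<lambda>y. jp (x0, y, 1)) \<tau>"
proof
  fix s
  let ?e = "\<lambda>j. if j = 0 then 1 else 0 :: real"
  show "singular_face (Suc n) 0 (sj 0 n \<sigma> \<tau>) s = simplex_map n (\<lambda>y. jp (x0, y, 1)) \<tau> s"
  proof (cases "s \<in> standard_simplex n")
    case True
    then have "(?e, s, 1) \<in> jdom 0 n" by (simp add: jdom_iff)
    from sj_jmap[OF this, of \<sigma> \<tau>] show ?thesis
      using True face_jmap_0[of s ?e] jp_1[of "\<sigma> ?e" "\<tau> s" x0] by (simp add: singular_face_def simplex_map_def)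
  qed (simp add: singular_face_def simplex_map_def)
qed

lemma sj_T:
  assumes \<sigma>: "singular_simplex k X \<sigma>" and \<tau>: "singular_simplex n Y \<tau>"
  shows "simplex_map (Suc (k + n)) (jact 1) (sj k n \<sigma> \<tau>) = sj k n (simplex_map k (\<phi> 1) \<sigma>) (simplex_map n (\<psi> 1) \<tau>)"
proof (rule sj_ext_eq)
  show "simplex_map (Suc (k + n)) (jact 1) (sj k n \<sigma> \<tau>) \<in> extensional (standard_simplex (Suc (k + n)))"
    by (simp add: simplex_map_def)
  fix a b t assume d: "(a, b, t) \<in> jdom k n"
  have m: "\<sigma> a \<in> topspace X" "\<tau> b \<in> topspace Y"
    using \<sigma> \<tau> d by (auto simp: singular_simplex_def continuous_map_def jdom_iff)
  show "simplex_map (Suc (k + n)) (jact 1) (sj k n \<sigma> \<tau>) (jmap k (a, b, t)) =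
      jp (simplex_map k (\<phi> 1) \<sigma> a, simplex_map n (\<psi> 1) \<tau> b, t)"
    using jmap_mem[OF d] sj_jmap[OF d, of \<sigma> \<tau>] jact_jp[OF one_carrier m] d
    by (simp add: simplex_map_def jdom_iff)
qed

text \<open>A slant product: \<open>v\<close> is evaluated on the join of \<open>\<sigma>\<close>
  with the fixed chain \<open>D\<close>, which lowers the degree by \<open>n + 1\<close>.\<close>

definition sl :: "nat \<Rightarrow> 'b chain \<Rightarrow> nat \<Rightarrow> ('a \<times> 'b \<times> real) set cochain \<Rightarrow> 'a cochain" where
  "sl n D k v = (\<lambda>\<sigma>. cev (\<lambda>\<tau>. v (sj k n \<sigma> \<tau>)) D)"

lemma sl_diff: "sl n D k (v - w) = sl n D k v - sl n D k w"
  by (auto simp: sl_def fun_eq_iff cev_diff_fun)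

lemma sl_nul:
  assumes D: "singular_chain n Y D" and v: "J.NL (Suc (k + n)) v"
  shows "X.NL k (sl n D k v)"
  using D v sj_simplex unfolding nul_def sl_def singular_chain_def
  by (auto intro!: cev_dvd)

text \<open>The generator acts on both factors of a join; as \<open>D\<close> is invariant modulo
  \<open>p\<close>, only its action on \<open>\<sigma>\<close> remains visible.\<close>

lemma sl_tw:
  assumes D: "singular_chain n Y D" and inv: "\<And>c. int p dvd cev (pb n (\<psi> 1) c) D - cev c D"
  shows "X.NL k (sl n D k (pb (Suc (k + n)) (jact 1) v) - pb k (\<phi> 1) (sl n D k v))"
  unfolding nul_def
proof (intro allI impI)
  fix \<sigma> assume \<sigma>: "singular_simplex k X \<sigma>"
  define c where "c = (\<lambda>\<tau>. v (sj k n (simplex_map k (\<phi> 1) \<sigma>) \<tau>))"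
  have "sl n D k (pb (Suc (k + n)) (jact 1) v) \<sigma> = cev (pb n (\<psi> 1) c) D"
    unfolding sl_def
  proof (rule cev_cong_keys)
    fix \<tau> assume "\<tau> \<in> Poly_Mapping.keys D"
    then have "singular_simplex n Y \<tau>" using D by (auto simp: singular_chain_def)
    then show "pb (Suc (k + n)) (jact 1) v (sj k n \<sigma> \<tau>) = pb n (\<psi> 1) c \<tau>"
      by (simp add: pb_def c_def sj_T[OF \<sigma>])
  qed
  then show "int p dvd (sl n D k (pb (Suc (k + n)) (jact 1) v) - pb k (\<phi> 1) (sl n D k v)) \<sigma>"
    using inv[of c] by (simp add: sl_def pb_def c_def)
qed

lemma sl_pow:
  assumes D: "singular_chain n Y D" and inv: "\<And>c. int p dvd cev (pb n (\<psi> 1) c) D - cev c D"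
  shows "X.NL k (sl n D k (pb (Suc (k + n)) (jact 1 ^^ j) v) - pb k (\<phi> 1 ^^ j) (sl n D k v))"
proof (induction j arbitrary: v)
  case 0
  have "J.NL (Suc (k + n)) (pb (Suc (k + n)) (jact 1 ^^ 0) v - v)"
    unfolding nul_def pb_def using J.simplex_map_pow_0(1) by simp
  from sl_nul[OF D this] have 1: "X.NL k (sl n D k (pb (Suc (k + n)) (jact 1 ^^ 0) v) - sl n D k v)"
    by (simp only: sl_diff)
  have "X.NL k (sl n D k v - pb k (\<phi> 1 ^^ 0) (sl n D k v))"
    unfolding nul_def pb_def using X.simplex_map_pow_0(1) by simp
  from nul_trans[OF 1 this] show ?case .
next
  case (Suc j)
  have 1: "X.NL k (pb k (\<phi> 1 ^^ j) (sl n D k (pb (Suc (k + n)) (jact 1) v)) - pb k (\<phi> 1 ^^ Suc j) (sl n D k v))"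
    using nul_pb[OF sl_tw[OF D inv, of k v] X.cont_pow[of j]] by (simp only: pb_diff pb_pb funpow.simps)
  have "pb (Suc (k + n)) (jact 1 ^^ Suc j) v = pb (Suc (k + n)) (jact 1 ^^ j) (pb (Suc (k + n)) (jact 1) v)"
    by (simp only: pb_pb funpow.simps)
  then show ?case using nul_trans[OF Suc[of "pb (Suc (k + n)) (jact 1) v"] 1] by (simp only:)
qed

lemma sl_nrm:
  assumes D: "singular_chain n Y D" and inv: "\<And>c. int p dvd cev (pb n (\<psi> 1) c) D - cev c D"
  shows "X.NL k (sl n D k (J.nrm (Suc (k + n)) v) - X.nrm k (sl n D k v))"
  unfolding nul_def
proof (intro allI impI)
  fix \<sigma> assume \<sigma>: "singular_simplex k X \<sigma>"
  have "(sl n D k (J.nrm (Suc (k + n)) v) - X.nrm k (sl n D k v)) \<sigma> =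
    (\<Sum>j<p. (sl n D k (pb (Suc (k + n)) (jact 1 ^^ j) v) - pb k (\<phi> 1 ^^ j) (sl n D k v)) \<sigma>)"
    by (simp add: nm_eq_sum sl_def cev_sum_fun sum_subtractf)
  also have "int p dvd \<dots>"
    using sl_pow[OF D inv, of k _ v] \<sigma> by (intro dvd_sum) (simp add: nul_def)
  finally show "int p dvd (sl n D k (J.nrm (Suc (k + n)) v) - X.nrm k (sl n D k v)) \<sigma>" .
qed

text \<open>The faces of the join come from faces of \<open>\<sigma>\<close> or from faces of
  \<open>D\<close>; the latter sum up to a value on \<open>\<partial> D\<close>, which is a multiple
  of \<open>p\<close>.\<close>

lemma sl_cobd:
  assumes n: "n = Suc n'" and bd: "chain_boundary n D = frag_cmul (int p) E"
  shows "X.NL (Suc k) (sl n D (Suc k) (cobd (Suc (k + n)) v) - cobd k (sl n D k v))"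
  unfolding nul_def
proof (intro allI impI)
  fix \<sigma> assume \<sigma>: "singular_simplex (Suc k) X \<sigma>"
  define F where "F i = (-1) ^ i * cev (\<lambda>\<tau>. v (singular_face (Suc (Suc (k + n))) i (sj (Suc k) n \<sigma> \<tau>))) D" for i
  define c where "c = (\<lambda>\<tau>. v (sj (Suc k) n' \<sigma> \<tau>))"
  have "sl n D (Suc k) (cobd (Suc (k + n)) v) \<sigma> = sum F {..Suc (Suc (k + n))}"
    unfolding sl_def cobd_def F_def by (simp only: cev_sum_fun cev_mult_fun)
  also have "\<dots> = sum F {..Suc k} + sum F {Suc (Suc k)..Suc (Suc (k + n))}"
    using sum_up_index_split[of F "Suc k" "Suc n"] by (simp only: add_Suc_right add_Suc)
  also have "sum F {..Suc k} = cobd k (sl n D k v) \<sigma>"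
    unfolding cobd_def sl_def F_def by (intro sum.cong) (auto simp: sj_face_left)
  also have "sum F {Suc (Suc k)..Suc (Suc (k + n))} = (\<Sum>j\<le>n. F (Suc (Suc k + j)))"
    using sum.shift_bounds_cl_nat_ivl[of F 0 "Suc (Suc k)" n] by (simp add: add.commute atMost_atLeast0)
  also have "\<dots> = (-1) ^ k * cev (cobd n' c) D"
  proof -
    have "F (Suc (Suc k + j)) = (-1) ^ k * ((-1) ^ j * cev (\<lambda>\<tau>. c (singular_face (Suc n') j \<tau>)) D)" if "j \<le> n" for j
    proof -
      have "singular_face (Suc (Suc (k + n))) (Suc (Suc k + j)) (sj (Suc k) n \<sigma> \<tau>) = sj (Suc k) n' \<sigma> (singular_face (Suc n') j \<tau>)" for \<tau>
        using sj_face_right[of j n' "Suc k" \<sigma> \<tau>] that n by simp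
      then show ?thesis by (simp add: F_def c_def power_add)
    qed
    then have "(\<Sum>j\<le>n. F (Suc (Suc k + j))) = (-1) ^ k * (\<Sum>j\<le>n. (-1) ^ j * cev (\<lambda>\<tau>. c (singular_face (Suc n') j \<tau>)) D)"
      unfolding sum_distrib_left by (intro sum.cong) auto
    also have "(\<Sum>j\<le>n. (-1) ^ j * cev (\<lambda>\<tau>. c (singular_face (Suc n') j \<tau>)) D) = cev (cobd n' c) D"
      unfolding n cobd_def by (simp only: cev_sum_fun cev_mult_fun)
    finally show ?thesis .
  qed
  also have "cev (cobd n' c) D = int p * cev c E"
    using cev_chain_boundary[of c n' D] bd n by (simp add: cev_cmul)
  finally show "int p dvd (sl n D (Suc k) (cobd (Suc (k + n)) v) - cobd k (sl n D k v)) \<sigma>"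
    by simp
qed

text \<open>For a vertex \<open>\<sigma>\<close> the face opposite to it is \<open>D\<close> itself
  at \<open>t = 1\<close>, so modulo \<open>p\<close> the value does not depend on
  \<open>\<sigma>\<close>.\<close>

lemma sl_cobd_0:
  assumes n: "n = Suc n'" and bd: "chain_boundary n D = frag_cmul (int p) E"
  shows "int p dvd sl n D 0 (cobd n v) \<sigma> - cev (pb n (\<lambda>y. jp (x0, y, 1)) v) D"
proof -
  define F where "F i = (-1) ^ i * cev (\<lambda>\<tau>. v (singular_face (Suc n) i (sj 0 n \<sigma> \<tau>))) D" for i
  define c where "c = (\<lambda>\<tau>. v (sj 0 n' \<sigma> \<tau>))"
  have "sl n D 0 (cobd n v) \<sigma> = sum F {..Suc n}"
    unfolding sl_def cobd_def F_def by (simp only: cev_sum_fun cev_mult_fun)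
  also have "\<dots> = F 0 + (\<Sum>j\<le>n. F (Suc j))"
    by (rule sum.atMost_Suc_shift)
  also have "F 0 = cev (pb n (\<lambda>y. jp (x0, y, 1)) v) D"
    unfolding F_def sj_face_0[of n \<sigma> _ x0] pb_def by simp
  also have "(\<Sum>j\<le>n. F (Suc j)) = - cev (cobd n' c) D"
  proof -
    have "F (Suc j) = - ((-1) ^ j * cev (\<lambda>\<tau>. c (singular_face (Suc n') j \<tau>)) D)" if "j \<le> n" for j
    proof -
      have "singular_face (Suc n) (Suc j) (sj 0 n \<sigma> \<tau>) = sj 0 n' \<sigma> (singular_face (Suc n') j \<tau>)" for \<tau>
        using sj_face_right[of j n' 0 \<sigma> \<tau>] that n by simp
      then show ?thesis by (simp add: F_def c_def)
    qed
    then have "(\<Sum>j\<le>n. F (Suc j)) = (\<Sum>j\<le>n. - ((-1) ^ j * cev (\<lambda>\<tau>. c (singular_face (Suc n') j \<tau>)) D))"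
      by (intro sum.cong) auto
    also have "\<dots> = - (\<Sum>j\<le>n. (-1) ^ j * cev (\<lambda>\<tau>. c (singular_face (Suc n') j \<tau>)) D)"
      by (rule sum_negf)
    also have "(\<Sum>j\<le>n. (-1) ^ j * cev (\<lambda>\<tau>. c (singular_face (Suc n') j \<tau>)) D) = cev (cobd n' c) D"
      unfolding n cobd_def by (simp only: cev_sum_fun cev_mult_fun)
    finally show ?thesis .
  qed
  also have "cev (cobd n' c) D = int p * cev c E"
    using cev_chain_boundary[of c n' D] bd n by (simp add: cev_cmul)
  finally show ?thesis by simp
qed

end

section \<open>The index of a join\<close>

text \<open>Duality with \<open>B\<close> the chains of the form \<open>(T - 1) e\<close>. A cochain
  killing \<open>B\<close> is an invariant one, so without such a \<open>d\<close> the cochain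
  \<open>g\<close> would be the coboundary of an invariant cochain.\<close>

lemma (in free_cyclic) dual_chain:
  assumes g: "\<not> CN (Suc n) g"
  obtains d e f where "singular_chain (Suc n) Z d" "singular_chain n Z e"
    "chain_boundary (Suc n) d = (chain_map n T e - e) + frag_cmul (int p) f" "\<not> int p dvd cev g d"
proof (rule ccontr)
  assume neg: "\<not> thesis"
  note dual = that
  let ?B = "{chain_map n T e - e | e. singular_chain n Z e}"
  have nodual: "int p dvd cev g d"
    if "singular_chain (Suc n) Z d" "b \<in> ?B" "chain_boundary (Suc n) d = b + frag_cmul (int p) f" for d b f
  proof (rule ccontr)
    assume a: "\<not> int p dvd cev g d"
    obtain e where e: "b = chain_map n T e - e" "singular_chain n Z e" using \<open>b \<in> ?B\<close> by blast
    from dual[OF that(1) e(2) that(3)[unfolded e(1)] a] neg show False by (rule notE[rotated])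
  qed
  have B0: "0 \<in> ?B" by (rule CollectI, rule exI[of _ 0]) simp
  have Bd: "x - y \<in> ?B" if "x \<in> ?B" "y \<in> ?B" for x y
  proof -
    obtain e e' where e: "x = chain_map n T e - e" "y = chain_map n T e' - e'" "singular_chain n Z e" "singular_chain n Z e'"
      using \<open>x \<in> ?B\<close> \<open>y \<in> ?B\<close> by blast
    have "x - y = chain_map n T (e - e') - (e - e')" by (simp add: e chain_map_diff)
    then show ?thesis using singular_chain_diff[OF e(3,4)] by blast
  qed
  obtain \<eta> where \<eta>: "\<And>b. b \<in> ?B \<Longrightarrow> int p dvd cev \<eta> b" "NL (Suc n) (g - cobd n \<eta>)"
    by (rule coboundary_or_dual_chain[where B = ?B and \<gamma> = g and k = n and Z = Z, OF prime_p B0],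
        erule (1) Bd, erule (2) nodual, blast)
  have "NL n (tw n \<eta> - \<eta>)"
    unfolding nul_def
  proof (intro allI impI)
    fix \<tau> assume "singular_simplex n Z \<tau>"
    then have "chain_map n T (frag_of \<tau>) - frag_of \<tau> \<in> ?B" using singular_chain_of by blast
    from \<eta>(1)[OF this] show "int p dvd (tw n \<eta> - \<eta>) \<tau>" by (simp add: cev_diff pb_def)
  qed
  with \<eta>(2) have "CN (Suc n) g" unfolding cnull_def by auto
  with g show False by simp
qed

text \<open>The norm of \<open>(T - 1) e\<close> telescopes to zero by periodicity, which leaves a
  multiple of \<open>p\<close>; in the pairing the norm passes from the chain to the
  cochain.\<close>

lemma (in free_cyclic) norm_chain:
  assumes d: "singular_chain (Suc n) Z d" and e: "singular_chain n Z e"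
    and bd: "chain_boundary (Suc n) d = (chain_map n T e - e) + frag_cmul (int p) f"
  obtains D E where "singular_chain (Suc n) Z D" "chain_boundary (Suc n) D = frag_cmul (int p) E"
    "\<And>c. cev c D = cev (nrm (Suc n) c) d"
proof
  define D where "D = (\<Sum>j<p. chain_map (Suc n) (T ^^ j) d)"
  define E where "E = (\<Sum>j<p. chain_map n (T ^^ j) f)"
  show "singular_chain (Suc n) Z D"
    unfolding D_def by (intro singular_chain_sum singular_chain_chain_map[OF d cont_pow])
  show "cev c D = cev (nrm (Suc n) c) d" for c
    by (simp add: D_def cev_sum cev_chain_map nm_eq_sum cev_sum_fun)
  define F where "F j = chain_map n (T ^^ j) e" for j
  have F0: "F 0 = e" unfolding F_def funpow.simps(1) by (rule chain_map_ident[OF e])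
  have Fp: "F p = e" unfolding F_def by (rule chain_map_id_gen[OF e period])
  have step: "chain_map n (T ^^ j) (chain_map n T e - e) = F (Suc j) - F j" for j
    by (simp add: F_def chain_map_diff funpow_Suc_right chain_map_compose del: funpow.simps)
  have "chain_boundary (Suc n) D = (\<Sum>j<p. chain_map n (T ^^ j) (chain_boundary (Suc n) d))"
    by (simp add: D_def chain_boundary_sum chain_boundary_chain_map[OF d])
  also have "\<dots> = (\<Sum>j<p. F (Suc j) - F j) + (\<Sum>j<p. frag_cmul (int p) (chain_map n (T ^^ j) f))"
    by (simp only: bd chain_map_add step chain_map_cmul sum.distrib)
  also have "(\<Sum>j<p. F (Suc j) - F j) = 0"
    by (simp add: sum_lessThan_telescope F0 Fp)
  finally show "chain_boundary (Suc n) D = frag_cmul (int p) E"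
    by (simp add: E_def frag_cmul_sum)
qed

context free_join
begin

lemma join_lower:
  assumes v: "J.ZZ v" and vX: "X.ZZ vX" and vY: "Y.ZZ vY" and n: "n = Suc n'" "odd n" and m: "m = Suc m'"
    and nY: "\<not> Y.CN n (Y.nrm n (vY n))"
    and nJ: "J.CN (Suc (m + n)) (J.nrm (Suc (m + n)) (v (Suc (m + n))))"
  shows "X.CN m (X.nrm m (vX m))"
proof (cases "topspace X = {}")
  case True
  then show ?thesis by (intro cnull_nul) (simp add: nul_def singular_simplex_empty)
next
  case False
  then obtain x0 where x0: "x0 \<in> topspace X" by blast
  let ?g = "Y.nrm n (vY n)"
  have nY': "\<not> Y.CN (Suc n') ?g" using nY unfolding n(1) .
  obtain d e f where d0: "singular_chain (Suc n') Y d" "singular_chain n' Y e"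
    "chain_boundary (Suc n') d = (chain_map n' (\<psi> 1) e - e) + frag_cmul (int p) f" "\<not> int p dvd cev ?g d"
    by (rule Y.dual_chain[OF nY'])
  obtain D E where D0: "singular_chain (Suc n') Y D" "chain_boundary (Suc n') D = frag_cmul (int p) E"
    "\<And>c. cev c D = cev (Y.nrm (Suc n') c) d"
    by (rule Y.norm_chain[OF d0(1-3)]) (rule that)
  note d = d0[folded n(1)] and D = D0[folded n(1)]
  have inv: "int p dvd cev (pb n (\<psi> 1) c) D - cev c D" for c
    unfolding D(3) cev_diff_fun[symmetric]
    using cev_dvd_nul[OF Y.nrm_tw[of n c] d(1)] by (simp add: fun_diff_def)
  let ?sl = "sl n D"
  \<comment> \<open>\<open>Y\<close> as the end \<open>t = 1\<close> of the join; the pullback of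
    \<open>v\<close> along it is a zigzag on \<open>Y\<close>.\<close>
  define \<iota> where "\<iota> y = jp (x0, y, 1)" for y
  have c\<iota>: "continuous_map Y J \<iota>"
  proof -
    have "continuous_map Y DJ (\<lambda>y. (x0, y, 1))"
      using x0 by (intro continuous_map_pairedI continuous_map_id[unfolded id_def]) auto
    from continuous_map_compose[OF this quotient_imp_continuous_map[OF jp_quotient]]
    show ?thesis by (simp add: o_def \<iota>_def[abs_def])
  qed
  have e\<iota>: "\<iota> (\<psi> 1 y) = jact 1 (\<iota> y)" if "y \<in> topspace Y" for y
    using jact_jp[OF one_carrier x0 that, of 1] jp_1[of "\<phi> 1 x0" "\<psi> 1 y" x0] by (simp add: \<iota>_def)
  interpret I: equivariant_pair p Y "\<psi> 1" J "jact 1" \<iota>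
    by unfold_locales (use c\<iota> e\<iota> in auto)
  define c where "c = cev (pb n \<iota> (v n)) D"
  \<comment> \<open>\<open>c\<close> is the pairing with \<open>d\<close> of the norm of the
    pulled-back \<open>v_n\<close>. That norm differs from \<open>?g\<close> by the coboundary of an
    invariant \<open>h\<close>, and modulo \<open>p\<close> the value of \<open>h\<close> on
    \<open>\<partial> d\<close> is that on \<open>(T - 1) e\<close>, namely zero.\<close>
  have c: "\<not> int p dvd c"
  proof
    assume "int p dvd c"
    have "Y.CN n (Y.nrm n (pb n \<iota> (v n)) - ?g)"
      by (rule Y.zigzag_unique[OF I.pb_zigzag[OF v] vY])
    then obtain h where h: "Y.NL n' (pb n' (\<psi> 1) h - h)" "Y.NL n (Y.nrm n (pb n \<iota> (v n)) - ?g - cobd n' h)"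
      unfolding n(1) cnull_def by auto
    have 1: "int p dvd cev (Y.nrm n (pb n \<iota> (v n))) d - cev ?g d - cev (cobd n' h) d"
      using cev_dvd_nul[OF h(2) d(1)] by (simp add: fun_diff_def cev_diff_fun)
    have "cev (cobd n' h) d = cev (pb n' (\<psi> 1) h - h) e + int p * cev h f"
      using cev_chain_boundary[of h n' d] d(3) unfolding n(1)
      by (simp add: cev_add cev_diff cev_chain_map cev_cmul fun_diff_def cev_diff_fun)
    then have 2: "int p dvd cev (cobd n' h) d" using cev_dvd_nul[OF h(1) d(2)] by simp
    have "int p dvd cev (Y.nrm n (pb n \<iota> (v n))) d" using \<open>int p dvd c\<close> unfolding c_def D(3) .
    from dvd_diff[OF dvd_diff[OF this 1] 2] d(4) show False by simp
  qed
  obtain c' where c': "int p dvd c' * c - 1"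
  proof -
    have "prime (int p)" using prime_p by simp
    from prime_imp_coprime[OF this c] have "coprime c (int p)" by (simp add: coprime_commute)
    then obtain a b where "a * c + b * int p = 1" using bezout_int[of c "int p"] by auto
    then have "a * c - 1 = int p * (- b)" by (simp add: algebra_simps)
    then show thesis using that[of a] by simp
  qed
  \<comment> \<open>The factor \<open>c'\<close>, inverse to \<open>c\<close> modulo
    \<open>p\<close>, normalizes the augmentation to 1.\<close>
  define w where "w k = smul c' (?sl k (v (Suc (k + n))))" for k
  \<comment> \<open>\<open>n + 1\<close> is even, so the differentials with indices
    \<open>k + n + 1\<close> and \<open>k\<close> have the same form.\<close>
  have slop: "X.NL k (?sl k (J.opr (Suc (k + n)) (Suc (k + n)) u) - X.opr k k (?sl k u))" for k u
  proof (cases "odd k")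
    case True
    then show ?thesis using sl_tw[OF D(1) inv, of k u] n(2) by (simp add: op_def sl_diff)
  next
    case False
    then show ?thesis using sl_nrm[OF D(1) inv, of k u] n(2) by (simp add: op_def)
  qed
  have vz: "J.NL (Suc k) (cobd k (v k) - J.opr (Suc k) (Suc k) (v (Suc k)))" for k
    using v by (simp add: zigzag_def)
  have "X.ZZ w"
    unfolding zigzag_def
  proof (intro conjI allI)
    have "J.NL (Suc (0 + n)) (cobd n (v n) - J.opr (Suc n) (Suc n) (v (Suc n)))" using vz[of n] by simp
    from sl_nul[OF D(1) this] have "X.NL 0 (?sl 0 (cobd n (v n)) - ?sl 0 (J.opr (Suc n) (Suc n) (v (Suc n))))"
      by (simp only: sl_diff)
    from nul_trans[OF this slop[of 0 "v (Suc n)", unfolded add_0]]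
    have a: "X.NL 0 (?sl 0 (cobd n (v n)) - X.nrm 0 (?sl 0 (v (Suc n))))" by (simp add: op_def)
    have b: "X.NL 0 (?sl 0 (cobd n (v n)) - smul c 1)"
      using sl_cobd_0[OF n(1) D(2), of "v n" _ x0]
      by (simp add: nul_def smul_def c_def \<iota>_def[abs_def])
    from nul_diff[OF b a] have "X.NL 0 (X.nrm 0 (?sl 0 (v (Suc n))) - smul c 1)" by simp
    from nul_smul[OF this, of c'] have "X.NL 0 (X.nrm 0 (w 0) - smul c' (smul c 1))"
      by (simp only: w_def smul_diff nm_smul add_0)
    moreover have "X.NL 0 (smul c' (smul c 1) - 1)" using c' by (simp add: nul_def smul_def)
    ultimately show "X.NL 0 (X.nrm 0 (w 0) - 1)" by (rule nul_trans)
    fix k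
    have "X.NL (Suc k) (?sl (Suc k) (cobd (Suc (k + n)) (v (Suc (k + n)))) -
        ?sl (Suc k) (J.opr (Suc (Suc k + n)) (Suc (Suc k + n)) (v (Suc (Suc k + n)))))"
      using sl_nul[OF D(1), of "Suc k", unfolded add_Suc, OF vz[of "Suc (k + n)"]] by (simp only: sl_diff add_Suc)
    from nul_trans[OF nul_sym[OF sl_cobd[OF n(1) D(2)]] nul_trans[OF this slop[of "Suc k"]]]
    have "X.NL (Suc k) (cobd k (?sl k (v (Suc (k + n)))) - X.opr (Suc k) (Suc k) (?sl (Suc k) (v (Suc (Suc k + n)))))" .
    from nul_smul[OF this, of c'] show "X.NL (Suc k) (cobd k (w k) - X.opr (Suc k) (Suc k) (w (Suc k)))"
      by (simp only: w_def smul_diff op_smul cobd_smul)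
  qed
  have "J.CN (Suc (Suc (m' + n))) (J.nrm (Suc (m + n)) (v (Suc (m + n))))" using nJ m by simp
  then obtain h where h: "J.NL (Suc (m' + n)) (pb (Suc (m' + n)) (jact 1) h - h)"
    "J.NL (Suc (m + n)) (J.nrm (Suc (m + n)) (v (Suc (m + n))) - cobd (Suc (m' + n)) h)"
    unfolding m cnull_def by auto
  \<comment> \<open>An invariant primitive on the join slants to an invariant primitive on
    \<open>X\<close>.\<close>
  have hi: "X.NL m' (pb m' (\<phi> 1) (?sl m' h) - ?sl m' h)"
    using nul_trans[OF nul_sym[OF sl_tw[OF D(1) inv, of m' h]] sl_nul[OF D(1) h(1), unfolded sl_diff]] .
  have "X.NL m (?sl m (J.nrm (Suc (m + n)) (v (Suc (m + n)))) - ?sl m (cobd (Suc (m' + n)) h))"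
    using sl_nul[OF D(1) h(2)] by (simp only: sl_diff)
  from nul_trans[OF nul_sym[OF sl_nrm[OF D(1) inv]] nul_trans[OF this sl_cobd[OF n(1) D(2), of m' h, folded m]]]
  have "X.NL m (X.nrm m (?sl m (v (Suc (m + n)))) - cobd m' (?sl m' h))" .
  then have "X.CN m (X.nrm m (?sl m (v (Suc (m + n)))))"
    using hi unfolding m cnull_def by auto
  from cnull_smul[OF this, of c'] have "X.CN m (X.nrm m (w m))" by (simp only: w_def nm_smul)
  from cnull_add[OF X.zigzag_unique[OF vX \<open>X.ZZ w\<close>] this] show ?thesis by simp
qed

end

text \<open>An odd value is not the dummy value 0, so the set of degrees is non-empty, and
  compactness makes it finite. Hence the value is attained and the next degree is not.\<close>

lemma hind_odd_degrees:
  assumes p: "prime p" and fa: "free_action (integer_mod_group p) X \<phi>" and comp: "compact_space X"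
    and odd: "odd (hind p X \<phi>)"
  obtains f v where "equivariant_map (integer_mod_group p) X \<phi> EG_space (EG_act p) f"
    "zigzag p X (\<phi> 1) v"
    "\<not> cnull p X (\<phi> 1) (hind p X \<phi>) (nm p (\<phi> 1) (hind p X \<phi>) (v (hind p X \<phi>)))"
    "cnull p X (\<phi> 1) (Suc (hind p X \<phi>)) (nm p (\<phi> 1) (Suc (hind p X \<phi>)) (v (Suc (hind p X \<phi>))))"
proof -
  have ne: "hind_degrees p X \<phi> \<noteq> {}" using odd by (auto simp: hind_def)
  then obtain f where f: "equivariant_map (integer_mod_group p) X \<phi> EG_space (EG_act p) f"
    by (auto simp: hind_degrees_def Let_def)
  interpret cyclic_cover p X "\<phi> 1" "orbit_space (integer_mod_group p) X \<phi>" "orbit (integer_mod_group p) \<phi>"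
    by (rule orbit_space_cover[OF p fa f])
  obtain v where v: "ZZ v" using zigzag_exists by blast
  obtain a where a: "CN (2 * a) (nrm (2 * a) (v (2 * a)))" using compact_null[OF v comp] by blast
  have iff: "k \<in> hind_degrees p X \<phi> \<longleftrightarrow> \<not> CN k (nrm k (v k))" for k
    by (rule hind_degrees_iff[OF p fa f v])
  have "hind_degrees p X \<phi> \<subseteq> {..<2 * a}"
    using zigzag_null_ge[OF v _ a] iff by (metis dvd_triv_left lessThan_iff not_le subsetI)
  then have fin: "finite (hind_degrees p X \<phi>)" using finite_subset by blast
  have h: "hind p X \<phi> = Max (hind_degrees p X \<phi>)" using ne by (simp add: hind_def)
  have "hind p X \<phi> \<in> hind_degrees p X \<phi>" unfolding h using fin ne by (rule Max_in)
  moreover have "Suc (hind p X \<phi>) \<notin> hind_degrees p X \<phi>"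
    using Max_ge[OF fin] unfolding h by (metis not_less_eq_eq order_refl)
  ultimately show thesis using that[OF f v] iff by blast
qed

lemma invariant_triangulation_compact:
  assumes "invariant_triangulation G X \<phi> K h"
  shows "compact_space X"
proof -
  have K: "simplicial_complex K" and h: "homeomorphic_map (top_of_set (\<Union>K)) X h"
    using assms by (auto simp: invariant_triangulation_def)
  have "compact S" if "S \<in> K" for S
    using K that compact_simplex unfolding simplicial_complex_def by blast
  moreover have "finite K" using K by (simp add: simplicial_complex_def)
  ultimately have "compact (\<Union>K)" by (intro compact_Union)
  then have "compact_space (top_of_set (\<Union>K))" by (simp add: compact_space_subtopology)
  then show ?thesis
    using homeomorphic_compact_space[OF homeomorphic_map_imp_homeomorphic_space[OF h]] by simp
qed

theorem theorem2p6:
  fixes p :: nat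
    and X :: "'a topology" and \<phi> :: "int \<Rightarrow> 'a \<Rightarrow> 'a"
    and Y :: "'b topology" and \<psi> :: "int \<Rightarrow> 'b \<Rightarrow> 'b"
    and K :: "'m::euclidean_space set set" and h :: "'m \<Rightarrow> 'a"
    and L :: "'n::euclidean_space set set" and k :: "'n \<Rightarrow> 'b"
  assumes "prime p" and "odd p"
    and "invariant_triangulation (integer_mod_group p) X \<phi> K h"
    and "free_action (integer_mod_group p) X \<phi>"
    and "invariant_triangulation (integer_mod_group p) Y \<psi> L k"
    and "free_action (integer_mod_group p) Y \<psi>"
    and "odd (hind p X \<phi>)" and "odd (hind p Y \<psi>)"
  shows "hind p (join_space X Y) (join_action X \<phi> Y \<psi>) = hind p X \<phi> + hind p Y \<psi> + 1"
proof -
  let ?m = "hind p X \<phi>" and ?n = "hind p Y \<psi>"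
  interpret free_join p X \<phi> Y \<psi>
    by (rule free_join.intro[OF assms(1,4,6)])
  obtain fX vX where fX: "equivariant_map G X \<phi> EG_space (EG_act p) fX" and vX: "X.ZZ vX"
    and X1: "\<not> X.CN ?m (X.nrm ?m (vX ?m))" and X0: "X.CN (Suc ?m) (X.nrm (Suc ?m) (vX (Suc ?m)))"
    by (rule hind_odd_degrees[OF assms(1,4) invariant_triangulation_compact[OF assms(3)] assms(7)])
  obtain fY vY where fY: "equivariant_map G Y \<psi> EG_space (EG_act p) fY" and vY: "Y.ZZ vY"
    and Y1: "\<not> Y.CN ?n (Y.nrm ?n (vY ?n))" and Y0: "Y.CN (Suc ?n) (Y.nrm (Suc ?n) (vY (Suc ?n)))"
    by (rule hind_odd_degrees[OF assms(1,6) invariant_triangulation_compact[OF assms(5)] assms(8)])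
  obtain f where f: "equivariant_map G J jact EG_space (EG_act p) f"
    by (rule join_equivariant_EG[OF fX fY])
  obtain v where v: "J.ZZ v"
    by (rule J.zigzag_exists)
  have degrees: "k \<in> hind_degrees p J jact \<longleftrightarrow> \<not> J.CN k (J.nrm k (v k))" for k
    by (rule hind_degrees_iff[OF assms(1) free_action_join f v])
  \<comment> \<open>Oddness of the index makes the degree \<open>?m + 1\<close>, where the class of
    \<open>X\<close> vanishes, even, as the product argument demands of its left factor.\<close>
  obtain a where a: "Suc ?m = 2 * a"
    using assms(7) by (metis even_Suc evenE)
  obtain m' n' where m': "?m = Suc m'" and n': "?n = Suc n'"
    using assms(7,8) by (metis even_zero not0_implies_Suc)
  have top: "?m + ?n + 1 \<in> hind_degrees p J jact"
  proof (rule ccontr)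
    assume "?m + ?n + 1 \<notin> hind_degrees p J jact"
    then have "J.CN (Suc (?m + ?n)) (J.nrm (Suc (?m + ?n)) (v (Suc (?m + ?n))))"
      by (simp add: degrees)
    from join_lower[OF v vX vY n' assms(8) m' Y1 this] X1 show False by (rule notE[rotated])
  qed
  have "J.CN (2 * a + Suc ?n) (J.nrm (2 * a + Suc ?n) (v (2 * a + Suc ?n)))"
    by (rule join_upper[OF v vX vY X0[unfolded a] Y0])
  \<comment> \<open>\<open>?m + ?n + 2\<close> is even as well, so the vanishing propagates to all
    higher degrees.\<close>
  moreover have "even (2 * a + Suc ?n)" using assms(8) by simp
  ultimately have null: "J.CN k (J.nrm k (v k))" if "2 * a + Suc ?n \<le> k" for k
    using J.zigzag_null_ge[OF v _ _ that] by blast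
  have bound: "k \<le> ?m + ?n + 1" if "k \<in> hind_degrees p J jact" for k
  proof (rule ccontr)
    assume "\<not> k \<le> ?m + ?n + 1"
    then have "2 * a + Suc ?n \<le> k" using a by linarith
    from null[OF this] that show False unfolding degrees by (rule notE[rotated])
  qed
  have "finite (hind_degrees p J jact)"
    by (rule finite_subset[of _ "{..?m + ?n + 1}"]) (use bound in auto)
  then have "Max (hind_degrees p J jact) = ?m + ?n + 1"
    by (rule Max_eqI[OF _ bound top])
  moreover have "hind_degrees p J jact \<noteq> {}" using top by blast
  ultimately show ?thesis by (simp add: hind_def)
qed

end
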